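(* Let $\alpha$ be a self-dual algebra norm of $V$ split by $V=V^0\perp W$, where $V^0$ is a split composition subalgebra of dimension 2, with orthogonal idempotents $e^+$ and $e^-$. Let $W=W^+\oplus W^-$ be the associated complete polarization of $W$: $W^+=e^+W$, $W^-=e^-W$. (i) The restriction of $\alpha$ to $W$ is split by $W=W^+\oplus W^-$, hence is of the form $\alpha^+\wedge\alpha^-$ with $\alpha^-=(\alpha^+)^\sharp$. (ii) For every basis $(f_1^+,f_2^+,f_3^+)$ of $W^+$ let $(f_1^-,f_2^-,f_3^-)$ be the dual basis of $W^-$. Then $f_1^-f_2^-$ is a nonzero multiple of $f_3^+$. Call special basis of $W^+$ any basis $(f_1^+,f_2^+,f_3^+)$ such that $f_3^+=f_1^-f_2^-$. The lattices generated by the special bases of $W^+$ all have the same volume. (iii) Normalize the volume so that the lattices generated by special bases of $W^+$ have volume zero. Then the restriction of $\alpha$ to $W^+$ has volume zero. (iv) Conversely, let $\alpha^+$ be a norm of $W^+$ of volume zero for the normalization of the volume in which the lattices generated by special bases of $W^+$ have volume zero, let $\alpha^-=(\alpha^+)^\sharp$, a norm of $W^-$, and let $\alpha_0$ be the unique self-dual algebra norm of $V^0$. Then $\alpha_0\wedge\alpha^+\wedge\alpha^-$ is a self-dual algebra norm of $V$, the unique such norm split by $V=V^0\perp W$ and extending $\alpha^+$.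
   Context: $F$ is a non-archimedean local field of residual characteristic $p\notin\{2,3\}$, with normalized valuation $v_F$. $V$ is the (split) octonion algebra over $F$, with unit $\mathit 1$, multiplicative norm $Q$ and bilinear form $f$ with $f(x,x)=2Q(x)$. A composition subalgebra is a unital subalgebra on which $Q$ is nondegenerate; $W=(V^0)^\perp$. A split composition subalgebra $V^0$ of dimension 2 has a unique pair of idempotents $e^\pm$ with $e^+e^-=0$ (then $e^++e^-=\mathit 1$); the subspaces $W^\pm=e^\pm W$ are totally isotropic and put in duality by $f$. A (rational) norm on an $F$-space $X$ is $\alpha:X\to\mathbb Q\cup\{\infty\}$ with $\alpha(x+y)\ge\inf(\alpha(x),\alpha(y))$, $\alpha(\xi x)=v_F(\xi)+\alpha(x)$ for $\xi\in F$, and $\alpha(x)=\infty\iff x=0$. A norm on $V$ (or on a nondegenerate subspace) is self-dual if $\alpha(v)=\inf_x(v_F(f(v,x))-\alpha(x))$ for all $v$ ($x$ running over the space), and (on $V$ or a subalgebra) an algebra norm if $\alpha(xy)\ge\alpha(x)+\alpha(y)$. For norms $\alpha_i$ on $X_i$, $(\alpha_1\wedge\alpha_2)(x_1+x_2)=\min\{\alpha_1(x_1),\alpha_2(x_2)\}$ on $X_1\oplus X_2$; a norm on $X_1\oplus X_2$ is split by the decomposition if it equals the $\wedge$ of its restrictions. A basis splits a norm if the decomposition into the corresponding lines does. For a norm $\alpha^+$ on $W^+$, $(\alpha^+)^\sharp(v)=\inf_{x\in W^+}(v_F(f(v,x))-\alpha^+(x))$ for $v\in W^-$. The volume of a lattice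 $L$ in a finite-dimensional space is defined, after choice of a reference lattice $L_0$, by $\mathrm{vol}(L)=v_F(\det g)$ if $gL_0=L$ (so it is defined up to a common additive constant). The volume of a norm $\alpha$ is $\mathrm{vol}\,\alpha=\mathrm{vol}\,L-\sum_i\alpha(e_i)$, where $(e_i)$ is a basis splitting $\alpha$ and $L$ is the lattice it generates (independent of the splitting basis). *)

theory Defs
  imports
    "HOL-Library.Extended_Real"
    "HOL-Computational_Algebra.Primes"
    "Jordan_Normal_Form.Determinant"
begin

section \<open>Local fields and octonion algebras\<close>

text \<open>
  A non-archimedean local field with normalized valuation \<open>v\<close> and residual characteristic \<open>p\<close>:
  complete, discretely valued, with finite residue field. The residue field is the quotient of the
  valuation ring by congruence modulo its maximal ideal; its characteristic is the prime \<open>p\<close>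
  that lies in the maximal ideal.
\<close>

locale local_field =
  fixes v :: "'a::field \<Rightarrow> ereal" and p :: nat
  assumes v_eq_infty_iff: "v x = \<infinity> \<longleftrightarrow> x = 0"
    and v_integral: "x \<noteq> 0 \<Longrightarrow> \<exists>n::int. v x = ereal (of_int n)"
    and v_mult: "v (x * y) = v x + v y"
    and v_add: "min (v x) (v y) \<le> v (x + y)"
    and v_normalized: "\<exists>x. v x = 1"
    and v_complete:
      "(\<forall>B::real. \<exists>N::nat. \<forall>m\<ge>N. \<forall>n\<ge>N. ereal B \<le> v (X m - X n)) \<Longrightarrow>
       (\<exists>l. \<forall>B::real. \<exists>N::nat. \<forall>n\<ge>N. ereal B \<le> v (X n - l))"
    and finite_residue_field:
      "finite ({x. 0 \<le> v x} // {(x, y). 0 \<le> v x \<and> 0 \<le> v y \<and> 0 < v (x - y)})"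
    and residue_char: "prime p" "0 < v (of_nat p)"

definition polar :: "('v::ab_group_add \<Rightarrow> 'a::ab_group_add) \<Rightarrow> 'v \<Rightarrow> 'v \<Rightarrow> 'a" where
  "polar Q x y = Q (x + y) - Q x - Q y"

text \<open>
  Octonion algebras are the 8-dimensional unital composition algebras (not associative);
  such an algebra is split iff its norm form is isotropic.
\<close>

locale split_octonion_algebra = vector_space scale
  for scale :: "'a::field \<Rightarrow> 'v::ab_group_add \<Rightarrow> 'v" +
  fixes mul :: "'v \<Rightarrow> 'v \<Rightarrow> 'v" and unit :: 'v and Q :: "'v \<Rightarrow> 'a"
  assumes dim_8: "dim UNIV = 8"
    and mult_add_left: "mul (x + y) z = mul x z + mul y z"
    and mult_add_right: "mul x (y + z) = mul x y + mul x z"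
    and mult_scale_left: "mul (scale c x) y = scale c (mul x y)"
    and mult_scale_right: "mul x (scale c y) = scale c (mul x y)"
    and unit_left: "mul unit x = x"
    and unit_right: "mul x unit = x"
    and Q_scale: "Q (scale c x) = c\<^sup>2 * Q x"
    and polar_add: "polar Q (x + y) z = polar Q x z + polar Q y z"
    and polar_scale: "polar Q (scale c x) y = c * polar Q x y"
    and nondegenerate: "(\<And>y. polar Q x y = 0) \<Longrightarrow> x = 0"
    and Q_mult: "Q (mul x y) = Q x * Q y"
    and isotropic: "\<exists>x. x \<noteq> 0 \<and> Q x = 0"
begin

lemma polar_self: "polar Q x x = 2 * Q x"
proof -
  have "x + x = scale 2 x"
    by (metis one_add_one scale_left_distrib scale_one)
  hence "Q (x + x) = 4 * Q x"
    by (simp add: Q_scale)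
  thus ?thesis
    by (simp add: polar_def)
qed

end

definition composition_subalgebra ::
  "('a::field \<Rightarrow> 'v::ab_group_add \<Rightarrow> 'v) \<Rightarrow> ('v \<Rightarrow> 'v \<Rightarrow> 'v) \<Rightarrow> 'v \<Rightarrow> ('v \<Rightarrow> 'a) \<Rightarrow> 'v set \<Rightarrow> bool" where
  "composition_subalgebra scale mul unit Q A \<longleftrightarrow>
     Modules.module.subspace scale A \<and> unit \<in> A \<and> (\<forall>x\<in>A. \<forall>y\<in>A. mul x y \<in> A) \<and>
     (\<forall>x\<in>A. (\<forall>y\<in>A. polar Q x y = 0) \<longrightarrow> x = 0)"

definition split_composition_subalgebra ::
  "('a::field \<Rightarrow> 'v::ab_group_add \<Rightarrow> 'v) \<Rightarrow> ('v \<Rightarrow> 'v \<Rightarrow> 'v) \<Rightarrow> 'v \<Rightarrow> ('v \<Rightarrow> 'a) \<Rightarrow> 'v set \<Rightarrow> bool" where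
  "split_composition_subalgebra scale mul unit Q A \<longleftrightarrow>
     composition_subalgebra scale mul unit Q A \<and> (\<exists>x\<in>A. x \<noteq> 0 \<and> Q x = 0)"

definition orth_compl :: "('v \<Rightarrow> 'v \<Rightarrow> 'a::zero) \<Rightarrow> 'v set \<Rightarrow> 'v set" where
  "orth_compl f A = {x. \<forall>y\<in>A. f x y = 0}"

section \<open>Norms\<close>

text \<open>
  A norm on a subspace \<open>X\<close> is a function on the ambient type of which only the values on \<open>X\<close> matter.
\<close>

definition norm_on ::
  "('a::field \<Rightarrow> ereal) \<Rightarrow> ('a \<Rightarrow> 'v::ab_group_add \<Rightarrow> 'v) \<Rightarrow> 'v set \<Rightarrow> ('v \<Rightarrow> ereal) \<Rightarrow> bool" where
  "norm_on v scale X \<alpha> \<longleftrightarrow>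
     (\<forall>x\<in>X. \<alpha> x \<in> insert \<infinity> (ereal ` \<rat>)) \<and>
     (\<forall>x\<in>X. \<forall>y\<in>X. min (\<alpha> x) (\<alpha> y) \<le> \<alpha> (x + y)) \<and>
     (\<forall>c. \<forall>x\<in>X. \<alpha> (scale c x) = v c + \<alpha> x) \<and>
     (\<forall>x\<in>X. \<alpha> x = \<infinity> \<longleftrightarrow> x = 0)"

text \<open>
  The term at \<open>x = 0\<close> of the infimum is \<open>\<infinity> - \<infinity>\<close>, which is \<open>\<infinity>\<close> in \<^typ>\<open>ereal\<close> and hence
  does not contribute.
\<close>

definition dual_norm ::
  "('a \<Rightarrow> ereal) \<Rightarrow> ('v \<Rightarrow> 'v \<Rightarrow> 'a) \<Rightarrow> 'v set \<Rightarrow> ('v \<Rightarrow> ereal) \<Rightarrow> 'v \<Rightarrow> ereal" where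
  "dual_norm v f X \<alpha> y = (INF x\<in>X. v (f y x) - \<alpha> x)"

definition self_dual_algebra_norm ::
  "('a::field \<Rightarrow> ereal) \<Rightarrow> ('a \<Rightarrow> 'v::ab_group_add \<Rightarrow> 'v) \<Rightarrow> ('v \<Rightarrow> 'v \<Rightarrow> 'v) \<Rightarrow> ('v \<Rightarrow> 'v \<Rightarrow> 'a) \<Rightarrow>
     'v set \<Rightarrow> ('v \<Rightarrow> ereal) \<Rightarrow> bool" where
  "self_dual_algebra_norm v scale mul f X \<alpha> \<longleftrightarrow>
     norm_on v scale X \<alpha> \<and>
     (\<forall>y\<in>X. \<alpha> y = dual_norm v f X \<alpha> y) \<and>
     (\<forall>x\<in>X. \<forall>y\<in>X. \<alpha> x + \<alpha> y \<le> \<alpha> (mul x y))"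

definition direct_sum ::
  "('a::field \<Rightarrow> 'v::ab_group_add \<Rightarrow> 'v) \<Rightarrow> 'v set \<Rightarrow> 'v set \<Rightarrow> 'v set \<Rightarrow> bool" where
  "direct_sum scale X A B \<longleftrightarrow>
     Modules.module.subspace scale A \<and> Modules.module.subspace scale B \<and>
     A \<inter> B = {0} \<and> X = {a + b | a b. a \<in> A \<and> b \<in> B}"

definition wedge ::
  "'v::ab_group_add set \<Rightarrow> 'v set \<Rightarrow> ('v \<Rightarrow> ereal) \<Rightarrow> ('v \<Rightarrow> ereal) \<Rightarrow> 'v \<Rightarrow> ereal" where
  "wedge A B \<alpha> \<beta> x = (THE r. \<exists>a\<in>A. \<exists>b\<in>B. x = a + b \<and> r = min (\<alpha> a) (\<beta> b))"

definition norm_split_by ::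
  "('a::field \<Rightarrow> 'v::ab_group_add \<Rightarrow> 'v) \<Rightarrow> 'v set \<Rightarrow> 'v set \<Rightarrow> 'v set \<Rightarrow> ('v \<Rightarrow> ereal) \<Rightarrow> bool" where
  "norm_split_by scale X A B \<alpha> \<longleftrightarrow>
     direct_sum scale X A B \<and> (\<forall>x\<in>X. \<alpha> x = wedge A B \<alpha> \<alpha> x)"

section \<open>Bases, lattices and volumes\<close>

definition basis_of ::
  "('a::field \<Rightarrow> 'v::ab_group_add \<Rightarrow> 'v) \<Rightarrow> 'v set \<Rightarrow> 'v list \<Rightarrow> bool" where
  "basis_of scale X bs \<longleftrightarrow>
     distinct bs \<and> \<not> Modules.module.dependent scale (set bs) \<and> Modules.module.span scale (set bs) = X"

definition dual_basis_of ::
  "('a::field \<Rightarrow> 'v::ab_group_add \<Rightarrow> 'v) \<Rightarrow> ('v \<Rightarrow> 'v \<Rightarrow> 'a) \<Rightarrow> 'v set \<Rightarrow> 'v list \<Rightarrow> 'v list \<Rightarrow> bool" where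
  "dual_basis_of scale f Y bs cs \<longleftrightarrow>
     basis_of scale Y cs \<and> length cs = length bs \<and>
     (\<forall>i<length bs. \<forall>j<length bs. f (bs ! i) (cs ! j) = (if i = j then 1 else 0))"

definition lattice_gen ::
  "('a::field \<Rightarrow> ereal) \<Rightarrow> ('a \<Rightarrow> 'v::ab_group_add \<Rightarrow> 'v) \<Rightarrow> 'v list \<Rightarrow> 'v set" where
  "lattice_gen v scale bs =
     {\<Sum>i<length bs. scale (c i) (bs ! i) | c. \<forall>i<length bs. 0 \<le> v (c i)}"

definition lattice_in ::
  "('a::field \<Rightarrow> ereal) \<Rightarrow> ('a \<Rightarrow> 'v::ab_group_add \<Rightarrow> 'v) \<Rightarrow> 'v set \<Rightarrow> 'v set \<Rightarrow> bool" where
  "lattice_in v scale X L \<longleftrightarrow> (\<exists>bs. basis_of scale X bs \<and> L = lattice_gen v scale bs)"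

text \<open>The determinant of an endomorphism of \<open>X\<close>, computed in an arbitrary basis of \<open>X\<close>.\<close>

definition endo_det ::
  "('a::field \<Rightarrow> 'v::ab_group_add \<Rightarrow> 'v) \<Rightarrow> 'v set \<Rightarrow> ('v \<Rightarrow> 'v) \<Rightarrow> 'a" where
  "endo_det scale X g =
     (let bs = (SOME bs. basis_of scale X bs) in
      Determinant.det (mat (length bs) (length bs)
        (\<lambda>(i, j). Modules.module.representation scale (set bs) (g (bs ! j)) (bs ! i))))"

text \<open>
  The volume in \<open>X\<close> with respect to the reference lattice \<open>L0\<close>; changing \<open>L0\<close> changes it by an
  additive constant. Automorphisms of \<open>X\<close> are represented by linear maps of the ambient space that
  restrict to a bijection of \<open>X\<close>; every automorphism of \<open>X\<close> extends to such a map.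
\<close>

definition lattice_vol ::
  "('a::field \<Rightarrow> ereal) \<Rightarrow> ('a \<Rightarrow> 'v::ab_group_add \<Rightarrow> 'v) \<Rightarrow> 'v set \<Rightarrow> 'v set \<Rightarrow> 'v set \<Rightarrow> ereal" where
  "lattice_vol v scale X L0 L =
     (THE r. \<exists>g. Vector_Spaces.linear scale scale g \<and> bij_betw g X X \<and> g ` L0 = L \<and>
                 r = v (endo_det scale X g))"

definition basis_splits_norm ::
  "('a::field \<Rightarrow> 'v::ab_group_add \<Rightarrow> 'v) \<Rightarrow> 'v list \<Rightarrow> ('v \<Rightarrow> ereal) \<Rightarrow> bool" where
  "basis_splits_norm scale bs \<alpha> \<longleftrightarrow>
     (\<forall>c. \<alpha> (\<Sum>i<length bs. scale (c i) (bs ! i)) = (INF i\<in>{..<length bs}. \<alpha> (scale (c i) (bs ! i))))"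

definition norm_vol ::
  "('a::field \<Rightarrow> ereal) \<Rightarrow> ('a \<Rightarrow> 'v::ab_group_add \<Rightarrow> 'v) \<Rightarrow> 'v set \<Rightarrow> 'v set \<Rightarrow> ('v \<Rightarrow> ereal) \<Rightarrow> ereal" where
  "norm_vol v scale X L0 \<alpha> =
     (THE r. \<exists>bs. basis_of scale X bs \<and> basis_splits_norm scale bs \<alpha> \<and>
        r = lattice_vol v scale X L0 (lattice_gen v scale bs) - (\<Sum>i<length bs. \<alpha> (bs ! i)))"

definition special_basis ::
  "('a::field \<Rightarrow> 'v::ab_group_add \<Rightarrow> 'v) \<Rightarrow> ('v \<Rightarrow> 'v \<Rightarrow> 'v) \<Rightarrow> ('v \<Rightarrow> 'v \<Rightarrow> 'a) \<Rightarrow>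
     'v set \<Rightarrow> 'v set \<Rightarrow> 'v list \<Rightarrow> bool" where
  "special_basis scale mul f Wp Wm bs \<longleftrightarrow>
     (\<exists>f1 f2 f3 g1 g2 g3. bs = [f1, f2, f3] \<and> basis_of scale Wp [f1, f2, f3] \<and>
        dual_basis_of scale f Wm [f1, f2, f3] [g1, g2, g3] \<and> f3 = mul g1 g2)"

text \<open>
  Normalizing the volume on \<open>Wp\<close> means choosing the reference lattice such that the lattices
  generated by special bases have volume zero.
\<close>

definition special_normalization ::
  "('a::field \<Rightarrow> ereal) \<Rightarrow> ('a \<Rightarrow> 'v::ab_group_add \<Rightarrow> 'v) \<Rightarrow> ('v \<Rightarrow> 'v \<Rightarrow> 'v) \<Rightarrow> ('v \<Rightarrow> 'v \<Rightarrow> 'a) \<Rightarrow>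
     'v set \<Rightarrow> 'v set \<Rightarrow> 'v set \<Rightarrow> bool" where
  "special_normalization v scale mul f Wp Wm L0 \<longleftrightarrow>
     lattice_in v scale Wp L0 \<and>
     (\<forall>bs. special_basis scale mul f Wp Wm bs \<longrightarrow>
        lattice_vol v scale Wp L0 (lattice_gen v scale bs) = 0)"

end

theory Submission
  imports Defs
begin

text \<open>
  By \<open>f\<close> the 3-dimensional spaces \<open>W\<^sup>+\<close> and \<open>W\<^sup>-\<close> are dual. The form \<open>T(x, y, z) = f(xy, z)\<close>
  is alternating and trilinear on \<open>W\<^sup>+\<close>, hence multiplied by \<open>det g\<close> under an endomorphism \<open>g\<close>; dual bases \<open>f\<^sub>i\<close>, \<open>g\<^sub>i\<close> satisfy
  \<open>g\<^sub>1 g\<^sub>2 = f\<^sub>3 / T(f\<^sub>1, f\<^sub>2, f\<^sub>3)\<close>. So special bases are those with \<open>T = 1\<close>, and in the associated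
  normalization the volume of a norm is \<open>v(T(e\<^sub>1, e\<^sub>2, e\<^sub>3)) - \<Sum> \<alpha>(e\<^sub>i)\<close> for a splitting basis \<open>e\<^sub>i\<close>.

  Since \<open>\<alpha>(e\<^sup>+) = \<alpha>(e\<^sup>-) = 0\<close>, multiplication by the idempotents does not decrease \<open>\<alpha>\<close> and so splits it
  on \<open>W\<close>. The algebra inequality for \<open>e\<^sub>1 e\<^sub>2\<close> bounds the volume from one side, and the one for the
  dual basis from the other. Conversely
  the Leibniz formula gives \<open>\<alpha>(x) + \<alpha>(y) + \<alpha>(z) \<le> v(T(x, y, z))\<close> when the volume is zero, and this is
  the algebra inequality \<open>\<alpha>\<^sup>+(x) + \<alpha>\<^sup>+(y) \<le> \<alpha>\<^sup>-(xy)\<close> by definition of the dual norm.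
\<close>

section \<open>Valuations and norms\<close>

text \<open>Four facts support this outline. A norm on W+ has a volume only if some basis splits it;
  completeness of F yields one, by moving a basis vector to its best translate modulo the span of
  the later ones. That W+ has dimension 3 is derived, not given: if products vanished on W+, then V
  would have dimension at most 4 instead of 8, and a Cramer rule shows that every triple with T
  nonzero is a basis. As the multiplication is not associative, all computations go back to
  polarizations of Q(xy) = Q(x) Q(y), which turn the products W+ x W+ -> W- and W- x W- -> W+ into
  cross products with T as triple product. Finally, a lattice determines v(T) of its bases, as the
  minimum of v(T) over its triples, so volumes can be compared without change-of-basis matrices.
  Exchanging the idempotents gives another polarization, and statements on W- are obtained from
  those on W+ in this way.\<close>

context local_field
begin

lemma v_0 [simp]: "v 0 = \<infinity>"
  by (simp add: v_eq_infty_iff)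

lemma v_int:
  assumes "x \<noteq> 0"
  obtains n :: int where "v x = ereal (of_int n)"
  using v_integral[OF assms] by blast

lemma v_1 [simp]: "v 1 = 0"
proof -
  obtain n :: int where n: "v 1 = ereal (of_int n)"
    using v_int[of 1] by auto
  with v_mult[of 1 1] show ?thesis
    by (simp add: zero_ereal_def)
qed

lemma v_minus [simp]: "v (- x) = v x"
proof -
  obtain n :: int where n: "v (- 1) = ereal (of_int n)"
    using v_int[of "- 1"] by auto
  with v_mult[of "- 1" "- 1"] have "v (- 1) = 0"
    by (simp add: zero_ereal_def)
  with v_mult[of "- 1" x] show ?thesis
    by simp
qed

lemma le_v_add: "r \<le> v x \<Longrightarrow> r \<le> v y \<Longrightarrow> r \<le> v (x + y)"
  using v_add[of x y] by (meson min.boundedI order_trans)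

lemma le_v_diff: "r \<le> v x \<Longrightarrow> r \<le> v y \<Longrightarrow> r \<le> v (x - y)"
  using le_v_add[of r x "- y"] by simp

lemma v_inverse: "x \<noteq> 0 \<Longrightarrow> v (inverse x) = - v x"
proof -
  assume x: "x \<noteq> 0"
  obtain m n :: int where "v x = ereal (of_int m)" "v (inverse x) = ereal (of_int n)"
    using v_integral[OF x] v_integral[of "inverse x"] x by auto
  with v_mult[of x "inverse x"] x show ?thesis
    by (simp add: zero_ereal_def)
qed

end

context vector_space
begin

lemma span_list_iff:
  assumes "distinct bs"
  shows "x \<in> span (set bs) \<longleftrightarrow> (\<exists>c. x = (\<Sum>i<length bs. scale (c i) (bs ! i)))"
proof
  assume "x \<in> span (set bs)"
  then obtain u where "x = (\<Sum>b\<in>set bs. scale (u b) b)"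
    by (auto simp: span_finite)
  also have "\<dots> = (\<Sum>i<length bs. scale (u (bs ! i)) (bs ! i))"
    by (rule sum.reindex_bij_betw[symmetric, OF bij_betw_nth]) (auto simp: assms)
  finally show "\<exists>c. x = (\<Sum>i<length bs. scale (c i) (bs ! i))"
    by (rule exI[of _ "\<lambda>i. u (bs ! i)"])
next
  assume "\<exists>c. x = (\<Sum>i<length bs. scale (c i) (bs ! i))"
  moreover have "(\<Sum>i<length bs. scale (c i) (bs ! i)) \<in> span (set bs)" for c
    by (intro span_sum span_scale span_base) simp
  ultimately show "x \<in> span (set bs)"
    by blast
qed

end

locale valued_space = local_field v p + vector_space scale
  for v :: "'a::field \<Rightarrow> ereal" and p :: nat
    and scale :: "'a \<Rightarrow> 'v::ab_group_add \<Rightarrow> 'v"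
begin

lemma norm_on_subset: "norm_on v scale X \<alpha> \<Longrightarrow> Y \<subseteq> X \<Longrightarrow> norm_on v scale Y \<alpha>"
  unfolding norm_on_def by blast

text \<open>Closure of \<open>X\<close> under sums and multiples keeps the axioms inside
  \<open>X\<close>. This allows an explicit formula known only on a subspace to replace a given
  function there.\<close>

lemma norm_on_cong:
  assumes "subspace X" "\<And>x. x \<in> X \<Longrightarrow> \<alpha> x = \<beta> x"
  shows "norm_on v scale X \<alpha> \<longleftrightarrow> norm_on v scale X \<beta>"
  unfolding norm_on_def using assms by (simp add: subspace_add subspace_scale)

context
  fixes X :: "'v set" and \<alpha> :: "'v \<Rightarrow> ereal"
  assumes norm: "norm_on v scale X \<alpha>"
begin

lemma norm_rat:
  assumes "x \<in> X" "x \<noteq> 0"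
  obtains r where "r \<in> \<rat>" "\<alpha> x = ereal r"
  using norm assms unfolding norm_on_def by (metis imageE insertE)

lemma norm_infty_iff: "x \<in> X \<Longrightarrow> \<alpha> x = \<infinity> \<longleftrightarrow> x = 0"
  using norm unfolding norm_on_def by blast

lemma norm_scale: "x \<in> X \<Longrightarrow> \<alpha> (scale c x) = v c + \<alpha> x"
  using norm unfolding norm_on_def by blast

lemma norm_add: "x \<in> X \<Longrightarrow> y \<in> X \<Longrightarrow> min (\<alpha> x) (\<alpha> y) \<le> \<alpha> (x + y)"
  using norm unfolding norm_on_def by blast

lemma le_norm_add: "x \<in> X \<Longrightarrow> y \<in> X \<Longrightarrow> r \<le> \<alpha> x \<Longrightarrow> r \<le> \<alpha> y \<Longrightarrow> r \<le> \<alpha> (x + y)"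
  using norm_add[of x y] by (meson min.boundedI order_trans)

lemma norm_minus: "x \<in> X \<Longrightarrow> \<alpha> (- x) = \<alpha> x"
  using norm_scale[of x "- 1"] by simp

lemma le_norm_diff:
  "subspace X \<Longrightarrow> x \<in> X \<Longrightarrow> y \<in> X \<Longrightarrow> r \<le> \<alpha> x \<Longrightarrow> r \<le> \<alpha> y \<Longrightarrow> r \<le> \<alpha> (x - y)"
  using le_norm_add[of x "- y"] norm_minus[of y] by (simp add: subspace_neg)

text \<open>The isosceles principle: \<open>\<alpha> x\<close> is at least the minimum of
  \<open>\<alpha> (x - y)\<close> and \<open>\<alpha> y\<close>, and \<open>\<alpha> y\<close> is
  too large to be that minimum.\<close>

lemma norm_diff_eq:
  assumes "subspace X" "x \<in> X" "y \<in> X" "\<alpha> x < \<alpha> y"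
  shows "\<alpha> (x - y) = \<alpha> x"
proof (rule antisym)
  show "\<alpha> x \<le> \<alpha> (x - y)"
    using le_norm_diff[of x y "\<alpha> x"] assms by auto
  have "min (\<alpha> (x - y)) (\<alpha> y) \<le> \<alpha> x"
    using norm_add[of "x - y" y] assms by (simp add: subspace_diff)
  with assms(4) show "\<alpha> (x - y) \<le> \<alpha> x"
    by (metis leD min_le_iff_disj)
qed

text \<open>At \<open>x = 0\<close> the left-hand side reads \<open>a \<le> \<infinity> - \<infinity>\<close>, which is true in \<^typ>\<open>ereal\<close>.\<close>

lemma le_minus_norm_iff:
  assumes "x \<in> X" "g 0 = 0"
  shows "a \<le> v (g x) - \<alpha> x \<longleftrightarrow> a + \<alpha> x \<le> v (g x)"
proof (cases "x = 0")
  case True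
  with assms norm_infty_iff[of x] show ?thesis
    by simp
next
  case False
  then obtain r where "\<alpha> x = ereal r"
    using norm_rat assms by metis
  thus ?thesis
    by (simp add: ereal_le_minus_iff)
qed

end

section \<open>Existence of splitting bases\<close>

lemma common_denominator:
  assumes "finite (K :: real set)" "K \<subseteq> \<rat>"
  shows "\<exists>N. (0::nat) < N \<and> (\<forall>k\<in>K. k * real N \<in> \<int>)"
  using assms
proof induction
  case empty
  show ?case by auto
next
  case (insert k K)
  then obtain N where N: "(0::nat) < N" "\<And>k. k \<in> K \<Longrightarrow> k * real N \<in> \<int>"
    by blast
  have "k \<in> \<rat>"
    using insert.prems by simp
  then obtain m :: int and n :: nat where n: "n \<noteq> 0" "k = real_of_int m / real n"
    unfolding Rats_eq_int_div_nat by blast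
  have "l * real (N * n) \<in> \<int>" if "l \<in> insert k K" for l
  proof (cases "l = k")
    case True
    hence "l * real (N * n) = of_int (m * int N)"
      using n by simp
    thus ?thesis
      by (metis Ints_of_int)
  next
    case False
    hence "l * real N \<in> \<int>"
      using N(2) that by blast
    hence "l * real N * real n \<in> \<int>"
      by (rule Ints_mult) simp
    thus ?thesis
      by (simp add: mult.assoc)
  qed
  with N(1) n(1) show ?case
    by (intro exI[of _ "N * n"]) auto
qed

context
  fixes es :: "'v list" and \<alpha> :: "'v \<Rightarrow> ereal" and X :: "'v set"
  assumes es: "distinct es" "independent (set es)" "set es \<subseteq> X"
    and splits: "basis_splits_norm scale es \<alpha>"
    and X: "subspace X" "norm_on v scale X \<alpha>"
begin

lemma nth_es: "i < length es \<Longrightarrow> es ! i \<in> X \<and> es ! i \<noteq> 0"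
  using es nth_mem dependent_zero by (metis subsetD)

lemma splitting_norm_eq:
  "\<alpha> (\<Sum>i<length es. scale (c i) (es ! i)) = (INF i\<in>{..<length es}. v (c i) + \<alpha> (es ! i))"
proof -
  have "\<alpha> (scale (c i) (es ! i)) = v (c i) + \<alpha> (es ! i)" if "i < length es" for i
    using that norm_scale[OF X(2)] nth_es by blast
  thus ?thesis
    using splits unfolding basis_splits_norm_def by simp
qed

text \<open>The infimum over finitely many indices is attained, so \<open>\<alpha> h\<close> is an
  integer plus one of the rational numbers \<open>\<alpha> (es ! i)\<close>; \<open>N\<close> is a
  common denominator of the latter.\<close>

lemma norm_values_discrete:
  obtains N where "(0::nat) < N"
    "\<And>h. h \<in> span (set es) \<Longrightarrow> h \<noteq> 0 \<Longrightarrow> \<exists>m::int. \<alpha> h = ereal (of_int m / real N)"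
proof -
  define K where "K = (\<lambda>e. real_of_ereal (\<alpha> e)) ` set es"
  have K: "real_of_ereal (\<alpha> (es ! i)) \<in> K" if "i < length es" for i
    using that by (auto simp: K_def)
  have "K \<subseteq> \<rat>"
  proof
    fix k assume "k \<in> K"
    then obtain i where "i < length es" "k = real_of_ereal (\<alpha> (es ! i))"
      by (auto simp: K_def in_set_conv_nth)
    with nth_es norm_rat[OF X(2)] show "k \<in> \<rat>"
      by (metis real_of_ereal.simps(1))
  qed
  then obtain N where N: "(0::nat) < N" "\<And>k. k \<in> K \<Longrightarrow> k * real N \<in> \<int>"
    using common_denominator[of K] by (auto simp: K_def)
  show thesis
  proof (rule that[OF N(1)])
    fix h assume h: "h \<in> span (set es)" "h \<noteq> 0"
    then obtain c where c: "h = (\<Sum>i<length es. scale (c i) (es ! i))"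
      using es by (auto simp: span_list_iff)
    have "length es > 0"
      using h c by (cases "length es") auto
    hence "(INF i\<in>{..<length es}. v (c i) + \<alpha> (es ! i)) \<in> (\<lambda>i. v (c i) + \<alpha> (es ! i)) ` {..<length es}"
      by (subst Min_Inf[symmetric]) (auto intro!: Min_in)
    then obtain i where i: "i < length es" "\<alpha> h = v (c i) + \<alpha> (es ! i)"
      using splitting_norm_eq[of c] c by auto
    obtain k where k: "\<alpha> (es ! i) = ereal k"
      using nth_es i norm_rat[OF X(2)] by metis
    have "h \<in> X"
      using h span_minimal[OF es(3) X(1)] by blast
    hence "\<alpha> h \<noteq> \<infinity>"
      using norm_infty_iff[OF X(2)] h by blast
    hence "c i \<noteq> 0"
      using i k by auto
    then obtain n :: int where n: "v (c i) = ereal n"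
      by (auto elim: v_int)
    obtain m :: int where m: "k * N = m"
      using N(2) K i(1) k by (metis Ints_cases real_of_ereal.simps(1))
    have "n + k = (n * N + m) / N"
      using m[symmetric] N(1) by (simp add: field_simps)
    hence "\<alpha> h = ereal ((n * N + m :: int) / N)"
      using i n k by simp
    thus "\<exists>m::int. \<alpha> h = ereal (of_int m / real N)"
      by blast
  qed
qed

text \<open>
  By discreteness of the values a supremum that is not attained is infinite, and by completeness
  it is then attained in the limit, at \<open>0\<close>.
\<close>

lemma best_approximation:
  assumes x: "x \<in> X" "x \<notin> span (set es)"
  obtains h where "h \<in> span (set es)" "\<And>h'. h' \<in> span (set es) \<Longrightarrow> \<alpha> (x + h') \<le> \<alpha> (x + h)"
proof (rule ccontr)
  assume "\<not> thesis"
  with that have ex: "\<exists>h'\<in>span (set es). \<alpha> (x + h) < \<alpha> (x + h')" if "h \<in> span (set es)" for h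
    using \<open>h \<in> span (set es)\<close> by (meson not_le)
  have sub: "span (set es) \<subseteq> X"
    using span_minimal[OF es(3) X(1)] .
  have inX: "x + h \<in> X" if "h \<in> span (set es)" for h
    using that x sub X by (auto intro: subspace_add)
  obtain N :: nat where N: "(0::nat) < N"
    "\<And>h. h \<in> span (set es) \<Longrightarrow> h \<noteq> 0 \<Longrightarrow> \<exists>m::int. \<alpha> h = ereal (of_int m / real N)"
    using norm_values_discrete by blast
  \<comment> \<open>Discreteness is known only on the span, which does not contain
    \<open>x + h\<close>. Since some \<open>x + h'\<close> is strictly better, the isosceles
    principle gives \<open>\<alpha> (x + h) = \<alpha> (h - h')\<close>, and \<open>h - h'\<close>
    lies in the span.\<close>
  have val: "\<exists>m::int. \<alpha> (x + h) = ereal (of_int m / real N)" if h: "h \<in> span (set es)" for h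
  proof -
    obtain h' where h': "h' \<in> span (set es)" "\<alpha> (x + h) < \<alpha> (x + h')"
      using ex h by blast
    hence "\<alpha> (h - h') = \<alpha> (x + h)"
      using norm_diff_eq[OF X(2) X(1) inX[OF h] inX[OF h'(1)]] by simp
    moreover have "h - h' \<noteq> 0"
      using h' by auto
    ultimately show ?thesis
      using N(2)[of "h - h'"] h h' by (simp add: span_diff)
  qed
  \<comment> \<open>Distinct multiples of \<open>1 / N\<close> are at least \<open>1 / N\<close>
    apart, so every improvement has a guaranteed size and iterating it drives the norm to
    infinity.\<close>
  have step: "\<exists>h'\<in>span (set es). \<alpha> (x + h) + ereal (1 / N) \<le> \<alpha> (x + h')"
    if h: "h \<in> span (set es)" for h
  proof -
    obtain h' where h': "h' \<in> span (set es)" "\<alpha> (x + h) < \<alpha> (x + h')"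
      using ex h by blast
    obtain m m' :: int where m: "\<alpha> (x + h) = ereal (of_int m / real N)" "\<alpha> (x + h') = ereal (of_int m' / real N)"
      using val h h'(1) by meson
    hence "m < m'"
      using h'(2) N(1) by (simp add: divide_less_cancel)
    hence "real_of_int m + 1 \<le> real_of_int m'"
      by linarith
    hence "m / N + 1 / N \<le> m' / N"
      by (metis add_divide_distrib divide_right_mono of_nat_0_le_iff)
    with m h' show ?thesis
      by (intro bexI[of _ h']) auto
  qed
  have 0: "0 \<in> span (set es)"
    by (rule span_zero)
  obtain m0 :: int where m0: "\<alpha> x = ereal (of_int m0 / real N)"
    using val[OF 0] by auto
  obtain h where h: "\<And>n. h n \<in> span (set es)"
    "\<And>n. \<alpha> (x + h n) + ereal (1 / N) \<le> \<alpha> (x + h (Suc n))"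
    using dependent_nat_choice[of "\<lambda>n h. h \<in> span (set es)"
        "\<lambda>n h h'. \<alpha> (x + h) + ereal (1 / N) \<le> \<alpha> (x + h')"] step 0 by metis
  have lower: "ereal (r + n / N) \<le> \<alpha> (x + h n)" if "\<alpha> (x + h 0) = ereal r" for r n
  proof (induction n)
    case 0
    show ?case using that by simp
  next
    case (Suc n)
    have "ereal (r + Suc n / N) = ereal (r + n / N) + ereal (1 / N)"
      by (simp add: add_divide_distrib)
    also have "\<dots> \<le> \<alpha> (x + h n) + ereal (1 / N)"
      using Suc.IH by (rule add_right_mono)
    finally show ?case
      using h(2)[of n] by (rule order_trans)
  qed
  obtain r where r: "\<alpha> (x + h 0) = ereal r"
    using val[OF h(1)] by blast
  have large: "\<exists>M. \<forall>n\<ge>M. ereal B \<le> \<alpha> (x + h n)" for B :: real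
  proof -
    obtain M :: nat where M: "(B - r) * N \<le> M"
      using real_arch_simple by blast
    have "ereal B \<le> \<alpha> (x + h n)" if "n \<ge> M" for n
    proof -
      have "(B - r) * N \<le> n"
        using M that by linarith
      hence "B \<le> r + n / N"
        using N(1) by (simp add: field_simps)
      thus ?thesis
        using lower[OF r, of n] by (meson ereal_less_eq(3) order_trans)
    qed
    thus ?thesis by blast
  qed
  have "\<exists>c. h n = (\<Sum>i<length es. scale (c i) (es ! i))" for n
    using h(1)[of n] es by (simp add: span_list_iff)
  then obtain c where c: "\<And>n. h n = (\<Sum>i<length es. scale (c n i) (es ! i))"
    by metis
  have coord: "\<alpha> (\<Sum>i<length es. scale (d i) (es ! i)) \<le> v (d i) + \<alpha> (es ! i)" if "i < length es" for d i
    unfolding splitting_norm_eq using that by (intro INF_lower) auto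
  \<comment> \<open>A splitting basis bounds the valuation of each coordinate of
    \<open>h m - h n\<close> from below in terms of its norm, so the coordinate sequences are
    Cauchy.\<close>
  have "\<exists>l. \<forall>B::real. \<exists>M::nat. \<forall>n\<ge>M. ereal B \<le> v (c n i - l)" if i: "i < length es" for i
  proof (rule v_complete, rule allI)
    fix B :: real
    obtain k where k: "\<alpha> (es ! i) = ereal k"
      using nth_es i norm_rat[OF X(2)] by metis
    obtain M where M: "\<And>n. n \<ge> M \<Longrightarrow> ereal (B + k) \<le> \<alpha> (x + h n)"
      using large by blast
    have "ereal B \<le> v (c m i - c n i)" if "m \<ge> M" "n \<ge> M" for m n
    proof -
      have "(x + h m) - (x + h n) = (\<Sum>i<length es. scale (c m i - c n i) (es ! i))"
        unfolding c by (simp add: scale_left_diff_distrib sum_subtractf)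
      moreover have "ereal (B + k) \<le> \<alpha> ((x + h m) - (x + h n))"
        using M that h(1) inX by (intro le_norm_diff[OF X(2) X(1)]) auto
      ultimately have "ereal (B + k) \<le> v (c m i - c n i) + ereal k"
        using coord[OF i, of "\<lambda>i. c m i - c n i"] k by (metis order_trans)
      thus ?thesis
        by (cases "v (c m i - c n i)") auto
    qed
    thus "\<exists>M. \<forall>m\<ge>M. \<forall>n\<ge>M. ereal B \<le> v (c m i - c n i)"
      by blast
  qed
  then obtain l where l: "\<And>i B::real. i < length es \<Longrightarrow> \<exists>M::nat. \<forall>n\<ge>M. ereal B \<le> v (c n i - l i)"
    by metis
  define y where "y = (\<Sum>i<length es. scale (l i) (es ! i))"
  have y: "y \<in> span (set es)"
    using es by (auto simp: span_list_iff y_def)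
  \<comment> \<open>The vector \<open>x + y\<close> is the limit of the \<open>x + h n\<close>,
    whose norms are unbounded. Its norm is therefore infinite, which puts \<open>x = - y\<close>
    into the span.\<close>
  have "ereal B \<le> \<alpha> (x + y)" for B :: real
  proof -
    have "\<forall>i<length es. \<exists>M::nat. \<forall>n\<ge>M. ereal B \<le> v (c n i - l i) + \<alpha> (es ! i)"
    proof (intro allI impI)
      fix i assume i: "i < length es"
      obtain k where k: "\<alpha> (es ! i) = ereal k"
        using nth_es i norm_rat[OF X(2)] by metis
      obtain M :: nat where M: "\<And>n. n \<ge> M \<Longrightarrow> ereal (B - k) \<le> v (c n i - l i)"
        using l[OF i] by blast
      have "ereal B \<le> v (c n i - l i) + \<alpha> (es ! i)" if "n \<ge> M" for n
        using M[OF that] k by (cases "v (c n i - l i)") auto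
      thus "\<exists>M::nat. \<forall>n\<ge>M. ereal B \<le> v (c n i - l i) + \<alpha> (es ! i)"
        by blast
    qed
    then obtain M where M: "\<And>i n. i < length es \<Longrightarrow> n \<ge> M i \<Longrightarrow> ereal B \<le> v (c n i - l i) + \<alpha> (es ! i)"
      by metis
    obtain M' where M': "\<And>n. n \<ge> M' \<Longrightarrow> ereal B \<le> \<alpha> (x + h n)"
      using large by blast
    \<comment> \<open>The sum is a simple common upper bound of all the thresholds.\<close>
    define n where "n = M' + (\<Sum>i<length es. M i)"
    have nM: "M i \<le> n" if "i < length es" for i
      using member_le_sum[of i "{..<length es}" M] that by (simp add: n_def)
    have "h n - y = (\<Sum>i<length es. scale (c n i - l i) (es ! i))"
      unfolding c y_def by (simp add: scale_left_diff_distrib sum_subtractf)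
    hence "ereal B \<le> \<alpha> (h n - y)"
      using M nM by (auto simp: splitting_norm_eq intro!: INF_greatest)
    moreover have "ereal B \<le> \<alpha> (x + h n)"
      by (rule M') (simp add: n_def)
    moreover have "h n - y \<in> X"
      using subspace_diff[OF X(1)] h(1) y sub by blast
    ultimately have "ereal B \<le> \<alpha> ((x + h n) - (h n - y))"
      using le_norm_diff[OF X(2) X(1)] inX h(1) by blast
    thus ?thesis
      by (simp add: algebra_simps)
  qed
  hence "\<alpha> (x + y) = \<infinity>"
    using ereal_top by blast
  hence "x + y = 0"
    using norm_infty_iff[OF X(2)] inX y by blast
  hence "x = - y"
    by (simp add: eq_neg_iff_add_eq_0)
  with x(2) y show False
    by (simp add: span_neg)
qed

end

text \<open>Gram-Schmidt with best approximation in place of orthogonal projection: the first vector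
  is moved by an element of the span \<open>H\<close> of the others until no element of
  \<open>H\<close> increases its norm. This maximality makes its line split off from
  \<open>H\<close>.\<close>

theorem exists_splitting_basis:
  assumes "norm_on v scale X \<alpha>" "basis_of scale X bs"
  obtains es where "basis_of scale X es" "basis_splits_norm scale es \<alpha>"
proof -
  have "\<exists>es. basis_of scale X es \<and> basis_splits_norm scale es \<alpha>"
    using assms
  proof (induction bs arbitrary: X)
    case Nil
    have "0 \<in> X"
      using Nil.prems(2) span_zero by (auto simp: basis_of_def)
    hence "\<alpha> 0 = \<infinity>"
      using norm_infty_iff[OF Nil.prems(1)] by blast
    \<comment> \<open>The empty infimum is \<open>\<infinity>\<close>, the value of a norm at
      \<open>0\<close>.\<close>
    hence "basis_splits_norm scale [] \<alpha>"
      by (simp add: basis_splits_norm_def top_ereal_def)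
    with Nil.prems(2) show ?case
      by blast
  next
    case (Cons b bs)
    define H where "H = span (set bs)"
    have b: "distinct bs" "independent (set bs)" "b \<notin> H" and X: "X = span (insert b (set bs))"
      using Cons.prems(2) by (auto simp: basis_of_def H_def independent_insert)
    have HX: "H \<subseteq> X"
      unfolding H_def X by (rule span_mono) auto
    have bX: "b \<in> X" and sX: "subspace X"
      by (auto simp: X span_base)
    have "norm_on v scale H \<alpha>"
      using Cons.prems(1) HX by (rule norm_on_subset)
    with Cons.IH[of H] b obtain es where es: "basis_of scale H es" "basis_splits_norm scale es \<alpha>"
      by (auto simp: basis_of_def H_def)
    have es': "distinct es" "independent (set es)" "span (set es) = H"
      using es(1) by (auto simp: basis_of_def)
    have esX: "set es \<subseteq> X"
      using es'(3) HX span_superset by blast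
    obtain h where h: "h \<in> H" "\<And>h'. h' \<in> H \<Longrightarrow> \<alpha> (b + h') \<le> \<alpha> (b + h)"
      using best_approximation[OF es'(1,2) esX es(2) sX Cons.prems(1) bX] b(3) es'(3) by blast
    define x where "x = b + h"
    have sH: "subspace H"
      by (simp add: H_def)
    have x: "x \<in> X" "x \<notin> H"
      using bX h HX sX sH b(3) subspace_diff[OF sH, of "b + h" h] by (auto simp: x_def intro: subspace_add)
    have best: "\<alpha> (x + h') \<le> \<alpha> x" if "h' \<in> H" for h'
      using h(2)[of "h + h'"] that h(1) sH by (simp add: x_def add.assoc subspace_add)
    \<comment> \<open>Here \<open>h'\<close> is the difference of \<open>x + h'\<close> and
      \<open>x\<close>, both of norm at least \<open>\<alpha> (x + h')\<close> by the choice of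
      \<open>x\<close>; hence \<open>h'\<close> has this property too.\<close>
    have split1: "\<alpha> (x + h') = min (\<alpha> x) (\<alpha> h')" if h': "h' \<in> H" for h'
    proof (rule antisym)
      have "\<alpha> (x + h') \<le> \<alpha> ((x + h') - x)"
        using h' x HX sX best by (intro le_norm_diff[OF Cons.prems(1)]) (auto intro: subspace_add)
      thus "\<alpha> (x + h') \<le> min (\<alpha> x) (\<alpha> h')"
        using best[OF h'] by simp
      show "min (\<alpha> x) (\<alpha> h') \<le> \<alpha> (x + h')"
        using norm_add[OF Cons.prems(1)] x h' HX by blast
    qed
    have split: "\<alpha> (scale c x + h') = min (\<alpha> (scale c x)) (\<alpha> h')" if h': "h' \<in> H" for c h'
    proof (cases "c = 0")
      case True
      have "\<alpha> 0 = \<infinity>"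
        using norm_infty_iff[OF Cons.prems(1), of 0] sX by (simp add: subspace_0)
      with True show ?thesis by simp
    next
      case False
      define k where "k = scale (inverse c) h'"
      have k: "k \<in> H" "h' = scale c k"
        using sH h' False by (auto simp: k_def subspace_scale)
      obtain n :: int where n: "v c = ereal n"
        using False by (auto elim: v_int)
      have "\<alpha> (scale c x + h') = \<alpha> (scale c (x + k))"
        by (simp add: k scale_right_distrib)
      also have "\<dots> = v c + min (\<alpha> x) (\<alpha> k)"
        using k x HX sX split1[of k] norm_scale[OF Cons.prems(1), of "x + k" c]
        by (auto intro: subspace_add)
      also have "\<dots> = min (v c + \<alpha> x) (v c + \<alpha> k)"
        using n by (cases "\<alpha> x \<le> \<alpha> k") (auto simp: min_def ereal_add_le_add_iff)
      also have "\<dots> = min (\<alpha> (scale c x)) (\<alpha> h')"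
        using k x HX norm_scale[OF Cons.prems(1)] by auto
      finally show ?thesis .
    qed
    have "span (insert x (set es)) = X"
    proof -
      have "span (insert x (set es)) = span (insert b (set es))"
        by (rule eq_span_insert_eq) (simp add: x_def es' h)
      also have "\<dots> = X"
        unfolding X span_insert using es'(3) by (simp add: H_def)
      finally show ?thesis .
    qed
    hence 1: "basis_of scale X (x # es)"
      using es' x span_base[of _ "set es"] by (auto simp: basis_of_def independent_insert)
    have "basis_splits_norm scale (x # es) \<alpha>"
      unfolding basis_splits_norm_def
    proof
      fix c :: "nat \<Rightarrow> 'a"
      define h' where "h' = (\<Sum>i<length es. scale (c (Suc i)) (es ! i))"
      have h': "h' \<in> H"
        unfolding es'(3)[symmetric] span_list_iff[OF es'(1)] h'_def by (rule exI[of _ "\<lambda>i. c (Suc i)"]) simp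
      have "\<alpha> h' = (INF i\<in>{..<length es}. \<alpha> (scale (c (Suc i)) (es ! i)))"
        using es(2) unfolding basis_splits_norm_def h'_def by (rule allE[of _ "\<lambda>i. c (Suc i)"])
      moreover have "(\<Sum>i<length (x # es). scale (c i) ((x # es) ! i)) = scale (c 0) x + h'"
        unfolding h'_def length_Cons sum.lessThan_Suc_shift by simp
      ultimately show "\<alpha> (\<Sum>i<length (x # es). scale (c i) ((x # es) ! i)) =
          (INF i\<in>{..<length (x # es)}. \<alpha> (scale (c i) ((x # es) ! i)))"
        using split[OF h', of "c 0"] by (simp add: lessThan_Suc_eq_insert_0 image_image inf_min)
    qed
    with 1 show ?case by blast
  qed
  thus thesis
    using that by blast
qed

end

section \<open>Composition algebra identities\<close>

context split_octonion_algebra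
begin

abbreviation B :: "'v \<Rightarrow> 'v \<Rightarrow> 'a" where
  "B \<equiv> polar Q"

lemma B_commute: "B x y = B y x"
  by (simp add: polar_def add.commute)

lemma B_add_left: "B (x + y) z = B x z + B y z"
  by (rule polar_add)

lemma B_scale_left: "B (scale c x) y = c * B x y"
  by (rule polar_scale)

lemma B_add_right: "B z (x + y) = B z x + B z y"
  using polar_add[of x y z] by (simp add: B_commute)

lemma B_scale_right: "B y (scale c x) = c * B y x"
  using polar_scale[of c x y] by (simp add: B_commute)

lemma B_0_left [simp]: "B 0 x = 0"
  using B_scale_left[of 0 0 x] by simp

lemma B_0_right [simp]: "B x 0 = 0"
  using B_scale_right[of x 0 0] by simp

lemma B_minus_left: "B (- x) y = - B x y"
  using B_scale_left[of "- 1" x y] by simp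

lemma B_minus_right: "B y (- x) = - B y x"
  using B_scale_right[of y "- 1" x] by simp

lemma B_diff_left: "B (x - y) z = B x z - B y z"
  using B_add_left[of x "- y" z] by (simp add: B_minus_left)

lemma B_diff_right: "B z (x - y) = B z x - B z y"
  using B_add_right[of z x "- y"] by (simp add: B_minus_right)

lemmas B_linear = B_add_left B_add_right B_scale_left B_scale_right B_minus_left B_minus_right
  B_diff_left B_diff_right

lemma mul_0_left [simp]: "mul 0 x = 0"
  using mult_scale_left[of 0 0 x] by simp

lemma mul_0_right [simp]: "mul x 0 = 0"
  using mult_scale_right[of x 0 0] by simp

lemma mul_minus_left: "mul (- x) y = - mul x y"
  using mult_scale_left[of "- 1" x y] by simp

lemma mul_minus_right: "mul x (- y) = - mul x y"
  using mult_scale_right[of x "- 1" y] by simp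

lemma mul_diff_left: "mul (x - y) z = mul x z - mul y z"
  using mult_add_left[of x "- y" z] by (simp add: mul_minus_left)

lemma mul_diff_right: "mul x (y - z) = mul x y - mul x z"
  using mult_add_right[of x y "- z"] by (simp add: mul_minus_right)

lemmas mul_linear = mult_add_left mult_add_right mult_scale_left mult_scale_right
  mul_minus_left mul_minus_right mul_diff_left mul_diff_right

lemma B_eqI: "(\<And>z. B x z = B y z) \<Longrightarrow> x = y"
  using nondegenerate[of "x - y"] by (simp add: B_linear)

lemma B_mul_same_left: "B (mul x y) (mul x z) = Q x * B y z"
  by (simp add: polar_def mult_add_right[symmetric] Q_mult algebra_simps)

text \<open>Polarization of the preceding identity in the left factor. With \<open>unit\<close> for
  \<open>w\<close> it yields the adjoint of left multiplication, from which the later identities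
  follow.\<close>

lemma B_mul_exchange: "B (mul x y) (mul w z) + B (mul w y) (mul x z) = B x w * B y z"
proof -
  have "Q (x + w) = Q x + Q w + B x w"
    by (simp add: polar_def)
  with B_mul_same_left[of "x + w" y z] show ?thesis
    by (simp add: mul_linear B_linear B_mul_same_left algebra_simps)
qed

definition conj :: "'v \<Rightarrow> 'v" where
  "conj x = scale (B x unit) unit - x"

lemma B_mul_adjoint_left: "B (mul x y) z = B y (mul (conj x) z)"
  using B_mul_exchange[of x y unit z]
  by (simp add: unit_left conj_def mul_linear B_linear algebra_simps)

text \<open>What survives of associativity. Left multiplication by \<open>conj x\<close> is adjoint
  to left multiplication by \<open>x\<close>, so pairing with \<open>z\<close> reduces the claim to
  \<open>B (mul x z) (mul x y) = Q x * B z y\<close>.\<close>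

lemma mul_conj_mul: "mul (conj x) (mul x y) = scale (Q x) y"
proof (rule B_eqI)
  fix z
  have "B (mul (conj x) (mul x y)) z = B (mul x z) (mul x y)"
    using B_mul_adjoint_left[of x z "mul x y"] by (metis B_commute)
  thus "B (mul (conj x) (mul x y)) z = B (scale (Q x) y) z"
    by (simp add: B_mul_same_left B_linear B_commute)
qed

lemma conj_add: "conj (x + y) = conj x + conj y"
  by (simp add: conj_def B_linear scale_left_distrib)

lemma mul_conj_exchange: "mul (conj x) (mul w y) + mul (conj w) (mul x y) = scale (B x w) y"
proof -
  have "Q (x + w) = Q x + Q w + B x w"
    by (simp add: polar_def)
  with mul_conj_mul[of "x + w" y] show ?thesis
    by (simp add: conj_add mul_linear mul_conj_mul scale_left_distrib algebra_simps)
qed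

lemma square_eq: "mul x x = scale (B x unit) x - scale (Q x) unit"
  using mul_conj_mul[of x unit] by (simp add: conj_def unit_right unit_left mul_linear algebra_simps)

lemma mul_anticommutator:
  "mul x y + mul y x = scale (B x unit) y + scale (B y unit) x - scale (B x y) unit"
proof -
  have "Q (x + y) = Q x + Q y + B x y"
    by (simp add: polar_def)
  moreover have "mul x x + mul x y + (mul y x + mul y y) =
      scale (B (x + y) unit) (x + y) - scale (Q (x + y)) unit"
    using square_eq[of "x + y"] by (simp add: mult_add_left mult_add_right algebra_simps)
  ultimately show ?thesis
    unfolding square_eq[of x] square_eq[of y]
    by (simp add: B_linear scale_left_distrib scale_right_distrib algebra_simps)
qed

lemma Q_eq_0_if_zero_divisor:
  assumes "mul x y = 0" "y \<noteq> 0"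
  shows "Q x = 0"
  using mul_conj_mul[of x y] assms by simp

end

section \<open>The polarization defined by a pair of idempotents\<close>

locale octonion_polarization = split_octonion_algebra +
  fixes V0 :: "'b set" and ep em :: 'b
  assumes V0: "split_composition_subalgebra scale mul unit Q V0" "dim V0 = 2"
    and ep_em: "ep \<in> V0" "em \<in> V0" "ep \<noteq> 0" "em \<noteq> 0"
    and idempotent: "mul ep ep = ep" "mul em em = em" and mul_ep_em: "mul ep em = 0"
begin

lemma subspace_V0: "subspace V0" and unit_V0: "unit \<in> V0"
  using V0 by (auto simp: split_composition_subalgebra_def composition_subalgebra_def)

text \<open>If \<open>em = c ep\<close>, then \<open>em = ep em = 0\<close>; so the idempotents are
  independent, and a vector outside their span would give three independent vectors in a
  plane.\<close>

lemma V0_eq: "V0 = span {ep, em}"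
proof -
  have ne: "ep \<noteq> em"
    using mul_ep_em idempotent ep_em by auto
  have "em \<notin> span {ep}"
  proof
    assume "em \<in> span {ep}"
    then obtain c where "em = scale c ep"
      by (auto simp: span_singleton)
    with mul_ep_em idempotent have "em = 0"
      by (simp add: mul_linear)
    with ep_em show False by simp
  qed
  hence ind: "independent {ep, em}"
    using ep_em ne by (simp add: independent_insert insert_commute[of ep em])
  obtain C where C: "C \<subseteq> V0" "independent C" "V0 \<subseteq> span C" "card C = 2"
    using basis_exists[of V0] V0(2) by metis
  show ?thesis
  proof (rule antisym)
    show "span {ep, em} \<subseteq> V0"
      using ep_em subspace_V0 by (intro span_minimal) auto
    show "V0 \<subseteq> span {ep, em}"
    proof
      fix x assume x: "x \<in> V0"
      show "x \<in> span {ep, em}"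
      proof (rule ccontr)
        assume nin: "x \<notin> span {ep, em}"
        hence "independent (insert x {ep, em})"
          using ind by (simp add: independent_insertI)
        moreover have "insert x {ep, em} \<subseteq> span C"
          using x ep_em C by auto
        moreover have "finite C"
          using C(4) by (simp add: card_ge_0_finite)
        ultimately have "card (insert x {ep, em}) \<le> 2"
          using independent_span_bound C(4) by metis
        moreover have "card (insert x {ep, em}) = 3"
          using nin ne span_base[of _ "{ep, em}"] by (auto simp: card_insert_if)
        ultimately show False by simp
      qed
    qed
  qed
qed

lemma ep_plus_em: "ep + em = unit"
proof -
  obtain a b where ab: "unit = scale a ep + scale b em"
    using unit_V0 unfolding V0_eq by (auto simp: span_insert algebra_simps)
  have "scale a ep = ep"
    using unit_right[of ep] unfolding ab by (simp add: mul_linear idempotent mul_ep_em)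
  moreover have "scale b em = em"
    using unit_left[of em] unfolding ab by (simp add: mul_linear idempotent mul_ep_em)
  ultimately show ?thesis
    using ab by simp
qed

lemma em_eq: "em = unit - ep"
  using ep_plus_em by (simp add: algebra_simps)

lemma mul_em: "mul em x = x - mul ep x"
  by (simp add: em_eq mul_linear unit_left)

lemma mul_em_ep: "mul em ep = 0"
  by (simp add: mul_em idempotent)

text \<open>Once \<open>mul em ep = 0\<close> is known, the hypotheses are symmetric in the two
  idempotents. Every fact about \<open>Wp\<close> thus has a counterpart about \<open>Wm\<close>,
  obtained by interpreting the locale a second time.\<close>

lemma swap: "octonion_polarization scale mul unit Q V0 em ep"
  using V0 ep_em idempotent mul_em_ep by unfold_locales auto

lemma Q_ep: "Q ep = 0" and Q_em: "Q em = 0"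
  using Q_eq_0_if_zero_divisor mul_ep_em mul_em_ep ep_em by blast+

lemma B_ep_unit: "B ep unit = 1"
  using square_eq[of ep] Q_ep idempotent ep_em scale_cancel_right[of "B ep unit" ep 1] by simp

lemma B_ep_ep: "B ep ep = 0" and B_em_em: "B em em = 0"
  by (simp_all add: polar_self Q_ep Q_em)

lemma B_ep_em: "B ep em = 1"
  by (simp add: em_eq B_linear B_ep_unit B_ep_ep)

lemma B_em_ep: "B em ep = 1"
  using B_ep_em B_commute by metis

lemma B_em_unit: "B em unit = 1"
  by (simp add: ep_plus_em[symmetric] B_linear B_em_ep B_em_em)

lemma conj_ep: "conj ep = em" and conj_em: "conj em = ep"
  using ep_plus_em by (simp_all add: conj_def B_ep_unit B_em_unit diff_eq_eq add.commute)

abbreviation W :: "'b set" where "W \<equiv> orth_compl B V0"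

lemma W_iff: "x \<in> W \<longleftrightarrow> B x ep = 0 \<and> B x em = 0"
proof
  assume "x \<in> W"
  with ep_em show "B x ep = 0 \<and> B x em = 0"
    by (auto simp: orth_compl_def)
next
  assume x: "B x ep = 0 \<and> B x em = 0"
  show "x \<in> W"
    unfolding orth_compl_def V0_eq by (auto simp: span_insert algebra_simps B_linear x)
qed

lemma subspace_W: "subspace W"
  by (rule subspaceI) (auto simp: W_iff B_linear)

section \<open>The two halves of W and their multiplication table\<close>

definition Wp :: "'b set" where "Wp = mul ep ` W"
definition Wm :: "'b set" where "Wm = mul em ` W"

lemma mul_ep_ep: "mul ep (mul ep x) = mul ep x"
  using mul_conj_mul[of ep x] by (simp add: conj_ep Q_ep em_eq mul_linear unit_left)

lemma ep_W: "x \<in> W \<Longrightarrow> mul ep x \<in> W"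
  by (simp add: W_iff B_mul_adjoint_left conj_ep idempotent mul_em_ep)

lemma Wp_iff: "x \<in> Wp \<longleftrightarrow> x \<in> W \<and> mul ep x = x"
  unfolding Wp_def using ep_W mul_ep_ep by (auto simp: image_iff) metis

lemma Wm_iff: "x \<in> Wm \<longleftrightarrow> x \<in> W \<and> mul em x = x"
proof -
  interpret s: octonion_polarization scale mul unit Q V0 em ep
    by (rule swap)
  show ?thesis
    using s.Wp_iff by (simp add: Wm_def s.Wp_def)
qed

lemma swap_Wp: "octonion_polarization.Wp mul Q V0 em = Wm"
  and swap_Wm: "octonion_polarization.Wm mul Q V0 ep = Wp"
proof -
  interpret s: octonion_polarization scale mul unit Q V0 em ep
    by (rule swap)
  show "octonion_polarization.Wp mul Q V0 em = Wm" "octonion_polarization.Wm mul Q V0 ep = Wp"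
    by (simp_all add: s.Wp_def s.Wm_def Wp_def Wm_def)
qed

lemma subspace_Wp: "subspace Wp"
  using subspace_W by (intro subspaceI) (auto simp: Wp_iff mul_linear subspace_0 subspace_add subspace_scale)

lemma subspace_Wm: "subspace Wm"
  using subspace_W by (intro subspaceI) (auto simp: Wm_iff mul_linear subspace_0 subspace_add subspace_scale)

lemma W_unit: "x \<in> W \<Longrightarrow> B x unit = 0"
  by (simp add: W_iff ep_plus_em[symmetric] B_linear)

lemma conj_W: "x \<in> W \<Longrightarrow> conj x = - x"
  by (simp add: conj_def W_unit)

text \<open>An element of \<open>W\<close> has trace zero and is orthogonal to \<open>ep\<close>, so
  the anticommutator formula reduces to \<open>x ep + ep x = x\<close>.\<close>

lemma mul_W_ep: "x \<in> W \<Longrightarrow> mul x ep = mul em x"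
  using mul_anticommutator[of x ep]
  by (simp add: W_unit B_ep_unit W_iff em_eq mul_linear unit_left algebra_simps)

lemma mul_W_em: "x \<in> W \<Longrightarrow> mul x em = mul ep x"
  using mul_W_ep[of x] by (simp add: em_eq mul_linear unit_left unit_right)

lemma Wp_D:
  assumes "x \<in> Wp"
  shows "x \<in> W" "mul ep x = x" "mul em x = 0" "mul x em = x" "mul x ep = 0"
    "B x ep = 0" "B x em = 0" "B x unit = 0" "Q x = 0" "mul x x = 0"
proof -
  show x: "x \<in> W" "mul ep x = x"
    using assms by (auto simp: Wp_iff)
  show em: "mul em x = 0"
    using x by (simp add: em_eq mul_linear unit_left)
  show "mul x em = x" "mul x ep = 0"
    using x em by (simp_all add: mul_W_em mul_W_ep)
  show "B x ep = 0" "B x em = 0" "B x unit = 0"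
    using x W_unit by (auto simp: W_iff)
  show "Q x = 0"
    using Q_mult[of ep x] x Q_ep by simp
  thus "mul x x = 0"
    using square_eq[of x] x by (simp add: W_unit)
qed

lemma Wm_D:
  assumes "x \<in> Wm"
  shows "x \<in> W" "mul em x = x" "mul ep x = 0" "mul x ep = x" "mul x em = 0"
    "B x ep = 0" "B x em = 0" "B x unit = 0" "Q x = 0" "mul x x = 0"
proof -
  interpret s: octonion_polarization scale mul unit Q V0 em ep
    by (rule swap)
  show "x \<in> W" "mul em x = x" "mul ep x = 0" "mul x ep = x" "mul x em = 0"
    "B x ep = 0" "B x em = 0" "B x unit = 0" "Q x = 0" "mul x x = 0"
    using s.Wp_D[of x] assms by (auto simp: swap_Wp)
qed

lemma Wp_0 [simp]: "0 \<in> Wp" and Wm_0 [simp]: "0 \<in> Wm"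
  by (simp_all add: subspace_0 subspace_Wp subspace_Wm)

lemma B_Wp_Wp:
  assumes "x \<in> Wp" "y \<in> Wp"
  shows "B x y = 0"
  using assms Wp_D(9)[of x] Wp_D(9)[of y] Wp_D(9)[of "x + y"] subspace_add[OF subspace_Wp]
  by (simp add: polar_def)

lemma B_Wm_Wm:
  assumes "x \<in> Wm" "y \<in> Wm"
  shows "B x y = 0"
  using assms Wm_D(9)[of x] Wm_D(9)[of y] Wm_D(9)[of "x + y"] subspace_add[OF subspace_Wm]
  by (simp add: polar_def)

lemma mul_W_exchange:
  assumes "x \<in> W" "y \<in> W"
  shows "mul x (mul y z) + mul y (mul x z) = - scale (B x y) z"
proof -
  have "- (mul x (mul y z) + mul y (mul x z)) = scale (B x y) z"
    using mul_conj_exchange[of x y z] assms by (simp add: conj_W mul_linear)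
  thus ?thesis
    by (metis minus_minus)
qed

lemma mul_Wp_Wm:
  assumes "x \<in> Wp" "y \<in> Wm"
  shows "mul x y = - scale (B x y) ep"
  using mul_W_exchange[of x y ep] assms by (simp add: Wp_D Wm_D)

lemma mul_Wm_Wp:
  assumes "x \<in> Wp" "y \<in> Wm"
  shows "mul y x = - scale (B x y) em"
  using mul_W_exchange[of x y em] assms by (simp add: Wp_D Wm_D)

lemma mul_Wp_anticommute:
  assumes "x \<in> Wp" "y \<in> Wp"
  shows "mul y x = - mul x y"
  using mul_anticommutator[of x y] assms by (simp add: Wp_D B_Wp_Wp eq_neg_iff_add_eq_0 add.commute)

text \<open>As \<open>em\<close> kills \<open>y\<close> and is orthogonal to \<open>x\<close>, the
  exchange identity for \<open>em\<close> and \<open>x\<close> reduces to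
  \<open>conj em (x y) = 0\<close>, that is, \<open>ep (x y) = 0\<close>.\<close>

lemma mul_Wp_Wp:
  assumes "x \<in> Wp" "y \<in> Wp"
  shows "mul x y \<in> Wm"
proof -
  have "mul x y \<in> W"
    using assms by (simp add: W_iff B_mul_adjoint_left conj_W mul_linear B_linear Wp_D B_Wp_Wp)
  moreover have "mul ep (mul x y) = 0"
    using mul_conj_exchange[of em x y] assms by (simp add: conj_em Wp_D B_commute[of em])
  ultimately show ?thesis
    by (simp add: Wm_iff mul_em)
qed

lemma mul_Wm_Wm:
  assumes "x \<in> Wm" "y \<in> Wm"
  shows "mul x y \<in> Wp"
proof -
  interpret s: octonion_polarization scale mul unit Q V0 em ep
    by (rule swap)
  show ?thesis
    using s.mul_Wp_Wp assms by (simp add: swap_Wp swap_Wm)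
qed

text \<open>The double cross product formula a x (b x c) = (a.c) b - (a.b) c, with
  \<open>mul\<close> as cross product and \<open>B\<close> as the pairing of the two halves.\<close>

lemma mul_Wp_WmWm:
  assumes "x \<in> Wp" "y \<in> Wm" "z \<in> Wm"
  shows "mul x (mul y z) = scale (B x z) y - scale (B x y) z"
  using mul_W_exchange[of x y z] assms
  by (simp add: Wp_D Wm_D mul_Wp_Wm mul_linear algebra_simps)

lemma mul_Wm_WpWp:
  assumes "x \<in> Wm" "y \<in> Wp" "z \<in> Wp"
  shows "mul x (mul y z) = scale (B x z) y - scale (B x y) z"
proof -
  interpret s: octonion_polarization scale mul unit Q V0 em ep
    by (rule swap)
  show ?thesis
    using s.mul_Wp_WmWm assms by (simp add: swap_Wp swap_Wm)
qed

text \<open>Left multiplication by \<open>ep\<close> keeps the \<open>ep\<close> and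
  \<open>Wp\<close> components. Pairing with \<open>em\<close> reads off the coefficient of
  \<open>ep\<close>, because \<open>em\<close> is isotropic, orthogonal to \<open>W\<close>, and
  \<open>B ep em = 1\<close>.\<close>

definition proj_p :: "'b \<Rightarrow> 'b" where
  "proj_p x = mul ep x - scale (B x em) ep"

definition proj_m :: "'b \<Rightarrow> 'b" where
  "proj_m x = mul em x - scale (B x ep) em"

lemma proj_p_Wp: "proj_p x \<in> Wp"
proof -
  have "B (mul ep x) ep = 0" "B (mul ep x) em = B x em"
    by (simp_all add: B_mul_adjoint_left conj_ep mul_em_ep idempotent)
  hence "proj_p x \<in> W"
    by (simp add: W_iff proj_p_def B_linear B_ep_ep B_ep_em)
  thus ?thesis
    by (simp add: Wp_iff proj_p_def mul_linear mul_ep_ep idempotent)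
qed

lemma proj_m_Wm: "proj_m x \<in> Wm"
proof -
  interpret s: octonion_polarization scale mul unit Q V0 em ep
    by (rule swap)
  show ?thesis
    using s.proj_p_Wp by (simp add: swap_Wp s.proj_p_def proj_m_def)
qed

lemma decomposition:
  "x = scale (B x em) ep + scale (B x ep) em + (proj_p x + proj_m x)"
  by (simp add: proj_p_def proj_m_def mul_em)

lemma decomposition_cases:
  obtains a b y z where "x = scale a ep + scale b em + (y + z)" "y \<in> Wp" "z \<in> Wm"
  using decomposition proj_p_Wp proj_m_Wm by blast

lemma Wp_eqI:
  assumes "x \<in> Wp" "y \<in> Wp" "\<And>z. z \<in> Wm \<Longrightarrow> B x z = B y z"
  shows "x = y"
proof (rule B_eqI)
  fix z
  obtain a b u w where "z = scale a ep + scale b em + (u + w)" "u \<in> Wp" "w \<in> Wm"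
    by (rule decomposition_cases)
  with assms show "B x z = B y z"
    by (simp add: B_linear Wp_D B_Wp_Wp)
qed

lemma Wm_eqI:
  assumes "x \<in> Wm" "y \<in> Wm" "\<And>z. z \<in> Wp \<Longrightarrow> B x z = B y z"
  shows "x = y"
proof (rule B_eqI)
  fix z
  obtain a b u w where "z = scale a ep + scale b em + (u + w)" "u \<in> Wp" "w \<in> Wm"
    by (rule decomposition_cases)
  with assms show "B x z = B y z"
    by (simp add: B_linear Wm_D B_Wm_Wm)
qed

section \<open>The triple product on W+ and Cramer's rule\<close>

definition T :: "'b \<Rightarrow> 'b \<Rightarrow> 'b \<Rightarrow> 'a" where
  "T x y z = B (mul x y) z"

lemma T_alternating:
  assumes "x \<in> Wp" "y \<in> Wp"
  shows "T x x y = 0" "T x y x = 0" "T y x x = 0"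
proof -
  show "T x x y = 0"
    using assms by (simp add: T_def Wp_D)
  show "T x y x = 0" "T y x x = 0"
    using assms by (simp_all add: T_def B_mul_adjoint_left conj_W Wp_D mul_linear B_linear
        mul_Wp_anticommute[of x y] B_Wp_Wp)
qed

lemma T_transpose:
  assumes "x \<in> Wp" "y \<in> Wp" "z \<in> Wp"
  shows "T y x z = - T x y z" "T x z y = - T x y z"
proof -
  show "T y x z = - T x y z"
    using assms by (simp add: T_def mul_Wp_anticommute[of x y] B_linear)
  have "T x (y + z) (y + z) = 0"
    using assms by (simp add: T_alternating subspace_add subspace_Wp)
  thus "T x z y = - T x y z"
    using assms T_alternating[of y x] T_alternating[of z x]
    by (simp add: T_def mul_linear B_linear eq_neg_iff_add_eq_0 algebra_simps)
qed

lemma T_rotate: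
  assumes "x \<in> Wp" "y \<in> Wp" "z \<in> Wp"
  shows "T y z x = T x y z" "T z x y = T x y z"
  using T_transpose assms by metis+

text \<open>The vector identity (a x b) x (b x c) = [a, b, c] b: in the double product formula the
  second term carries the factor \<open>T x y y = 0\<close>.\<close>

lemma mul_products:
  assumes "x \<in> Wp" "y \<in> Wp" "z \<in> Wp"
  shows "mul (mul x y) (mul y z) = scale (T x y z) y"
  using assms mul_Wp_Wp[OF assms(1,2)] T_alternating[of y x]
  by (simp add: mul_Wm_WpWp T_def)

text \<open>It shows that \<open>a\<close>, \<open>b\<close>, \<open>c\<close> span
  \<open>Wp\<close> before the dimension of \<open>Wp\<close> is known. The double product formula
  for \<open>(b c)(x a)\<close> splits off the component along \<open>a\<close>; the other two
  appear when \<open>x a\<close> is expanded after writing \<open>T a b c\<close> times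
  \<open>a\<close> as \<open>(c a)(a b)\<close>.\<close>

lemma cramer:
  assumes "a \<in> Wp" "b \<in> Wp" "c \<in> Wp" "x \<in> Wp" and T: "T a b c \<noteq> 0"
  shows "scale (T a b c) x = scale (B x (mul b c)) a + scale (B x (mul c a)) b + scale (B x (mul a b)) c"
proof -
  note ab = mul_Wp_Wp[OF assms(1,2)] and bc = mul_Wp_Wp[OF assms(2,3)]
    and ca = mul_Wp_Wp[OF assms(3,1)] and xa = mul_Wp_Wp[OF assms(4,1)]
  let ?t = "T a b c"
  have "mul (mul b c) (mul x a) = scale ?t x - scale (B x (mul b c)) a"
    using mul_Wm_WpWp[OF bc assms(4,1)] T_rotate[OF assms(1-3)] by (simp add: T_def B_commute)
  hence 1: "scale ?t x = scale (B x (mul b c)) a + mul (mul b c) (mul x a)"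
    by simp
  have "mul (mul c a) (mul a b) = scale ?t a"
    using mul_products[OF assms(3,1,2)] T_rotate[OF assms(1-3)] by simp
  hence "scale ?t (mul x a) = mul x (mul (mul c a) (mul a b))"
    by (simp add: mul_linear)
  also have "\<dots> = scale (B x (mul a b)) (mul c a) - scale (B x (mul c a)) (mul a b)"
    by (rule mul_Wp_WmWm[OF assms(4) ca ab])
  finally have xa': "scale ?t (mul x a) =
    scale (B x (mul a b)) (mul c a) - scale (B x (mul c a)) (mul a b)" .
  have "mul (mul b c) (mul c a) = scale ?t c"
    using mul_products[OF assms(2,3,1)] T_rotate[OF assms(1-3)] by simp
  moreover have "mul (mul b c) (mul a b) = - scale ?t b"
    using mul_Wm_WpWp[OF bc assms(1,2)] T_alternating[of b c] assms T_rotate[OF assms(1-3)]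
    by (simp add: T_def)
  ultimately have "scale ?t (mul (mul b c) (mul x a)) =
      scale ?t (scale (B x (mul a b)) c + scale (B x (mul c a)) b)"
    using arg_cong[OF xa', of "mul (mul b c)"]
    by (simp add: mul_linear scale_right_distrib mult.commute)
  hence "mul (mul b c) (mul x a) = scale (B x (mul a b)) c + scale (B x (mul c a)) b"
    using T by simp
  with 1 show ?thesis
    by (simp add: algebra_simps)
qed

text \<open>Dimension 8 enters here: if all products vanished on \<open>Wp\<close>, both halves
  would be at most one-dimensional and four vectors would span everything.\<close>

lemma exists_mul_Wp_nonzero:
  obtains x y where "x \<in> Wp" "y \<in> Wp" "mul x y \<noteq> 0"
proof (rule ccontr)
  assume "\<not> thesis"
  with that have zero: "mul x y = 0" if "x \<in> Wp" "y \<in> Wp" for x y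
    using \<open>x \<in> Wp\<close> \<open>y \<in> Wp\<close> by blast
  have "\<exists>x y. Wp \<subseteq> span {x} \<and> Wm \<subseteq> span {y}"
  proof (cases "\<exists>x\<in>Wp. \<exists>y\<in>Wm. B x y \<noteq> 0")
    case True
    then obtain x y where xy: "x \<in> Wp" "y \<in> Wm" "B x y \<noteq> 0"
      by blast
    \<comment> \<open>Because \<open>z x = 0\<close>, the exchange identity for \<open>z\<close>,
      \<open>w\<close>, \<open>x\<close> loses a term, and \<open>w x\<close> is a multiple of
      \<open>em\<close>. Taking \<open>y\<close> for \<open>w\<close> makes every \<open>z\<close>
      proportional to \<open>x\<close>.\<close>
    have rel: "scale (B x w) z = scale (B z w) x" if "z \<in> Wp" "w \<in> Wm" for z w
      using mul_W_exchange[of z w x] zero[OF that(1) xy(1)] that xy(1)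
      by (simp add: Wp_D Wm_D mul_Wm_Wp mul_linear)
    have "z \<in> span {x}" if "z \<in> Wp" for z
    proof -
      have "z = scale (inverse (B x y)) (scale (B x y) z)"
        using xy by simp
      thus ?thesis
        using rel[OF that xy(2)] by (metis span_base span_scale singletonI)
    qed
    moreover have "w \<in> span {y}" if w: "w \<in> Wm" for w
    proof -
      have "w = scale (B x w / B x y) y"
      proof (rule Wm_eqI)
        show "w \<in> Wm" "scale (B x w / B x y) y \<in> Wm"
          using w xy subspace_Wm by (auto intro: subspace_scale)
        fix z assume z: "z \<in> Wp"
        have "B (scale (B x w) z) y = B (scale (B z w) x) y"
          using rel[OF z w] by simp
        thus "B w z = B (scale (B x w / B x y) y) z"
          using xy(3) by (simp add: B_linear field_simps B_commute[of w] B_commute[of y])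
      qed
      thus ?thesis
        by (metis span_base span_scale singletonI)
    qed
    ultimately show ?thesis by blast
  next
    case False
    hence "x = 0" if "x \<in> Wp" for x
      using that Wp_eqI[of x 0] by simp
    moreover have "x = 0" if "x \<in> Wm" for x
      using that False Wm_eqI[of x 0] by (metis B_0_left B_commute Wm_0)
    ultimately have "Wp \<subseteq> span {0}" "Wm \<subseteq> span {0}"
      by auto
    thus ?thesis by blast
  qed
  then obtain x y where xy: "Wp \<subseteq> span {x}" "Wm \<subseteq> span {y}"
    by blast
  have "UNIV \<subseteq> span {ep, em, x, y}"
  proof
    fix z
    obtain a b u w where z: "z = scale a ep + scale b em + (u + w)" "u \<in> Wp" "w \<in> Wm"
      by (rule decomposition_cases)
    moreover have "u \<in> span {ep, em, x, y}" "w \<in> span {ep, em, x, y}"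
      using z xy span_mono[of "{x}" "{ep, em, x, y}"] span_mono[of "{y}" "{ep, em, x, y}"] by auto
    moreover have "ep \<in> span {ep, em, x, y}" "em \<in> span {ep, em, x, y}"
      by (auto intro: span_base)
    ultimately show "z \<in> span {ep, em, x, y}"
      by (auto intro!: span_add span_scale)
  qed
  hence "dim UNIV \<le> card {ep, em, x, y}"
    by (rule dim_le_card) simp
  also have "\<dots> \<le> 4"
    by (simp add: card_insert_if)
  finally show False
    by (simp add: dim_8)
qed

lemma exists_T_eq_1:
  obtains x y z where "x \<in> Wp" "y \<in> Wp" "z \<in> Wp" "T x y z = 1"
proof -
  obtain x y where xy: "x \<in> Wp" "y \<in> Wp" "mul x y \<noteq> 0"
    by (rule exists_mul_Wp_nonzero)
  then obtain z where z: "z \<in> Wp" "B (mul x y) z \<noteq> 0"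
    using Wm_eqI[OF mul_Wp_Wp Wm_0] by auto
  define z' where "z' = scale (inverse (T x y z)) z"
  have "z' \<in> Wp" "T x y z' = 1"
    using z subspace_Wp by (auto simp: z'_def T_def B_linear intro: subspace_scale)
  thus thesis
    using that xy by blast
qed

end

section \<open>Volumes via an alternating trilinear form\<close>

definition det3 :: "(nat \<Rightarrow> 'a::comm_ring_1) \<Rightarrow> (nat \<Rightarrow> 'a) \<Rightarrow> (nat \<Rightarrow> 'a) \<Rightarrow> 'a" where
  "det3 a b c = a 0 * (b 1 * c 2 - b 2 * c 1) - a 1 * (b 0 * c 2 - b 2 * c 0) + a 2 * (b 0 * c 1 - b 1 * c 0)"

lemma sum_lessThan_3: "(\<Sum>i<(3::nat). g i) = g 0 + g 1 + (g 2 :: 'a::comm_monoid_add)"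
  by (simp add: eval_nat_numeral)

lemma det_mat_3:
  fixes A :: "nat \<times> nat \<Rightarrow> 'a::comm_ring_1"
  shows "Determinant.det (mat 3 3 A) = det3 (\<lambda>i. A (i, 0)) (\<lambda>i. A (i, 1)) (\<lambda>i. A (i, 2))"
proof -
  have det_mat_1: "Determinant.det (mat (Suc 0) (Suc 0) M) = M (0, 0)" for M :: "nat \<times> nat \<Rightarrow> 'a"
    by (subst det_single) auto
  have delete: "mat_delete (mat (Suc n) (Suc n) M) i j =
      mat n n (\<lambda>(i', j'). M (if i' < i then i' else Suc i', if j' < j then j' else Suc j'))"
    for n i j and M :: "nat \<times> nat \<Rightarrow> 'a"
    by (rule eq_matI) (auto simp: mat_delete_def)
  have laplace: "Determinant.det (mat (Suc n) (Suc n) M) =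
      (\<Sum>i<Suc n. M (i, 0) * ((- 1) ^ i * Determinant.det (mat n n (\<lambda>(i', j'). M (if i' < i then i' else Suc i', Suc j')))))"
    for n and M :: "nat \<times> nat \<Rightarrow> 'a"
    by (subst laplace_expansion_column[of _ "Suc n" 0]) (auto simp: cofactor_def delete intro!: sum.cong)
  have "Determinant.det (mat (Suc (Suc (Suc 0))) (Suc (Suc (Suc 0))) A) =
      det3 (\<lambda>i. A (i, 0)) (\<lambda>i. A (i, 1)) (\<lambda>i. A (i, 2))"
    unfolding laplace by (simp add: det_mat_1 det3_def numeral_2_eq_2 algebra_simps)
  thus ?thesis
    by (simp add: numeral_3_eq_3)
qed

context local_field
begin

lemma le_v_mult: "ereal r \<le> v x \<Longrightarrow> ereal s \<le> v y \<Longrightarrow> ereal (r + s) \<le> v (x * y)"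
  using add_mono[of "ereal r" "v x" "ereal s" "v y"] by (simp add: v_mult)

text \<open>Each term of the expansion uses every index once, so the corrections \<open>k i\<close>
  always have the same sum. In the application they are the norms of the vectors of a splitting
  basis.\<close>

lemma le_v_det3:
  assumes "\<And>i. i < 3 \<Longrightarrow> ereal (r - k i) \<le> v (a i)" "\<And>i. i < 3 \<Longrightarrow> ereal (s - k i) \<le> v (b i)"
    "\<And>i. i < 3 \<Longrightarrow> ereal (t - k i) \<le> v (c i)"
  shows "ereal (r + s + t - (\<Sum>i<3. k i)) \<le> v (det3 a b c)"
proof -
  have "ereal (r + s + t - (\<Sum>i<3. k i)) \<le> v (a i * (b j * c l))"
    if "i < 3" "j < 3" "l < 3" "k i + (k j + k l) = (\<Sum>i<3. k i)" for i j l
  proof -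
    have "ereal ((r - k i) + ((s - k j) + (t - k l))) \<le> v (a i * (b j * c l))"
      using that assms by (intro le_v_mult)
    thus ?thesis
      using that(4) by (simp add: algebra_simps)
  qed
  thus ?thesis
    unfolding det3_def right_diff_distrib by (intro le_v_add le_v_diff) (simp_all add: sum_lessThan_3)
qed

end

context vector_space
begin

lemma basis_of_length_eq:
  assumes "basis_of scale X bs" "basis_of scale X cs"
  shows "length bs = length cs"
  using assms by (metis basis_of_def distinct_card dim_span_eq_card_independent)

lemma basis_of_expansion:
  assumes "basis_of scale X bs" "x \<in> X"
  obtains a where "x = (\<Sum>i<length bs. scale (a i) (bs ! i))"
  using assms span_list_iff[of bs x] by (auto simp: basis_of_def)

lemma basis_of_subset: "basis_of scale X bs \<Longrightarrow> set bs \<subseteq> X"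
  unfolding basis_of_def using span_superset by blast

lemma nth_mem_lattice_gen:
  assumes "v 0 = \<infinity>" "v 1 = 0" "i < length bs"
  shows "bs ! i \<in> lattice_gen v scale bs"
proof -
  have "bs ! i = (\<Sum>j<length bs. scale (if j = i then 1 else 0) (bs ! j))"
    using assms(3) by (simp add: if_distrib[of "\<lambda>c. scale c _"] sum.delta cong: if_cong)
  moreover have "\<forall>j<length bs. 0 \<le> v (if j = i then 1 else 0)"
    using assms by simp
  ultimately show ?thesis
    unfolding lattice_gen_def by (intro CollectI exI[of _ "\<lambda>j. if j = i then 1 else 0"] conjI)
qed

lemma image_lattice_gen:
  assumes "Vector_Spaces.linear scale scale g"
  shows "g ` lattice_gen v scale bs = lattice_gen v scale (map g bs)"
proof -
  interpret g: Vector_Spaces.linear scale scale g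
    by (rule assms)
  have "g (\<Sum>i<length bs. scale (c i) (bs ! i)) = (\<Sum>i<length bs. scale (c i) (map g bs ! i))" for c
    by (simp add: g.sum g.scale)
  thus ?thesis
    unfolding lattice_gen_def by (simp add: setcompr_eq_image image_image)
qed

end

text \<open>The form comes from the multiplication of the ambient algebra, hence is multilinear
  everywhere, while it alternates only on \<open>X\<close>. The last axiom makes \<open>X\<close>
  three-dimensional and \<open>T\<close> a volume form on it.\<close>

locale alternating_form = vector_space +
  fixes X :: "'b set" and T :: "'b \<Rightarrow> 'b \<Rightarrow> 'b \<Rightarrow> 'a"
  assumes subspace_X: "subspace X"
    and add1: "T (x + x') y z = T x y z + T x' y z" and scale1: "T (scale c x) y z = c * T x y z"
    and add2: "T x (y + y') z = T x y z + T x y' z" and scale2: "T x (scale c y) z = c * T x y z"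
    and add3: "T x y (z + z') = T x y z + T x y z'" and scale3: "T x y (scale c z) = c * T x y z"
    and alternating: "x \<in> X \<Longrightarrow> y \<in> X \<Longrightarrow> T x x y = 0" "x \<in> X \<Longrightarrow> y \<in> X \<Longrightarrow> T y x x = 0"
    and nonzero: "\<exists>b1 b2 b3. basis_of scale X [b1, b2, b3] \<and> T b1 b2 b3 \<noteq> 0"
begin

abbreviation TL :: "'b list \<Rightarrow> 'a" where
  "TL bs \<equiv> T (bs ! 0) (bs ! 1) (bs ! 2)"

lemma transpose12:
  assumes "x \<in> X" "y \<in> X" "z \<in> X"
  shows "T y x z = - T x y z"
  using alternating(1)[of "x + y" z] alternating(1)[of x z] alternating(1)[of y z]
    subspace_add[OF subspace_X, of x y] assms
  by (simp add: add1 add2 eq_neg_iff_add_eq_0 add.commute)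

lemma transpose23:
  assumes "x \<in> X" "y \<in> X" "z \<in> X"
  shows "T x z y = - T x y z"
  using alternating(2)[of "y + z" x] alternating(2)[of y x] alternating(2)[of z x]
    subspace_add[OF subspace_X, of y z] assms
  by (simp add: add2 add3 eq_neg_iff_add_eq_0 add.commute)

lemma T_expand:
  assumes e: "\<And>i. i < 3 \<Longrightarrow> e i \<in> X"
  shows "T (\<Sum>i<3. scale (a i) (e i)) (\<Sum>i<3. scale (b i) (e i)) (\<Sum>i<3. scale (c i) (e i)) =
    det3 a b c * T (e 0) (e 1) (e 2)"
proof -
  have X: "e 0 \<in> X" "e 1 \<in> X" "e 2 \<in> X"
    by (simp_all add: e)
  have perm: "T (e 1) (e 0) (e 2) = - T (e 0) (e 1) (e 2)" "T (e 0) (e 2) (e 1) = - T (e 0) (e 1) (e 2)"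
    "T (e 2) (e 1) (e 0) = - T (e 0) (e 1) (e 2)" "T (e 1) (e 2) (e 0) = T (e 0) (e 1) (e 2)"
    "T (e 2) (e 0) (e 1) = T (e 0) (e 1) (e 2)"
    using transpose12[OF X] transpose23[OF X] transpose12[OF X(2,3,1)] transpose23[OF X(2,1,3)]
      transpose12[OF X(1,3,2)]
    by (simp_all del: One_nat_def)
  have zero: "T (e i) (e i) (e j) = 0" "T (e j) (e i) (e i) = 0" "T (e i) (e j) (e i) = 0"
    if "i < 3" "j < 3" for i j
    using alternating[OF e e, OF that] transpose23[OF e e e, OF that(1,1,2)] by simp_all
  show ?thesis
    unfolding sum_lessThan_3
    by (simp add: add1 add2 add3 scale1 scale2 scale3 zero perm det3_def del: One_nat_def)
      (simp add: algebra_simps)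
qed

lemma basis_length:
  assumes "basis_of scale X bs"
  shows "length bs = 3"
proof -
  obtain b1 b2 b3 where "basis_of scale X [b1, b2, b3]"
    using nonzero by blast
  from basis_of_length_eq[OF assms this] show ?thesis
    by simp
qed

lemma basis_nth: "basis_of scale X bs \<Longrightarrow> i < 3 \<Longrightarrow> bs ! i \<in> X"
  using basis_of_subset[of X bs] basis_length[of bs] nth_mem[of i bs] by auto

lemma basis_expansion:
  assumes "basis_of scale X bs" "x \<in> X"
  obtains a where "x = (\<Sum>i<3. scale (a i) (bs ! i))"
  using basis_of_expansion[OF assms] basis_length[OF assms(1)] by metis

lemma basis_expansions:
  assumes "basis_of scale X bs" "x \<in> X" "y \<in> X" "z \<in> X"
  obtains a b c where "x = (\<Sum>i<3. scale (a i) (bs ! i))" "y = (\<Sum>i<3. scale (b i) (bs ! i))"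
    "z = (\<Sum>i<3. scale (c i) (bs ! i))" "T x y z = det3 a b c * TL bs"
proof -
  obtain a where a: "x = (\<Sum>i<3. scale (a i) (bs ! i))"
    by (rule basis_expansion[OF assms(1,2)])
  obtain b where b: "y = (\<Sum>i<3. scale (b i) (bs ! i))"
    by (rule basis_expansion[OF assms(1,3)])
  obtain c where c: "z = (\<Sum>i<3. scale (c i) (bs ! i))"
    by (rule basis_expansion[OF assms(1,4)])
  have "T x y z = det3 a b c * TL bs"
    unfolding a b c by (rule T_expand) (rule basis_nth[OF assms(1)])
  with a b c show thesis
    by (rule that)
qed

lemma TL_nonzero:
  assumes "basis_of scale X bs"
  shows "TL bs \<noteq> 0"
proof -
  obtain x y z where xyz: "basis_of scale X [x, y, z]" "T x y z \<noteq> 0"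
    using nonzero by blast
  have "x \<in> X" "y \<in> X" "z \<in> X"
    using basis_of_subset[OF xyz(1)] by simp_all
  then obtain a b c where "T x y z = det3 a b c * TL bs"
    by (rule basis_expansions[OF assms])
  with xyz(2) show ?thesis
    by auto
qed

text \<open>Since \<open>endo_det\<close> is the factor by which an endomorphism multiplies the
  volume form, the basis picked by \<open>SOME\<close> in its definition becomes irrelevant. The
  proof expands first the images of that basis and then \<open>x\<close>, \<open>y\<close>,
  \<open>z\<close> in it.\<close>

lemma T_endo:
  assumes g: "Vector_Spaces.linear scale scale g" "g ` X \<subseteq> X" and "x \<in> X" "y \<in> X" "z \<in> X"
  shows "T (g x) (g y) (g z) = endo_det scale X g * T x y z"
proof -
  interpret g: Vector_Spaces.linear scale scale g
    by (rule g)
  define bs where "bs = (SOME bs. basis_of scale X bs)"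
  have bs: "basis_of scale X bs"
    unfolding bs_def using nonzero by (metis someI)
  have len: "length bs = 3"
    using basis_length[OF bs] .
  have bX: "bs ! i \<in> X" if "i < 3" for i
    using basis_nth[OF bs that] .
  define A where "A j i = representation (set bs) (g (bs ! j)) (bs ! i)" for j i
  have gb: "g (bs ! j) = (\<Sum>i<3. scale (A j i) (bs ! i))" if j: "j < 3" for j
  proof -
    have "g (bs ! j) \<in> span (set bs)"
      using g(2) bX[OF j] bs by (auto simp: basis_of_def)
    hence "g (bs ! j) = (\<Sum>b\<in>set bs. scale (representation (set bs) (g (bs ! j)) b) b)"
      using bs by (subst sum_representation_eq) (auto simp: basis_of_def)
    also have "\<dots> = (\<Sum>i<3. scale (A j i) (bs ! i))"
      unfolding A_def len[symmetric] using bs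
      by (intro sum.reindex_bij_betw[symmetric] bij_betw_nth) (auto simp: basis_of_def)
    finally show ?thesis .
  qed
  have "T (g (bs ! 0)) (g (bs ! 1)) (g (bs ! 2)) = det3 (A 0) (A 1) (A 2) * TL bs"
    using T_expand[of "(!) bs" "A 0" "A 1" "A 2"] bX gb by simp
  also have "det3 (A 0) (A 1) (A 2) = endo_det scale X g"
    unfolding endo_det_def Let_def bs_def[symmetric] len det_mat_3 by (simp add: A_def[abs_def])
  finally have TLg: "T (g (bs ! 0)) (g (bs ! 1)) (g (bs ! 2)) = endo_det scale X g * TL bs" .
  obtain a b c where abc: "x = (\<Sum>i<3. scale (a i) (bs ! i))" "y = (\<Sum>i<3. scale (b i) (bs ! i))"
    "z = (\<Sum>i<3. scale (c i) (bs ! i))" "T x y z = det3 a b c * TL bs"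
    using basis_expansions[OF bs assms(3-5)] .
  have "T (g x) (g y) (g z) = det3 a b c * T (g (bs ! 0)) (g (bs ! 1)) (g (bs ! 2))"
    using T_expand[of "\<lambda>i. g (bs ! i)" a b c] bX g(2) by (simp add: abc g.sum g.scale image_subset_iff)
  thus ?thesis
    by (simp add: TLg abc(4) del: One_nat_def)
qed

end

locale valued_alternating_form = valued_space v p scale + alternating_form scale X T
  for v :: "'a::field \<Rightarrow> ereal" and p :: nat
    and scale :: "'a \<Rightarrow> 'v::ab_group_add \<Rightarrow> 'v" and X T
begin

lemma v_TL:
  assumes "basis_of scale X bs"
  obtains n :: int where "v (TL bs) = ereal n"
  using v_int TL_nonzero[OF assms] by blast

text \<open>Integral coordinates have an integral determinant. As a basis belongs to the lattice it
  generates, \<open>v (TL bs)\<close> is the minimum of \<open>v\<close> of \<open>T\<close> over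
  triples of the lattice, an invariant of the lattice alone.\<close>

lemma le_v_T_lattice:
  assumes bs: "basis_of scale X bs" and x: "x \<in> lattice_gen v scale bs"
    and y: "y \<in> lattice_gen v scale bs" and z: "z \<in> lattice_gen v scale bs"
  shows "v (TL bs) \<le> v (T x y z)"
proof -
  have len: "length bs = 3"
    using basis_length[OF bs] .
  have ex: "\<exists>a. u = (\<Sum>i<3. scale (a i) (bs ! i)) \<and> (\<forall>i<3. 0 \<le> v (a i))"
    if "u \<in> lattice_gen v scale bs" for u
    using that unfolding lattice_gen_def len by blast
  obtain a b c where a: "x = (\<Sum>i<3. scale (a i) (bs ! i))" "\<forall>i<3. 0 \<le> v (a i)"
    and b: "y = (\<Sum>i<3. scale (b i) (bs ! i))" "\<forall>i<3. 0 \<le> v (b i)"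
    and c: "z = (\<Sum>i<3. scale (c i) (bs ! i))" "\<forall>i<3. 0 \<le> v (c i)"
    using ex[OF x] ex[OF y] ex[OF z] by blast
  have "T x y z = det3 a b c * TL bs"
    unfolding a b c by (rule T_expand) (rule basis_nth[OF bs])
  moreover have "0 \<le> v (det3 a b c)"
    using le_v_det3[of 0 "\<lambda>_. 0" a 0 b 0 c] a b c by (simp add: zero_ereal_def)
  ultimately show ?thesis
    using add_right_mono[of 0 "v (det3 a b c)" "v (TL bs)"] by (simp add: v_mult)
qed

text \<open>Supplies the automorphism without which the definite description in
  \<open>lattice_vol\<close> would have no solution.\<close>

lemma exists_linear_basis_map:
  assumes cs: "basis_of scale X cs" and bs: "basis_of scale X bs"
  obtains g where "Vector_Spaces.linear scale scale g" "bij_betw g X X" "map g cs = bs"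
proof -
  interpret vector_space_pair scale scale ..
  have dist: "distinct cs" "distinct bs" "length cs = length bs"
    using cs bs basis_of_length_eq[OF cs bs] by (simp_all add: basis_of_def)
  have ind: "independent (set cs)" "independent (set bs)"
    using cs bs by (auto simp: basis_of_def)
  define h where "h x = bs ! (THE i. i < length cs \<and> cs ! i = x)" for x
  have h: "h (cs ! i) = bs ! i" if "i < length cs" for i
  proof -
    have "(THE j. j < length cs \<and> cs ! j = cs ! i) = i"
      using that dist by (intro the_equality) (auto simp: nth_eq_iff_index_eq)
    thus ?thesis by (simp add: h_def)
  qed
  obtain g where g: "Vector_Spaces.linear scale scale g" "\<forall>x\<in>set cs. g x = h x"
    using linear_independent_extend[OF ind(1)] by blast
  have map: "map g cs = bs"
    using g(2) h dist(3) by (simp add: list_eq_iff_nth_eq)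
  hence set: "g ` set cs = set bs"
    by (metis set_map)
  have "inj_on g (set cs)"
    using map dist by (metis distinct_map)
  hence "inj_on g (span (set cs))"
    using linear_inj_on_span_independent_image[OF g(1)] set ind by simp
  moreover have "g ` span (set cs) = span (set bs)"
    using linear_span_image[OF g(1), of "set cs"] set by simp
  ultimately have "bij_betw g X X"
    using cs bs by (simp add: basis_of_def bij_betw_def)
  with g(1) map that show thesis
    by blast
qed

text \<open>An automorphism \<open>g\<close> carrying one lattice onto the other shifts the minimum
  of \<open>v\<close> of \<open>T\<close> by the valuation of its determinant. This applies to every
  such \<open>g\<close>, also when it does not map \<open>cs\<close> to \<open>bs\<close>.\<close>

lemma lattice_vol_eq:
  assumes cs: "basis_of scale X cs" and bs: "basis_of scale X bs"
  shows "lattice_vol v scale X (lattice_gen v scale cs) (lattice_gen v scale bs) = v (TL bs) - v (TL cs)"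
proof -
  have endo_det: "v (endo_det scale X g) = v (TL bs) - v (TL cs)"
    if g: "Vector_Spaces.linear scale scale g" "bij_betw g X X"
      and img: "g ` lattice_gen v scale cs = lattice_gen v scale bs" for g
  proof -
    have gX: "g ` X \<subseteq> X"
      using g by (simp add: bij_betw_def)
    have len: "length cs = 3" "length bs = 3"
      using cs bs by (auto simp: basis_length)
    have "v (TL bs) \<le> v (T (g (cs ! 0)) (g (cs ! 1)) (g (cs ! 2)))"
      using nth_mem_lattice_gen[of v _ cs] len img by (intro le_v_T_lattice[OF bs]) auto
    also have "\<dots> = v (endo_det scale X g) + v (TL cs)"
      using T_endo[OF g(1) gX] basis_nth[OF cs] by (simp add: v_mult)
    finally have 1: "v (TL bs) \<le> v (endo_det scale X g) + v (TL cs)" .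
    \<comment> \<open>For the reverse inequality \<open>bs\<close> is pulled back to elements
      \<open>u i\<close> of the lattice of \<open>cs\<close>, on which \<open>T\<close> has
      valuation at least \<open>v (TL cs)\<close>.\<close>
    have "\<forall>i\<in>{..<3}. \<exists>u. u \<in> lattice_gen v scale cs \<and> g u = bs ! i"
    proof
      fix i :: nat assume "i \<in> {..<3}"
      hence "bs ! i \<in> g ` lattice_gen v scale cs"
        using nth_mem_lattice_gen[of v i bs] len img by simp
      then obtain u where "bs ! i = g u" "u \<in> lattice_gen v scale cs"
        by (rule imageE)
      thus "\<exists>u. u \<in> lattice_gen v scale cs \<and> g u = bs ! i"
        by (intro exI[of _ u]) simp
    qed
    from bchoice[OF this] obtain u where
      u: "\<And>i. i < 3 \<Longrightarrow> u i \<in> lattice_gen v scale cs" "\<And>i. i < 3 \<Longrightarrow> g (u i) = bs ! i"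
      by auto
    have uX: "u i \<in> X" if "i < 3" for i
    proof -
      have "lattice_gen v scale cs \<subseteq> X"
        unfolding lattice_gen_def using basis_nth[OF cs] len subspace_X
        by (auto intro!: subspace_sum subspace_scale)
      thus ?thesis
        using u(1)[OF that] by blast
    qed
    have "v (endo_det scale X g) + v (TL cs) \<le> v (endo_det scale X g) + v (T (u 0) (u 1) (u 2))"
      using u by (intro add_left_mono le_v_T_lattice[OF cs]) auto
    also have "\<dots> = v (T (g (u 0)) (g (u 1)) (g (u 2)))"
      using T_endo[OF g(1) gX] uX by (simp add: v_mult)
    also have "\<dots> = v (TL bs)"
      using u by simp
    finally have "v (endo_det scale X g) + v (TL cs) = v (TL bs)"
      using 1 by simp
    moreover obtain m :: int where "v (TL cs) = ereal m"
      by (rule v_TL[OF cs])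
    moreover obtain n :: int where "v (TL bs) = ereal n"
      by (rule v_TL[OF bs])
    ultimately show ?thesis
      by (cases "v (endo_det scale X g)") auto
  qed
  obtain g where g: "Vector_Spaces.linear scale scale g" "bij_betw g X X" "map g cs = bs"
    by (rule exists_linear_basis_map[OF cs bs])
  have "g ` lattice_gen v scale cs = lattice_gen v scale bs"
    using image_lattice_gen[OF g(1)] g(3) by simp
  with g(1,2) show ?thesis
    unfolding lattice_vol_def
    by (intro the_equality exI[of _ g]) (auto simp: endo_det)
qed

section \<open>The volume of a norm\<close>

context
  fixes \<alpha> :: "'v \<Rightarrow> ereal" and es :: "'v list"
  assumes \<alpha>: "norm_on v scale X \<alpha>" and es: "basis_of scale X es" "basis_splits_norm scale es \<alpha>"
begin

lemma norm_basis:
  assumes "basis_of scale X bs" "i < 3"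
  obtains k where "k \<in> \<rat>" "\<alpha> (bs ! i) = ereal k"
proof -
  have "bs ! i \<noteq> 0"
  proof
    assume "bs ! i = 0"
    hence "0 \<in> set bs"
      using assms basis_length[OF assms(1)] by (metis nth_mem)
    thus False
      using assms dependent_zero by (auto simp: basis_of_def)
  qed
  thus thesis
    using norm_rat[OF \<alpha> basis_nth[OF assms]] that by metis
qed

lemma splitting_basis_norm_eq:
  "\<alpha> (\<Sum>i<3. scale (c i) (es ! i)) = (INF i\<in>{..<3}. v (c i) + \<alpha> (es ! i))"
  using splitting_norm_eq[OF _ _ basis_of_subset[OF es(1)] es(2) subspace_X \<alpha>, of c] es(1)
    basis_length[OF es(1)] by (simp add: basis_of_def)

text \<open>An inequality of Hadamard type. Since the norm is the minimum over the coordinates, a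
  vector of norm \<open>q\<close> has \<open>i\<close>-th coordinate of valuation at least
  \<open>q - k i\<close>; the bound on \<open>det3\<close> then applies.\<close>

lemma le_v_T_norm:
  assumes "x \<in> X" "y \<in> X" "z \<in> X"
  shows "\<alpha> x + \<alpha> y + \<alpha> z + (v (TL es) - (\<Sum>i<3. \<alpha> (es ! i))) \<le> v (T x y z)"
proof (cases "x = 0 \<or> y = 0 \<or> z = 0")
  case True
  hence "T x y z = 0"
    using scale1[of 0 0 y z] scale2[of x 0 0 z] scale3[of x y 0 0] by auto
  thus ?thesis
    by simp
next
  case False
  obtain r where r: "\<alpha> x = ereal r"
    using norm_rat[OF \<alpha> assms(1)] False by metis
  obtain s where s: "\<alpha> y = ereal s"
    using norm_rat[OF \<alpha> assms(2)] False by metis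
  obtain t where t: "\<alpha> z = ereal t"
    using norm_rat[OF \<alpha> assms(3)] False by metis
  define k where "k i = real_of_ereal (\<alpha> (es ! i))" for i
  have k: "\<alpha> (es ! i) = ereal (k i)" if "i < 3" for i
    using norm_basis[OF es(1) that] unfolding k_def by (metis real_of_ereal.simps(1))
  obtain a b c where abc: "x = (\<Sum>i<3. scale (a i) (es ! i))" "y = (\<Sum>i<3. scale (b i) (es ! i))"
    "z = (\<Sum>i<3. scale (c i) (es ! i))" "T x y z = det3 a b c * TL es"
    using assms by (rule basis_expansions[OF es(1)])
  have coeff: "ereal (q - k i) \<le> v (d i)"
    if "\<alpha> (\<Sum>i<3. scale (d i) (es ! i)) = ereal q" "i < 3" for d q i
  proof -
    have "ereal q \<le> v (d i) + ereal (k i)"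
      using splitting_basis_norm_eq[of d] that k[OF that(2)] by (auto intro!: INF_lower2[of i])
    thus ?thesis
      by (cases "v (d i)") auto
  qed
  have "ereal (r + s + t - (\<Sum>i<3. k i)) \<le> v (det3 a b c)"
    using r s t abc by (intro le_v_det3 coeff) auto
  moreover obtain m :: int where "v (TL es) = ereal m"
    by (rule v_TL[OF es(1)])
  ultimately show ?thesis
    using abc(4) k r s t by (cases "v (det3 a b c)") (auto simp: v_mult)
qed

end

text \<open>The Hadamard inequality at the vectors of \<open>bs\<close>. A splitting basis minimizes
  this expression among all bases, so any two splitting bases agree and the volume of a norm is well
  defined.\<close>

lemma splitting_basis_volume_le:
  assumes \<alpha>: "norm_on v scale X \<alpha>" and es: "basis_of scale X es" "basis_splits_norm scale es \<alpha>"
    and bs: "basis_of scale X bs"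
  shows "v (TL es) - (\<Sum>i<3. \<alpha> (es ! i)) \<le> v (TL bs) - (\<Sum>i<3. \<alpha> (bs ! i))"
proof -
  define k where "k cs i = real_of_ereal (\<alpha> (cs ! i))" for cs i
  have k: "\<alpha> (cs ! i) = ereal (k cs i)" if "basis_of scale X cs" "i < 3" for cs i
    using norm_basis[OF \<alpha> es that] unfolding k_def by (metis real_of_ereal.simps(1))
  have sum: "(\<Sum>i<3. \<alpha> (cs ! i)) = ereal (\<Sum>i<3. k cs i)" if "basis_of scale X cs" for cs
    using k[OF that] by simp
  have "\<alpha> (bs ! 0) + \<alpha> (bs ! 1) + \<alpha> (bs ! 2) + (v (TL es) - (\<Sum>i<3. \<alpha> (es ! i))) \<le> v (TL bs)"
    by (intro le_v_T_norm[OF \<alpha> es] basis_nth[OF bs]) simp_all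
  moreover have "\<alpha> (bs ! 0) + \<alpha> (bs ! 1) + \<alpha> (bs ! 2) = (\<Sum>i<3. \<alpha> (bs ! i))"
    by (simp only: sum_lessThan_3)
  moreover obtain m :: int where "v (TL es) = ereal m"
    by (rule v_TL[OF es(1)])
  moreover obtain n :: int where "v (TL bs) = ereal n"
    by (rule v_TL[OF bs])
  ultimately show ?thesis
    unfolding sum[OF es(1)] sum[OF bs] by simp
qed

lemma norm_vol_eq:
  assumes cs: "basis_of scale X cs" and \<alpha>: "norm_on v scale X \<alpha>"
    and es: "basis_of scale X es" "basis_splits_norm scale es \<alpha>"
  shows "norm_vol v scale X (lattice_gen v scale cs) \<alpha> = v (TL es) - v (TL cs) - (\<Sum>i<3. \<alpha> (es ! i))"
proof -
  have vol: "lattice_vol v scale X (lattice_gen v scale cs) (lattice_gen v scale bs) - (\<Sum>i<length bs. \<alpha> (bs ! i)) =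
      v (TL es) - v (TL cs) - (\<Sum>i<3. \<alpha> (es ! i))"
    if bs: "basis_of scale X bs" "basis_splits_norm scale bs \<alpha>" for bs
  proof -
    obtain l :: int where "v (TL cs) = ereal l"
      by (rule v_TL[OF cs])
    moreover obtain m :: int where "v (TL es) = ereal m"
      by (rule v_TL[OF es(1)])
    moreover obtain n :: int where "v (TL bs) = ereal n"
      by (rule v_TL[OF bs(1)])
    moreover have "v (TL es) - (\<Sum>i<3. \<alpha> (es ! i)) = v (TL bs) - (\<Sum>i<3. \<alpha> (bs ! i))"
      using splitting_basis_volume_le[OF \<alpha> es bs(1)] splitting_basis_volume_le[OF \<alpha> bs es(1)] by simp
    ultimately show ?thesis
      unfolding lattice_vol_eq[OF cs bs(1)] basis_length[OF bs(1)]
      by (cases "\<Sum>i<3. \<alpha> (es ! i)"; cases "\<Sum>i<3. \<alpha> (bs ! i)") auto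
  qed
  show ?thesis
    unfolding norm_vol_def using vol es by (intro the_equality) metis+
qed

end

section \<open>Norms on the split octonions\<close>

lemma INF_lessThan_3: "(INF i\<in>{..<3::nat}. g i) = min (g 0) (min (g 1) (g 2 :: ereal))"
proof -
  have "{..<3::nat} = {0, 1, 2}"
    by auto
  thus ?thesis
    by (simp add: inf_min)
qed

context vector_space
begin

text \<open>Uniqueness of the decomposition of a vector justifies the definite description in
  \<open>wedge\<close>.\<close>

lemma wedge_eq:
  assumes "direct_sum scale X A C" "a \<in> A" "c \<in> C"
  shows "wedge A C \<alpha> \<beta> (a + c) = min (\<alpha> a) (\<beta> c)"
  unfolding wedge_def
proof (rule the_equality)
  show "\<exists>a'\<in>A. \<exists>c'\<in>C. a + c = a' + c' \<and> min (\<alpha> a) (\<beta> c) = min (\<alpha> a') (\<beta> c')"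
    using assms by blast
  fix r assume "\<exists>a'\<in>A. \<exists>c'\<in>C. a + c = a' + c' \<and> r = min (\<alpha> a') (\<beta> c')"
  then obtain a' c' where r: "a' \<in> A" "c' \<in> C" "a + c = a' + c'" "r = min (\<alpha> a') (\<beta> c')"
    by blast
  have sub: "subspace A" "subspace C" "A \<inter> C = {0}"
    using assms(1) by (auto simp: direct_sum_def)
  have "a - a' = c' - c"
    using r(3) by (simp add: algebra_simps)
  hence "a - a' \<in> A \<inter> C"
    using subspace_diff[OF sub(1) assms(2) r(1)] subspace_diff[OF sub(2) r(2) assms(3)] by simp
  hence "a' = a" "c' = c"
    using sub(3) r(3) by auto
  with r(4) show "r = min (\<alpha> a) (\<beta> c)"
    by simp
qed

lemma norm_split_byI:
  assumes "direct_sum scale X A C" "\<And>a c. a \<in> A \<Longrightarrow> c \<in> C \<Longrightarrow> \<alpha> (a + c) = min (\<alpha> a) (\<alpha> c)"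
  shows "norm_split_by scale X A C \<alpha>"
  using assms wedge_eq[OF assms(1)] unfolding norm_split_by_def
  by (auto simp: direct_sum_def)

lemma norm_split_byD:
  assumes "norm_split_by scale X A C \<alpha>" "a \<in> A" "c \<in> C"
  shows "\<alpha> (a + c) = min (\<alpha> a) (\<alpha> c)"
proof -
  have "a + c \<in> X"
    using assms by (auto simp: norm_split_by_def direct_sum_def)
  thus ?thesis
    using assms wedge_eq[of X A C a c \<alpha> \<alpha>] by (simp add: norm_split_by_def)
qed

end

context split_octonion_algebra
begin

lemma biorthogonal_independent:
  assumes "\<forall>i<length bs. \<forall>j<length bs. B (bs ! i) (cs ! j) = (if i = j then 1 else 0)"
  shows "distinct bs \<and> independent (set bs)"
proof
  show dist: "distinct bs"
    unfolding distinct_conv_nth using assms by (metis zero_neq_one)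
  show "independent (set bs)"
  proof (rule independent_if_scalars_zero)
    fix u x assume sum: "(\<Sum>x\<in>set bs. scale (u x) x) = 0" and "x \<in> set bs"
    then obtain i where i: "i < length bs" "x = bs ! i"
      by (auto simp: in_set_conv_nth)
    have B_sum: "B (sum h I) y = (\<Sum>i\<in>I. B (h i) y)" if "finite I" for h y and I :: "nat set"
      using that by induction (simp_all add: B_linear)
    have "(\<Sum>j<length bs. scale (u (bs ! j)) (bs ! j)) = (\<Sum>x\<in>set bs. scale (u x) x)"
      by (rule sum.reindex_bij_betw[OF bij_betw_nth]) (auto simp: dist)
    hence "B (\<Sum>j<length bs. scale (u (bs ! j)) (bs ! j)) (cs ! i) = 0"
      using sum by simp
    moreover have "B (\<Sum>j<length bs. scale (u (bs ! j)) (bs ! j)) (cs ! i) =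
        (\<Sum>j<length bs. if j = i then u (bs ! j) else 0)"
      unfolding B_sum[OF finite_lessThan] using assms i(1) by (intro sum.cong) (auto simp: B_linear)
    ultimately show "u x = 0"
      using i by (simp add: sum.delta)
  qed simp
qed

end

section \<open>Dual bases and special bases\<close>

context octonion_polarization
begin

text \<open>Up to the factor \<open>T a b c\<close> the products \<open>b c\<close>,
  \<open>c a\<close>, \<open>a b\<close> are dual to \<open>a\<close>, \<open>b\<close>,
  \<open>c\<close>; the cyclic order avoids signs.\<close>

lemma B_mul_eq_T:
  assumes abc: "a \<in> Wp" "b \<in> Wp" "c \<in> Wp"
  shows "B a (mul b c) = T a b c" "B b (mul c a) = T a b c" "B c (mul a b) = T a b c"
    "B a (mul c a) = 0" "B a (mul a b) = 0" "B b (mul b c) = 0" "B b (mul a b) = 0"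
    "B c (mul b c) = 0" "B c (mul c a) = 0"
  using T_rotate[OF abc] T_alternating[OF abc(1,2)] T_alternating[OF abc(2,3)] T_alternating[OF abc(3,1)]
    T_alternating[OF abc(2,1)] T_alternating[OF abc(3,2)] T_alternating[OF abc(1,3)]
  by (simp_all add: T_def B_commute[of a] B_commute[of b] B_commute[of c])

lemma basis_of_Wp_if_T_nonzero:
  assumes abc: "a \<in> Wp" "b \<in> Wp" "c \<in> Wp" and T: "T a b c \<noteq> 0"
  shows "basis_of scale Wp [a, b, c]"
proof -
  let ?t = "inverse (T a b c)"
  have "\<forall>i<length [a, b, c]. \<forall>j<length [a, b, c].
      B ([a, b, c] ! i) ([scale ?t (mul b c), scale ?t (mul c a), scale ?t (mul a b)] ! j) = (if i = j then 1 else 0)"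
    using T by (simp add: All_less_Suc B_linear B_mul_eq_T[OF abc])
  hence ind: "distinct [a, b, c] \<and> independent (set [a, b, c])"
    by (rule biorthogonal_independent)
  have "span {a, b, c} = Wp"
  proof (rule antisym)
    show "span {a, b, c} \<subseteq> Wp"
      using abc subspace_Wp by (intro span_minimal) auto
    show "Wp \<subseteq> span {a, b, c}"
    proof
      fix x assume "x \<in> Wp"
      from cramer[OF abc this T] have "scale (T a b c) x \<in> span {a, b, c}"
        by (auto intro!: span_add span_scale intro: span_base)
      hence "scale ?t (scale (T a b c) x) \<in> span {a, b, c}"
        by (rule span_scale)
      thus "x \<in> span {a, b, c}"
        using T by simp
    qed
  qed
  with ind show ?thesis
    by (simp add: basis_of_def)
qed

end

sublocale octonion_polarization \<subseteq> Wp: alternating_form scale Wp T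
proof
  show "subspace Wp"
    by (rule subspace_Wp)
  show "\<exists>b1 b2 b3. basis_of scale Wp [b1, b2, b3] \<and> T b1 b2 b3 \<noteq> 0"
    using basis_of_Wp_if_T_nonzero exists_T_eq_1 by (metis zero_neq_one)
qed (simp_all add: T_def mul_linear B_linear T_alternating[unfolded T_def])

context octonion_polarization
begin

text \<open>As in three-space, the dual basis consists of cross products divided by the triple
  product. It is unique because an element of \<open>Wm\<close> is determined by its pairings with
  \<open>f1\<close>, \<open>f2\<close>, \<open>f3\<close>.\<close>

lemma dual_basis_of_iff:
  assumes bs: "basis_of scale Wp [f1, f2, f3]"
  shows "dual_basis_of scale B Wm [f1, f2, f3] [g1, g2, g3] \<longleftrightarrow>
    g1 = scale (inverse (T f1 f2 f3)) (mul f2 f3) \<and> g2 = scale (inverse (T f1 f2 f3)) (mul f3 f1) \<and>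
    g3 = scale (inverse (T f1 f2 f3)) (mul f1 f2)"
proof -
  have f: "f1 \<in> Wp" "f2 \<in> Wp" "f3 \<in> Wp"
    using basis_of_subset[OF bs] by auto
  let ?t = "inverse (T f1 f2 f3)"
  have T: "T f1 f2 f3 \<noteq> 0"
    using Wp.TL_nonzero[OF bs] by simp
  let ?g1 = "scale ?t (mul f2 f3)" and ?g2 = "scale ?t (mul f3 f1)" and ?g3 = "scale ?t (mul f1 f2)"
  have g: "?g1 \<in> Wm" "?g2 \<in> Wm" "?g3 \<in> Wm"
    using f by (auto intro!: subspace_scale[OF subspace_Wm] mul_Wp_Wp)
  have dual: "\<forall>i<length [f1, f2, f3]. \<forall>j<length [f1, f2, f3].
      B ([f1, f2, f3] ! i) ([?g1, ?g2, ?g3] ! j) = (if i = j then 1 else 0)"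
    using T by (simp add: All_less_Suc B_linear B_mul_eq_T[OF f])
  have eqI: "y = z" if yz: "y \<in> Wm" "z \<in> Wm" and "B f1 y = B f1 z" "B f2 y = B f2 z" "B f3 y = B f3 z" for y z
  proof (rule Wm_eqI[OF yz])
    fix x assume "x \<in> Wp"
    then obtain a where "x = (\<Sum>i<3. scale (a i) ([f1, f2, f3] ! i))"
      by (rule Wp.basis_expansion[OF bs])
    thus "B y x = B z x"
      using that(3-5) by (simp add: sum_lessThan_3 B_linear B_commute[of y] B_commute[of z])
  qed
  have Wm_expand: "y = scale (B f1 y) ?g1 + scale (B f2 y) ?g2 + scale (B f3 y) ?g3" if y: "y \<in> Wm" for y
  proof (rule eqI)
    show "scale (B f1 y) ?g1 + scale (B f2 y) ?g2 + scale (B f3 y) ?g3 \<in> Wm"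
      by (simp add: subspace_add[OF subspace_Wm] subspace_scale[OF subspace_Wm] mul_Wp_Wp f)
  qed (use y T in \<open>simp_all add: B_linear B_mul_eq_T[OF f]\<close>)
  have "dual_basis_of scale B Wm [f1, f2, f3] [?g1, ?g2, ?g3]"
  proof -
    have "span {?g1, ?g2, ?g3} = Wm"
    proof (rule antisym)
      show "span {?g1, ?g2, ?g3} \<subseteq> Wm"
        using g subspace_Wm by (intro span_minimal) auto
      show "Wm \<subseteq> span {?g1, ?g2, ?g3}"
      proof
        fix y assume y: "y \<in> Wm"
        show "y \<in> span {?g1, ?g2, ?g3}"
          by (subst Wm_expand[OF y]) (intro span_add span_scale span_base; simp)
      qed
    qed
    moreover have "distinct [?g1, ?g2, ?g3] \<and> independent (set [?g1, ?g2, ?g3])"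
      by (rule biorthogonal_independent[of _ "[f1, f2, f3]"])
        (use T in \<open>simp add: All_less_Suc B_linear B_mul_eq_T[OF f] B_commute[of "mul f2 f3"]
          B_commute[of "mul f3 f1"] B_commute[of "mul f1 f2"]\<close>)
    ultimately show ?thesis
      using dual by (simp add: dual_basis_of_def basis_of_def)
  qed
  moreover have "g1 = ?g1 \<and> g2 = ?g2 \<and> g3 = ?g3"
    if d: "dual_basis_of scale B Wm [f1, f2, f3] [g1, g2, g3]"
  proof -
    have "basis_of scale Wm [g1, g2, g3]"
      and d': "\<forall>i<3. \<forall>j<3. B ([f1, f2, f3] ! i) ([g1, g2, g3] ! j) = (if i = j then 1 else 0)"
      using d by (simp_all add: dual_basis_of_def)
    hence "g1 \<in> Wm" "g2 \<in> Wm" "g3 \<in> Wm"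
      using basis_of_subset by force+
    thus ?thesis
      using g dual d' by (intro conjI eqI) (simp_all add: All_less_Suc eval_nat_numeral)
  qed
  ultimately show ?thesis
    by blast
qed

lemma dual_basis_exists:
  assumes "basis_of scale Wp es"
  obtains gs where "dual_basis_of scale B Wm es gs"
proof -
  obtain f1 f2 f3 where es: "es = [f1, f2, f3]"
    using Wp.basis_length[OF assms] by (auto simp: numeral_3_eq_3 length_Suc_conv)
  have "dual_basis_of scale B Wm es [scale (inverse (T f1 f2 f3)) (mul f2 f3),
      scale (inverse (T f1 f2 f3)) (mul f3 f1), scale (inverse (T f1 f2 f3)) (mul f1 f2)]"
    unfolding es by (simp add: dual_basis_of_iff[OF assms[unfolded es]])
  thus thesis
    by (rule that)
qed

text \<open>The identity \<open>(f2 f3)(f3 f1) = T f3\<close>, with \<open>T\<close> taken at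
  \<open>f1\<close>, \<open>f2\<close>, \<open>f3\<close>, cancels one of the two factors
  \<open>1 / T\<close> contributed by \<open>g1\<close> and \<open>g2\<close>.\<close>

lemma dual_basis_mul:
  assumes bs: "basis_of scale Wp [f1, f2, f3]" and d: "dual_basis_of scale B Wm [f1, f2, f3] [g1, g2, g3]"
  shows "mul g1 g2 = scale (inverse (T f1 f2 f3)) f3"
proof -
  have f: "f1 \<in> Wp" "f2 \<in> Wp" "f3 \<in> Wp"
    using basis_of_subset[OF bs] by auto
  have "T f1 f2 f3 \<noteq> 0"
    using Wp.TL_nonzero[OF bs] by simp
  moreover have "g1 = scale (inverse (T f1 f2 f3)) (mul f2 f3)" "g2 = scale (inverse (T f1 f2 f3)) (mul f3 f1)"
    using d unfolding dual_basis_of_iff[OF bs] by auto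
  ultimately show ?thesis
    using mul_products[OF f(2,3,1)] T_rotate[OF f] by (simp add: mul_linear)
qed

lemma dual_basis_T:
  assumes bs: "basis_of scale Wp [f1, f2, f3]" and d: "dual_basis_of scale B Wm [f1, f2, f3] [g1, g2, g3]"
  shows "T g1 g2 g3 = inverse (T f1 f2 f3)"
  using d unfolding T_def[of g1] dual_basis_mul[OF assms]
  by (simp add: dual_basis_of_def B_linear All_less_Suc)

lemma special_basis_iff:
  "special_basis scale mul B Wp Wm bs \<longleftrightarrow> basis_of scale Wp bs \<and> Wp.TL bs = 1"
proof
  assume "special_basis scale mul B Wp Wm bs"
  then obtain f1 f2 f3 g1 g2 g3 where f: "bs = [f1, f2, f3]" "basis_of scale Wp [f1, f2, f3]"
    "dual_basis_of scale B Wm [f1, f2, f3] [g1, g2, g3]" "f3 = mul g1 g2"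
    unfolding special_basis_def by blast
  have "f3 \<noteq> 0"
    using f(2) dependent_zero[of "{f1, f2, f3}"] by (auto simp: basis_of_def)
  moreover have "scale (inverse (T f1 f2 f3)) f3 = f3"
    using dual_basis_mul[OF f(2,3), symmetric] f(4)[symmetric] by (rule trans)
  ultimately have "T f1 f2 f3 = 1"
    using scale_cancel_right[of "inverse (T f1 f2 f3)" f3 1] by simp
  with f(1,2) show "basis_of scale Wp bs \<and> Wp.TL bs = 1"
    by simp
next
  assume bs: "basis_of scale Wp bs \<and> Wp.TL bs = 1"
  obtain f1 f2 f3 where f: "bs = [f1, f2, f3]"
    using Wp.basis_length[of bs] bs by (auto simp: numeral_3_eq_3 length_Suc_conv)
  have b: "basis_of scale Wp [f1, f2, f3]" and T: "T f1 f2 f3 = 1"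
    using bs f by auto
  have d: "dual_basis_of scale B Wm [f1, f2, f3] [mul f2 f3, mul f3 f1, mul f1 f2]"
    unfolding dual_basis_of_iff[OF b] by (simp add: T)
  have "f3 = mul (mul f2 f3) (mul f3 f1)"
    using dual_basis_mul[OF b d] by (simp add: T)
  with f b d show "special_basis scale mul B Wp Wm bs"
    unfolding special_basis_def by (intro exI conjI)
qed

lemma special_basis_exists:
  obtains bs where "special_basis scale mul B Wp Wm bs"
proof -
  obtain x y z where "x \<in> Wp" "y \<in> Wp" "z \<in> Wp" "T x y z = 1"
    by (rule exists_T_eq_1)
  hence "special_basis scale mul B Wp Wm [x, y, z]"
    using basis_of_Wp_if_T_nonzero[of x y z] by (simp add: special_basis_iff)
  thus thesis
    by (rule that)
qed

lemma dual_basis_flip: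
  assumes "basis_of scale Wp es" "dual_basis_of scale B Wm es gs"
  shows "basis_of scale Wm gs" "dual_basis_of scale B Wp gs es"
  using assms by (auto simp: dual_basis_of_def B_commute)

lemma dual_expansion:
  assumes es: "basis_of scale Wp es" and gs: "dual_basis_of scale B Wm es gs" and x: "x \<in> Wp"
  shows "x = (\<Sum>i<3. scale (B x (gs ! i)) (es ! i))"
proof -
  have d: "\<forall>i<3. \<forall>j<3. B (es ! i) (gs ! j) = (if i = j then 1 else 0)"
    using gs Wp.basis_length[OF es] by (simp add: dual_basis_of_def)
  obtain a where a: "x = (\<Sum>i<3. scale (a i) (es ! i))"
    by (rule Wp.basis_expansion[OF es x])
  have "B x (gs ! i) = a i" if "i < 3" for i
    using that d unfolding a by (auto simp: sum_lessThan_3 B_linear eval_nat_numeral less_Suc_eq)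
  thus ?thesis
    using a by simp
qed

section \<open>Coordinates on V and the product in them\<close>

lemma components:
  assumes x: "x = scale a ep + scale b em + (y + z)" and y: "y \<in> Wp" and z: "z \<in> Wm"
  shows "B x em = a" "B x ep = b" "proj_p x = y" "proj_m x = z"
proof -
  show ab: "B x em = a" "B x ep = b"
    using y z by (simp_all add: x B_linear B_ep_ep B_em_em B_ep_em B_em_ep Wp_D Wm_D)
  show "proj_p x = y" "proj_m x = z"
    unfolding proj_p_def proj_m_def ab
    using y z by (simp_all add: x mul_linear idempotent mul_ep_em mul_em_ep Wp_D Wm_D)
qed

lemma B_idempotent_Wp_Wm:
  "x \<in> Wp \<Longrightarrow> B ep x = 0" "x \<in> Wp \<Longrightarrow> B em x = 0"
  "x \<in> Wm \<Longrightarrow> B ep x = 0" "x \<in> Wm \<Longrightarrow> B em x = 0"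
  using Wp_D(6,7) Wm_D(6,7) by (metis B_commute)+

lemma B_decomposition:
  "B x y = B x em * B y ep + B x ep * B y em + B (proj_p x) (proj_m y) + B (proj_m x) (proj_p y)"
proof -
  have "B (scale a ep + scale b em + (u + w)) (scale a' ep + scale b' em + (u' + w')) =
      a * b' + b * a' + B u w' + B w u'"
    if "u \<in> Wp" "u' \<in> Wp" "w \<in> Wm" "w' \<in> Wm" for a b a' b' u u' w w'
    using that by (simp add: B_linear B_ep_ep B_em_em B_ep_em B_em_ep B_idempotent_Wp_Wm Wp_D Wm_D
        B_Wp_Wp B_Wm_Wm algebra_simps)
  from this[OF proj_p_Wp proj_p_Wp proj_m_Wm proj_m_Wm, of "B x em" "B x ep" x x "B y em" "B y ep" y y]
  show ?thesis
    by (simp only: decomposition[symmetric])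
qed

text \<open>This is Zorn's vector-matrix multiplication: \<open>B x em\<close> and
  \<open>B x ep\<close> are the diagonal entries, the projections to the two halves are the vector
  entries.\<close>

lemma mul_decomposition:
  "mul x y = scale (B x em * B y em - B (proj_p x) (proj_m y)) ep
    + scale (B x ep * B y ep - B (proj_p y) (proj_m x)) em
    + ((scale (B x em) (proj_p y) + scale (B y ep) (proj_p x) + mul (proj_m x) (proj_m y))
    + (scale (B x ep) (proj_m y) + scale (B y em) (proj_m x) + mul (proj_p x) (proj_p y)))"
proof -
  have "mul (scale a ep + scale b em + (u + w)) (scale a' ep + scale b' em + (u' + w')) =
      scale (a * a' - B u w') ep + scale (b * b' - B u' w) em
      + ((scale a u' + scale b' u + mul w w') + (scale b w' + scale a' w + mul u u'))"
    if "u \<in> Wp" "u' \<in> Wp" "w \<in> Wm" "w' \<in> Wm" for a b a' b' u u' w w'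
    using that by (simp add: mul_linear idempotent mul_ep_em mul_em_ep Wp_D Wm_D mul_Wp_Wm mul_Wm_Wp
        scale_left_diff_distrib algebra_simps)
  from this[OF proj_p_Wp proj_p_Wp proj_m_Wm proj_m_Wm, of "B x em" "B x ep" x x "B y em" "B y ep" y y]
  show ?thesis
    by (simp only: decomposition[symmetric])
qed

lemma mul_components:
  "B (mul x y) em = B x em * B y em - B (proj_p x) (proj_m y)"
  "B (mul x y) ep = B x ep * B y ep - B (proj_p y) (proj_m x)"
  "proj_p (mul x y) = scale (B x em) (proj_p y) + scale (B y ep) (proj_p x) + mul (proj_m x) (proj_m y)"
  "proj_m (mul x y) = scale (B x ep) (proj_m y) + scale (B y em) (proj_m x) + mul (proj_p x) (proj_p y)"
  by (rule components[OF mul_decomposition];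
      intro subspace_add[OF subspace_Wp] subspace_scale[OF subspace_Wp] subspace_add[OF subspace_Wm]
        subspace_scale[OF subspace_Wm] mul_Wp_Wp mul_Wm_Wm proj_p_Wp proj_m_Wm)+

lemma proj_linear:
  "proj_p (x + y) = proj_p x + proj_p y" "proj_m (x + y) = proj_m x + proj_m y"
  "proj_p (scale c x) = scale c (proj_p x)" "proj_m (scale c x) = scale c (proj_m x)"
  by (simp_all add: proj_p_def proj_m_def mul_linear B_linear scale_left_distrib scale_right_diff_distrib)

lemma V0_iff: "x \<in> V0 \<longleftrightarrow> x = scale (B x em) ep + scale (B x ep) em"
proof
  assume "x \<in> V0"
  then obtain a b where x: "x = scale a ep + scale b em"
    unfolding V0_eq by (auto simp: span_insert algebra_simps)
  show "x = scale (B x em) ep + scale (B x ep) em"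
    by (simp add: x B_linear B_ep_ep B_em_em B_ep_em B_em_ep)
next
  assume "x = scale (B x em) ep + scale (B x ep) em"
  moreover have "scale a ep + scale b em \<in> V0" for a b
    using ep_em subspace_V0 by (intro subspace_add subspace_scale)
  ultimately show "x \<in> V0"
    by metis
qed

lemma V0_decomposition:
  assumes "x \<in> V0"
  shows "proj_p x = 0" "proj_m x = 0"
  using components[of x "B x em" "B x ep" 0 0] assms by (simp_all add: V0_iff)

lemma Wp_components:
  assumes "x \<in> Wp"
  shows "proj_p x = x" "proj_m x = 0"
  using components[of x 0 0 x 0] assms by simp_all

lemma Wm_components:
  assumes "x \<in> Wm"
  shows "proj_p x = 0" "proj_m x = x"
  using components[of x 0 0 0 x] assms by simp_all

lemma Wp_add_Wm: "y \<in> Wp \<Longrightarrow> z \<in> Wm \<Longrightarrow> y + z \<in> W"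
  by (intro subspace_add[OF subspace_W]) (simp_all add: Wp_D Wm_D)

lemma W_eq: "x \<in> W \<Longrightarrow> x = proj_p x + proj_m x"
  using decomposition[of x] by (simp add: W_iff)

lemma direct_sum_V0_W: "direct_sum scale UNIV V0 W"
  unfolding direct_sum_def
proof (intro conjI)
  show "V0 \<inter> W = {0}"
    using subspace_0[OF subspace_V0] subspace_0[OF subspace_W] by (auto simp: W_iff V0_iff)
  show "UNIV = {a + b |a b. a \<in> V0 \<and> b \<in> W}"
  proof (rule UNIV_eq_I)
    fix x
    have "scale (B x em) ep + scale (B x ep) em \<in> V0"
      using ep_em subspace_V0 by (intro subspace_add subspace_scale)
    with decomposition[of x] Wp_add_Wm[OF proj_p_Wp[of x] proj_m_Wm[of x]]
    show "x \<in> {a + b |a b. a \<in> V0 \<and> b \<in> W}"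
      by (intro CollectI exI conjI)
  qed
qed (rule subspace_V0 subspace_W)+

lemma direct_sum_Wp_Wm: "direct_sum scale W Wp Wm"
  unfolding direct_sum_def
proof (intro conjI)
  have "x = 0" if "x \<in> Wp" "x \<in> Wm" for x
    using Wp_D(3)[OF that(1)] Wm_D(2)[OF that(2)] by simp
  thus "Wp \<inter> Wm = {0}"
    by auto
  show "W = {a + b |a b. a \<in> Wp \<and> b \<in> Wm}"
  proof (intro subset_antisym subsetI)
    fix x assume "x \<in> W"
    from W_eq[OF this] proj_p_Wp[of x] proj_m_Wm[of x]
    show "x \<in> {a + b |a b. a \<in> Wp \<and> b \<in> Wm}"
      by (intro CollectI exI conjI)
  next
    fix x assume "x \<in> {a + b |a b. a \<in> Wp \<and> b \<in> Wm}"
    thus "x \<in> W"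
      using Wp_add_Wm by auto
  qed
qed (rule subspace_Wp subspace_Wm)+

end

section \<open>Self-dual norms\<close>

lemma min_eq_infty_iff: "min a b = (\<infinity>::ereal) \<longleftrightarrow> a = \<infinity> \<and> b = \<infinity>"
  by (cases a; cases b) (auto simp: min_def)

lemma self_dual_algebra_normD:
  assumes "self_dual_algebra_norm v scale mul f X \<alpha>"
  shows "norm_on v scale X \<alpha>" "y \<in> X \<Longrightarrow> \<alpha> y = dual_norm v f X \<alpha> y"
    "x \<in> X \<Longrightarrow> y \<in> X \<Longrightarrow> \<alpha> x + \<alpha> y \<le> \<alpha> (mul x y)"
  using assms unfolding self_dual_algebra_norm_def by blast+

lemma self_dual_algebra_normI:
  assumes "norm_on v scale X \<alpha>" "\<And>y. y \<in> X \<Longrightarrow> \<alpha> y = dual_norm v f X \<alpha> y"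
    "\<And>x y. x \<in> X \<Longrightarrow> y \<in> X \<Longrightarrow> \<alpha> x + \<alpha> y \<le> \<alpha> (mul x y)"
  shows "self_dual_algebra_norm v scale mul f X \<alpha>"
  unfolding self_dual_algebra_norm_def using assms by blast

context valued_space
begin

text \<open>The norm axioms without definiteness. The norms constructed below are minima of shifted
  valuations of functionals and of norms composed with projections, which are only seminorms
  individually; definiteness is checked for the minimum.\<close>

definition seminorm_on :: "'v set \<Rightarrow> ('v \<Rightarrow> ereal) \<Rightarrow> bool" where
  "seminorm_on X \<alpha> \<longleftrightarrow>
     (\<forall>x\<in>X. \<alpha> x \<in> insert \<infinity> (ereal ` \<rat>)) \<and>
     (\<forall>x\<in>X. \<forall>y\<in>X. min (\<alpha> x) (\<alpha> y) \<le> \<alpha> (x + y)) \<and>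
     (\<forall>c. \<forall>x\<in>X. \<alpha> (scale c x) = v c + \<alpha> x)"

lemma norm_on_iff_seminorm_on:
  "norm_on v scale X \<alpha> \<longleftrightarrow> seminorm_on X \<alpha> \<and> (\<forall>x\<in>X. \<alpha> x = \<infinity> \<longleftrightarrow> x = 0)"
  by (simp add: norm_on_def seminorm_on_def)

lemma v_add_min:
  assumes "a \<noteq> - \<infinity>" "b \<noteq> - \<infinity>"
  shows "v c + min a b = min (v c + a) (v c + b)"
proof (cases "c = 0")
  case True
  with assms show ?thesis
    by (cases a; cases b) (auto simp: min_def)
next
  case False
  then obtain n :: int where "v c = ereal n"
    by (rule v_int)
  with assms show ?thesis
    by (cases a; cases b) (auto simp: min_def)
qed

lemma seminorm_on_min:
  assumes "seminorm_on X \<alpha>" "seminorm_on X \<beta>"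
  shows "seminorm_on X (\<lambda>x. min (\<alpha> x) (\<beta> x))"
  unfolding seminorm_on_def
proof (intro conjI ballI allI)
  fix x assume x: "x \<in> X"
  show val: "min (\<alpha> x) (\<beta> x) \<in> insert \<infinity> (ereal ` \<rat>)"
    using assms x unfolding seminorm_on_def min_def by simp
  show "min (\<alpha> (scale c x)) (\<beta> (scale c x)) = v c + min (\<alpha> x) (\<beta> x)" for c
  proof -
    have "\<alpha> x \<noteq> - \<infinity>" "\<beta> x \<noteq> - \<infinity>"
      using assms x unfolding seminorm_on_def by fastforce+
    thus ?thesis
      using assms x v_add_min[of "\<alpha> x" "\<beta> x" c] by (simp add: seminorm_on_def)
  qed
  fix y assume y: "y \<in> X"
  have "min (\<alpha> x) (\<alpha> y) \<le> \<alpha> (x + y)" "min (\<beta> x) (\<beta> y) \<le> \<beta> (x + y)"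
    using assms x y by (simp_all add: seminorm_on_def)
  thus "min (min (\<alpha> x) (\<beta> x)) (min (\<alpha> y) (\<beta> y)) \<le> min (\<alpha> (x + y)) (\<beta> (x + y))"
    by (auto simp: min_le_iff_disj)
qed

lemma seminorm_on_comp:
  assumes "seminorm_on Y \<alpha>" "\<And>x. h x \<in> Y" "\<And>x y. h (x + y) = h x + h y" "\<And>c x. h (scale c x) = scale c (h x)"
  shows "seminorm_on X (\<lambda>x. \<alpha> (h x))"
  using assms by (simp add: seminorm_on_def)

lemma seminorm_on_functional:
  assumes "\<And>x y. l (x + y) = l x + l y" "\<And>c x. l (scale c x) = c * l x" "r \<in> \<rat>"
  shows "seminorm_on X (\<lambda>x. v (l x) + ereal r)"
  unfolding seminorm_on_def
proof (intro conjI ballI allI)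
  fix x y c
  show "v (l x) + ereal r \<in> insert \<infinity> (ereal ` \<rat>)"
  proof (cases "l x = 0")
    case False
    then obtain n :: int where "v (l x) = ereal n"
      by (rule v_int)
    thus ?thesis
      using assms(3) by (auto intro!: imageI Rats_add)
  qed simp
  show "v (l (scale c x)) + ereal r = v c + (v (l x) + ereal r)"
    by (simp add: assms v_mult add.assoc)
  show "min (v (l x) + ereal r) (v (l y) + ereal r) \<le> v (l (x + y)) + ereal r"
    using v_add[of "l x" "l y"] unfolding assms(1)
    by (metis add_right_mono min_le_iff_disj)
qed

lemma seminorm_on_functional0:
  assumes "\<And>x y. l (x + y) = l x + l y" "\<And>c x. l (scale c x) = c * l x"
  shows "seminorm_on X (\<lambda>x. v (l x))"
  using seminorm_on_functional[of l 0] assms by (simp add: zero_ereal_def[symmetric])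

end

section \<open>Duality under the pairing and the norm of V0\<close>

locale valued_polarization = valued_space v p scale +
  octonion_polarization scale mul unit Q V0 ep em
  for v :: "'a::field \<Rightarrow> ereal" and p :: nat
    and scale :: "'a \<Rightarrow> 'v::ab_group_add \<Rightarrow> 'v" and mul unit Q V0 ep em

sublocale valued_polarization \<subseteq> Wp: valued_alternating_form v p scale Wp T
  by unfold_locales

context valued_polarization
begin

lemma valued_swap: "valued_polarization v p scale mul unit Q V0 em ep"
proof -
  interpret s: octonion_polarization scale mul unit Q V0 em ep
    by (rule swap)
  show ?thesis
    by unfold_locales
qed

text \<open>Replacing \<open>x\<close> by \<open>h x\<close> keeps its pairing with \<open>y\<close>
  and does not lower its norm, so the infimum can be taken over \<open>A\<close>. It is applied with
  the projections to \<open>V0\<close> and \<open>Wp\<close>.\<close>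

lemma dual_norm_restrict:
  assumes "A \<subseteq> X" "\<And>x. x \<in> X \<Longrightarrow> h x \<in> A" "\<And>x. x \<in> X \<Longrightarrow> B y x = B y (h x)"
    "\<And>x. x \<in> X \<Longrightarrow> \<alpha> x \<le> \<alpha> (h x)"
  shows "dual_norm v B X \<alpha> y = dual_norm v B A \<alpha> y"
  unfolding dual_norm_def
proof (rule antisym)
  show "(INF x\<in>X. v (B y x) - \<alpha> x) \<le> (INF x\<in>A. v (B y x) - \<alpha> x)"
    using assms(1) by (rule INF_superset_mono) simp
  show "(INF x\<in>A. v (B y x) - \<alpha> x) \<le> (INF x\<in>X. v (B y x) - \<alpha> x)"
  proof (rule INF_greatest)
    fix x assume x: "x \<in> X"
    have "(INF x\<in>A. v (B y x) - \<alpha> x) \<le> v (B y (h x)) - \<alpha> (h x)"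
      by (rule INF_lower) (rule assms(2)[OF x])
    also have "\<dots> \<le> v (B y x) - \<alpha> x"
      by (rule ereal_minus_mono) (simp_all add: assms x)
    finally show "(INF x\<in>A. v (B y x) - \<alpha> x) \<le> v (B y x) - \<alpha> x" .
  qed
qed

text \<open>Turns the infimum of differences into additive inequalities, free of differences of
  infinities and ready to be combined with the algebra inequality.\<close>

lemma le_dual_norm_iff:
  assumes "norm_on v scale X \<alpha>"
  shows "a \<le> dual_norm v B X \<alpha> y \<longleftrightarrow> (\<forall>x\<in>X. a + \<alpha> x \<le> v (B y x))"
  using le_minus_norm_iff[OF assms, of _ "B y" a] by (simp add: dual_norm_def le_INF_iff)

text \<open>For \<open>x = a ep + b em\<close> the two pairings are \<open>a\<close> and
  \<open>b\<close>, so on \<open>V0\<close> the unit ball is O \<open>ep\<close> + O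
  \<open>em\<close>, with O the valuation ring.\<close>

definition norm_V0 :: "'v \<Rightarrow> ereal" where
  "norm_V0 x = min (v (B x em)) (v (B x ep))"

text \<open>Multiplication by \<open>ep\<close> isolates the coefficient of \<open>ep\<close>, and
  the finite value \<open>\<beta> ep\<close> cancels from the algebra inequality.\<close>

lemma V0_norm_le:
  assumes \<beta>: "self_dual_algebra_norm v scale mul B V0 \<beta>" and x: "x \<in> V0"
  shows "\<beta> x \<le> v (B x em)"
proof -
  have norm: "norm_on v scale V0 \<beta>"
    by (rule self_dual_algebra_normD(1)[OF \<beta>])
  obtain r where r: "\<beta> ep = ereal r"
    using norm_rat[OF norm ep_em(1,3)] by metis
  have "mul ep x = mul ep (scale (B x em) ep + scale (B x ep) em)"
    using x V0_iff by simp
  also have "\<dots> = scale (B x em) ep"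
    by (simp add: mul_linear idempotent mul_ep_em)
  finally have "\<beta> (mul ep x) = v (B x em) + \<beta> ep"
    using norm_scale[OF norm ep_em(1)] by simp
  moreover have "\<beta> ep + \<beta> x \<le> \<beta> (mul ep x)"
    by (rule self_dual_algebra_normD(3)[OF \<beta> ep_em(1) x])
  ultimately show ?thesis
    using r by (cases "\<beta> x"; cases "v (B x em)") auto
qed

lemma V0_norm_le_norm_V0:
  assumes \<beta>: "self_dual_algebra_norm v scale mul B V0 \<beta>" and x: "x \<in> V0"
  shows "\<beta> x \<le> norm_V0 x"
proof -
  interpret s: valued_polarization v p scale mul unit Q V0 em ep
    by (rule valued_swap)
  show ?thesis
    using V0_norm_le[OF assms] s.V0_norm_le[OF assms] by (simp add: norm_V0_def)
qed

text \<open>Self-duality converts the upper bound for \<open>\<beta>\<close> into a lower bound: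
  \<open>B ep x\<close> is the coefficient of \<open>em\<close> in \<open>x\<close>, and its
  valuation is at least \<open>\<beta> x\<close>.\<close>

lemma V0_norm_idempotent:
  assumes \<beta>: "self_dual_algebra_norm v scale mul B V0 \<beta>"
  shows "0 \<le> \<beta> ep" "0 \<le> \<beta> em"
proof -
  have norm: "norm_on v scale V0 \<beta>"
    by (rule self_dual_algebra_normD(1)[OF \<beta>])
  have "0 \<le> dual_norm v B V0 \<beta> ep" "0 \<le> dual_norm v B V0 \<beta> em"
    unfolding le_dual_norm_iff[OF norm] using V0_norm_le_norm_V0[OF \<beta>]
    by (auto simp: norm_V0_def B_commute[of ep] B_commute[of em])
  thus "0 \<le> \<beta> ep" "0 \<le> \<beta> em"
    using self_dual_algebra_normD(2)[OF \<beta>] ep_em by simp_all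
qed

lemma V0_norm_unique:
  assumes \<beta>: "self_dual_algebra_norm v scale mul B V0 \<beta>" and x: "x \<in> V0"
  shows "\<beta> x = norm_V0 x"
proof (rule antisym)
  show "\<beta> x \<le> norm_V0 x"
    by (rule V0_norm_le_norm_V0[OF assms])
  have norm: "norm_on v scale V0 \<beta>"
    by (rule self_dual_algebra_normD(1)[OF \<beta>])
  let ?a = "B x em" and ?b = "B x ep"
  have ab: "scale ?a ep \<in> V0" "scale ?b em \<in> V0"
    using subspace_scale[OF subspace_V0] ep_em by simp_all
  have "v ?a \<le> \<beta> (scale ?a ep)" "v ?b \<le> \<beta> (scale ?b em)"
    using norm_scale[OF norm] ep_em add_left_mono[OF V0_norm_idempotent(1)[OF \<beta>], of "v ?a"]
      add_left_mono[OF V0_norm_idempotent(2)[OF \<beta>], of "v ?b"] by simp_all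
  hence "norm_V0 x \<le> \<beta> (scale ?a ep + scale ?b em)"
    by (intro le_norm_add[OF norm ab]) (auto simp: norm_V0_def min_le_iff_disj)
  thus "norm_V0 x \<le> \<beta> x"
    using x V0_iff by simp
qed

lemma self_dual_norm_V0: "self_dual_algebra_norm v scale mul B V0 norm_V0"
proof -
  have "B x em = 0 \<and> B x ep = 0 \<longleftrightarrow> x = 0" if "x \<in> V0" for x
    using that V0_iff by (metis B_0_left add.right_neutral scale_zero_left)
  moreover have "seminorm_on V0 norm_V0"
    unfolding norm_V0_def[abs_def]
    by (intro seminorm_on_min seminorm_on_functional0) (simp_all add: B_linear)
  moreover have "norm_V0 x = \<infinity> \<longleftrightarrow> B x em = 0 \<and> B x ep = 0" for x
    by (simp add: norm_V0_def min_eq_infty_iff v_eq_infty_iff)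
  ultimately have norm: "norm_on v scale V0 norm_V0"
    unfolding norm_on_iff_seminorm_on by simp
  have B_V0: "B x y = B x em * B y ep + B x ep * B y em" if "x \<in> V0" for x y
    using B_decomposition[of x y] V0_decomposition[OF that] by simp
  have mul_V0: "B (mul x y) em = B x em * B y em" "B (mul x y) ep = B x ep * B y ep" if "x \<in> V0" for x y
    using mul_components[of x y] V0_decomposition[OF that] by simp_all
  have "norm_V0 y = dual_norm v B V0 norm_V0 y" if y: "y \<in> V0" for y
  proof (rule antisym)
    have "norm_V0 y + norm_V0 x \<le> v (B y x)" for x
      by (subst B_V0[OF y], intro le_v_add) (simp_all add: v_mult norm_V0_def add_mono)
    thus "norm_V0 y \<le> dual_norm v B V0 norm_V0 y"
      unfolding le_dual_norm_iff[OF norm] by simp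
    have "dual_norm v B V0 norm_V0 y \<le> v (B y ep) - norm_V0 ep"
      "dual_norm v B V0 norm_V0 y \<le> v (B y em) - norm_V0 em"
      unfolding dual_norm_def using ep_em by (auto intro: INF_lower)
    thus "dual_norm v B V0 norm_V0 y \<le> norm_V0 y"
      by (simp add: norm_V0_def B_ep_ep B_em_em B_ep_em B_em_ep)
  qed
  moreover have "norm_V0 x + norm_V0 y \<le> norm_V0 (mul x y)" if "x \<in> V0" for x y
    using that by (simp add: mul_V0 v_mult norm_V0_def add_mono)
  ultimately show ?thesis
    using norm by (intro self_dual_algebra_normI)
qed

section \<open>Dual norms on the two halves and biduality\<close>

context
  fixes N :: "'v \<Rightarrow> ereal" and es gs :: "'v list"
  assumes N: "norm_on v scale Wp N" and es: "basis_of scale Wp es" "basis_splits_norm scale es N"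
    and gs: "dual_basis_of scale B Wm es gs"
begin

lemma splitting_norm_coords:
  assumes "x \<in> Wp"
  shows "N x = (INF i\<in>{..<3}. v (B x (gs ! i)) + N (es ! i))"
  by (subst dual_expansion[OF es(1) gs assms]) (rule Wp.splitting_basis_norm_eq[OF N es])

lemma N_es:
  obtains k where "\<forall>i<3. N (es ! i) = ereal (k i)" "\<forall>i<3. k i \<in> \<rat>"
proof -
  have "N (es ! i) = ereal (real_of_ereal (N (es ! i))) \<and> real_of_ereal (N (es ! i)) \<in> \<rat>" if i: "i < 3" for i
  proof -
    obtain r where "r \<in> \<rat>" "N (es ! i) = ereal r"
      by (rule Wp.norm_basis[OF N es es(1) i])
    thus ?thesis
      by simp
  qed
  thus thesis
    by (intro that[of "\<lambda>i. real_of_ereal (N (es ! i))"]) auto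
qed

text \<open>The three basis vectors suffice in the infimum: \<open>B y x\<close> is a sum of three
  coordinate products, and the norm of \<open>x\<close> is the minimum of its coordinate
  contributions.\<close>

lemma dual_norm_coords:
  "dual_norm v B Wp N y = (INF i\<in>{..<3}. v (B y (es ! i)) - N (es ! i))" (is "_ = ?M")
proof (rule antisym)
  show "dual_norm v B Wp N y \<le> ?M"
    unfolding dual_norm_def by (intro INF_greatest INF_lower Wp.basis_nth[OF es(1)]) simp
  obtain k where "\<forall>i<3. N (es ! i) = ereal (k i)" "\<forall>i<3. k i \<in> \<rat>"
    by (rule N_es)
  hence k: "\<And>i. i < 3 \<Longrightarrow> N (es ! i) = ereal (k i)" "\<And>i. i < 3 \<Longrightarrow> k i \<in> \<rat>"
    by simp_all
  have "?M + N x \<le> v (B y x)" if x: "x \<in> Wp" for x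
  proof -
    have summand: "?M + N x \<le> v (B x (gs ! i) * B y (es ! i))" if i: "i < 3" for i
    proof -
      have "?M \<le> v (B y (es ! i)) - N (es ! i)"
        using i by (intro INF_lower) simp
      moreover have "N x \<le> v (B x (gs ! i)) + N (es ! i)"
        unfolding splitting_norm_coords[OF x] using i by (intro INF_lower) simp
      ultimately have "?M + N x \<le> (v (B y (es ! i)) - N (es ! i)) + (v (B x (gs ! i)) + N (es ! i))"
        by (rule add_mono)
      also have "\<dots> = v (B x (gs ! i) * B y (es ! i))"
        unfolding v_mult k(1)[OF i] by (cases "v (B y (es ! i))"; cases "v (B x (gs ! i))") auto
      finally show ?thesis .
    qed
    have "B y x = B y (\<Sum>i<3. scale (B x (gs ! i)) (es ! i))"
      using dual_expansion[OF es(1) gs x] by simp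
    also have "\<dots> = B x (gs ! 0) * B y (es ! 0) + B x (gs ! 1) * B y (es ! 1) + B x (gs ! 2) * B y (es ! 2)"
      unfolding sum_lessThan_3 by (simp add: B_linear)
    finally show ?thesis
      using summand[of 0] summand[of 1] summand[of 2] by (auto intro!: le_v_add)
  qed
  thus "?M \<le> dual_norm v B Wp N y"
    unfolding le_dual_norm_iff[OF N] by simp
qed

lemma B_gs_es: "i < 3 \<Longrightarrow> j < 3 \<Longrightarrow> B (gs ! i) (es ! j) = (if i = j then 1 else 0)"
  using gs Wp.basis_length[OF es(1)] by (simp add: dual_basis_of_def B_commute[of "gs ! i"])

lemma gs_nth: "i < 3 \<Longrightarrow> gs ! i \<in> Wm" and length_gs: "length gs = 3"
proof -
  show len: "length gs = 3"
    using gs Wp.basis_length[OF es(1)] by (simp add: dual_basis_of_def)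
  have "set gs \<subseteq> Wm"
    using basis_of_subset dual_basis_flip(1)[OF es(1) gs] by simp
  thus "gs ! i \<in> Wm" if "i < 3"
    using that len nth_mem[of i gs] by (simp add: subset_iff)
qed

context
  fixes M :: "'v \<Rightarrow> ereal"
  assumes M: "\<And>y. y \<in> Wm \<Longrightarrow> M y = dual_norm v B Wp N y"
begin

text \<open>By the coordinate formula \<open>M\<close> is, on \<open>Wm\<close>, a minimum of three
  valuations of functionals shifted by rational constants. The functionals have no common zero
  except \<open>0\<close>, as they are the coordinates with respect to \<open>gs\<close>.\<close>

lemma norm_dual: "norm_on v scale Wm M"
proof -
  interpret s: valued_polarization v p scale mul unit Q V0 em ep
    by (rule valued_swap)
  obtain k where "\<forall>i<3. N (es ! i) = ereal (k i)" "\<forall>i<3. k i \<in> \<rat>"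
    by (rule N_es)
  hence k: "\<And>i. i < 3 \<Longrightarrow> N (es ! i) = ereal (k i)" "\<And>i. i < 3 \<Longrightarrow> k i \<in> \<rat>"
    by simp_all
  let ?M = "\<lambda>y. min (v (B y (es ! 0)) + ereal (- k 0)) (min (v (B y (es ! 1)) + ereal (- k 1)) (v (B y (es ! 2)) + ereal (- k 2)))"
  have M': "M y = ?M y" if "y \<in> Wm" for y
    using M[OF that] unfolding dual_norm_coords INF_lessThan_3
    by (simp add: k minus_ereal_def del: One_nat_def)
  have "y = 0" if y: "y \<in> Wm" and "B y (es ! 0) = 0" "B y (es ! 1) = 0" "B y (es ! 2) = 0" for y
  proof -
    have "y = (\<Sum>i<3. scale (B y (es ! i)) (gs ! i))"
      using s.dual_expansion[of gs es y] dual_basis_flip[OF es(1) gs] y by (simp add: swap_Wp swap_Wm)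
    thus ?thesis
      using that(2-4) by (simp add: sum_lessThan_3)
  qed
  moreover have "?M y = \<infinity> \<longleftrightarrow> B y (es ! 0) = 0 \<and> B y (es ! 1) = 0 \<and> B y (es ! 2) = 0" for y
    by (simp add: min_eq_infty_iff v_eq_infty_iff)
  moreover have "seminorm_on Wm ?M"
    using k(2) by (intro seminorm_on_min seminorm_on_functional) (simp_all add: B_linear)
  ultimately have "norm_on v scale Wm ?M"
    unfolding norm_on_iff_seminorm_on by auto
  with norm_on_cong[OF subspace_Wm M'] show ?thesis
    by simp
qed

text \<open>In the coordinate formula at \<open>gs ! i\<close> the two terms with other indices are
  \<open>\<infinity>\<close>, because the pairing vanishes there.\<close>

lemma dual_norm_nth:
  assumes i: "i < 3"
  shows "M (gs ! i) = - N (es ! i)"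
proof -
  obtain k where "\<forall>i<3. N (es ! i) = ereal (k i)" "\<forall>i<3. k i \<in> \<rat>"
    by (rule N_es)
  hence k: "\<And>i. i < 3 \<Longrightarrow> N (es ! i) = ereal (k i)" "\<And>i. i < 3 \<Longrightarrow> k i \<in> \<rat>"
    by simp_all
  have "i = 0 \<or> i = 1 \<or> i = 2"
    using i by auto
  thus ?thesis
    unfolding M[OF gs_nth[OF i]] dual_norm_coords INF_lessThan_3
    by (auto simp: k B_gs_es simp del: One_nat_def)
qed

lemma dual_norm_splits: "basis_splits_norm scale gs M"
  unfolding basis_splits_norm_def length_gs
proof
  fix c :: "nat \<Rightarrow> 'a"
  have mem: "(\<Sum>i<3. scale (c i) (gs ! i)) \<in> Wm"
    by (intro subspace_sum[OF subspace_Wm] subspace_scale[OF subspace_Wm] gs_nth) simp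
  have B_c: "B (\<Sum>i<3. scale (c i) (gs ! i)) (es ! j) = c j" if "j < 3" for j
  proof -
    have "j = 0 \<or> j = 1 \<or> j = 2"
      using that by auto
    thus ?thesis
      unfolding sum_lessThan_3 by (auto simp: B_linear B_gs_es simp del: One_nat_def)
  qed
  have M_c: "M (scale (c i) (gs ! i)) = v (c i) - N (es ! i)" if "i < 3" for i
    using norm_scale[OF norm_dual gs_nth[OF that]] dual_norm_nth[OF that] by (simp add: minus_ereal_def)
  show "M (\<Sum>i<3. scale (c i) (gs ! i)) = (INF i\<in>{..<3}. M (scale (c i) (gs ! i)))"
    unfolding M[OF mem] dual_norm_coords INF_lessThan_3 by (simp add: B_c M_c del: One_nat_def)
qed

end

end

text \<open>Dualizing passes to the dual basis and negates the values on it. The swapped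
  polarization does this a second time and restores the original norm.\<close>

lemma bidual_norm:
  assumes N: "norm_on v scale Wp N" and es: "basis_of scale Wp es" "basis_splits_norm scale es N"
    and gs: "dual_basis_of scale B Wm es gs" and M: "\<And>y. y \<in> Wm \<Longrightarrow> M y = dual_norm v B Wp N y"
    and x: "x \<in> Wp"
  shows "N x = dual_norm v B Wm M x"
proof -
  interpret s: valued_polarization v p scale mul unit Q V0 em ep
    by (rule valued_swap)
  note dual = norm_dual[OF N es gs M] dual_norm_splits[OF N es gs M] dual_norm_nth[OF N es gs M]
  have "dual_norm v B Wm M x = (INF i\<in>{..<3}. v (B x (gs ! i)) - M (gs ! i))"
    using s.dual_norm_coords[where N = M and es = gs and gs = es and y = x] dual dual_basis_flip[OF es(1) gs] by (simp add: swap_Wp swap_Wm)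
  also have "\<dots> = (INF i\<in>{..<3}. v (B x (gs ! i)) + N (es ! i))"
    using dual(3) by (intro INF_cong) (simp_all add: minus_ereal_def)
  finally show ?thesis
    using splitting_norm_coords[OF N es gs x] by simp
qed

lemma dual_TL:
  assumes "basis_of scale Wp es" "dual_basis_of scale B Wm es gs"
  shows "Wp.TL gs = inverse (Wp.TL es)"
proof -
  have "length es = 3" "length gs = 3"
    using Wp.basis_length[OF assms(1)] assms(2) by (simp_all add: dual_basis_of_def)
  then obtain f1 f2 f3 g1 g2 g3 where "es = [f1, f2, f3]" "gs = [g1, g2, g3]"
    by (auto simp: numeral_3_eq_3 length_Suc_conv)
  thus ?thesis
    using dual_basis_T assms by simp
qed

lemma norm_mul_le_dual_norm:
  assumes N: "norm_on v scale Wp N" and es: "basis_of scale Wp es" "basis_splits_norm scale es N"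
    and vol: "v (Wp.TL es) - (\<Sum>i<3. N (es ! i)) = 0" and xy: "x \<in> Wp" "y \<in> Wp"
  shows "N x + N y \<le> dual_norm v B Wp N (mul x y)"
  unfolding le_dual_norm_iff[OF N]
  using Wp.le_v_T_norm[OF N es xy] vol by (simp add: T_def)

text \<open>The reference lattice may come from any basis \<open>cs\<close>, but a special basis has
  \<open>T = 1\<close> and volume zero, which forces \<open>v\<close> of \<open>T\<close> to vanish
  on \<open>cs\<close>.\<close>

lemma norm_vol_special:
  assumes L0: "special_normalization v scale mul B Wp Wm L0"
    and N: "norm_on v scale Wp N" and es: "basis_of scale Wp es" "basis_splits_norm scale es N"
  shows "norm_vol v scale Wp L0 N = v (Wp.TL es) - (\<Sum>i<3. N (es ! i))"
proof -
  obtain cs where cs: "basis_of scale Wp cs" "L0 = lattice_gen v scale cs"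
    using L0 by (auto simp: special_normalization_def lattice_in_def)
  obtain bs where bs: "special_basis scale mul B Wp Wm bs"
    by (rule special_basis_exists)
  have "lattice_vol v scale Wp L0 (lattice_gen v scale bs) = 0"
    using L0 bs by (simp add: special_normalization_def)
  moreover have b: "basis_of scale Wp bs" "Wp.TL bs = 1"
    using bs special_basis_iff by auto
  moreover obtain n :: int where "v (Wp.TL cs) = ereal n"
    by (rule Wp.v_TL[OF cs(1)])
  ultimately have "v (Wp.TL cs) = 0"
    using Wp.lattice_vol_eq[OF cs(1) b(1)] cs(2) by (simp add: zero_ereal_def)
  thus ?thesis
    using Wp.norm_vol_eq[OF cs(1) N es] cs(2) by simp
qed

text \<open>The closed form of \<alpha>0 \<and> \<alpha>p \<and> \<alpha>m through projections,
  without the definite descriptions in \<open>wedge\<close>. It also describes every self-dual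
  algebra norm split by V0 and W, which gives uniqueness.\<close>

definition wedge_norm :: "('v \<Rightarrow> ereal) \<Rightarrow> ('v \<Rightarrow> ereal) \<Rightarrow> 'v \<Rightarrow> ereal" where
  "wedge_norm \<alpha>p \<alpha>m x = min (norm_V0 x) (min (\<alpha>p (proj_p x)) (\<alpha>m (proj_m x)))"

section \<open>Self-dual algebra norms split by V0 and W\<close>

context
  fixes \<alpha> :: "'v \<Rightarrow> ereal"
  assumes self_dual: "self_dual_algebra_norm v scale mul B UNIV \<alpha>"
    and split: "norm_split_by scale UNIV V0 W \<alpha>"
begin

lemma norm_\<alpha>: "norm_on v scale X \<alpha>"
  using norm_on_subset[OF self_dual_algebra_normD(1)[OF self_dual]] by simp

lemma self_dual_V0: "self_dual_algebra_norm v scale mul B V0 \<alpha>"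
proof -
  have dual: "\<alpha> y = dual_norm v B V0 \<alpha> y" if y: "y \<in> V0" for y
  proof -
    have "dual_norm v B UNIV \<alpha> y = dual_norm v B V0 \<alpha> y"
    proof (rule dual_norm_restrict[where h = "\<lambda>x. scale (B x em) ep + scale (B x ep) em"])
      fix x
      show V0: "scale (B x em) ep + scale (B x ep) em \<in> V0"
        using ep_em subspace_V0 by (intro subspace_add subspace_scale)
      have W: "proj_p x + proj_m x \<in> W"
        by (rule Wp_add_Wm[OF proj_p_Wp proj_m_Wm])
      show "B y x = B y (scale (B x em) ep + scale (B x ep) em)"
        using B_decomposition[of y x] V0_decomposition[OF y] by (simp add: B_linear)
      show "\<alpha> x \<le> \<alpha> (scale (B x em) ep + scale (B x ep) em)"
        using norm_split_byD[OF split V0 W] decomposition[of x] by simp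
    qed simp
    thus ?thesis
      using self_dual_algebra_normD(2)[OF self_dual, of y] by simp
  qed
  show ?thesis
    by (rule self_dual_algebra_normI[OF norm_\<alpha> dual]) (simp_all add: self_dual_algebra_normD(3)[OF self_dual])
qed

lemma split_Wp_Wm:
  assumes y: "y \<in> Wp" and z: "z \<in> Wm"
  shows "\<alpha> (y + z) = min (\<alpha> y) (\<alpha> z)"
proof (rule antisym)
  have mul: "mul ep (y + z) = y" "mul em (y + z) = z"
    using y z by (simp_all add: mult_add_right Wp_D Wm_D)
  have alg: "\<alpha> e + \<alpha> x \<le> \<alpha> (mul e x)" for e x
    using self_dual_algebra_normD(3)[OF self_dual] by simp
  have le: "\<alpha> (y + z) \<le> \<alpha> ep + \<alpha> (y + z)" "\<alpha> (y + z) \<le> \<alpha> em + \<alpha> (y + z)"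
    using add_right_mono[OF V0_norm_idempotent(1)[OF self_dual_V0], of "\<alpha> (y + z)"]
      add_right_mono[OF V0_norm_idempotent(2)[OF self_dual_V0], of "\<alpha> (y + z)"] by simp_all
  show "\<alpha> (y + z) \<le> min (\<alpha> y) (\<alpha> z)"
    using order_trans[OF le(1) alg] order_trans[OF le(2) alg] by (simp add: mul)
  show "min (\<alpha> y) (\<alpha> z) \<le> \<alpha> (y + z)"
    using norm_add[OF norm_\<alpha>, of y UNIV z] by simp
qed

lemma norm_eq_wedge_norm: "\<alpha> x = wedge_norm \<alpha> \<alpha> x"
proof -
  have V0: "scale (B x em) ep + scale (B x ep) em \<in> V0"
    using ep_em subspace_V0 by (intro subspace_add subspace_scale)
  have "\<alpha> x = \<alpha> (scale (B x em) ep + scale (B x ep) em + (proj_p x + proj_m x))"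
    using decomposition[of x] by simp
  also have "\<dots> = min (\<alpha> (scale (B x em) ep + scale (B x ep) em)) (\<alpha> (proj_p x + proj_m x))"
    by (rule norm_split_byD[OF split V0 Wp_add_Wm[OF proj_p_Wp proj_m_Wm]])
  also have "\<dots> = wedge_norm \<alpha> \<alpha> x"
    unfolding V0_norm_unique[OF self_dual_V0 V0] split_Wp_Wm[OF proj_p_Wp proj_m_Wm]
    by (simp add: wedge_norm_def norm_V0_def B_linear B_ep_ep B_em_em B_ep_em B_em_ep)
  finally show ?thesis .
qed

lemma dual_norm_Wm:
  assumes y: "y \<in> Wm"
  shows "\<alpha> y = dual_norm v B Wp \<alpha> y"
proof -
  have "dual_norm v B UNIV \<alpha> y = dual_norm v B Wp \<alpha> y"
  proof (rule dual_norm_restrict[where h = proj_p])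
    fix x
    show "B y x = B y (proj_p x)"
      using B_decomposition[of y x] Wm_components[OF y] y by (simp add: Wm_D)
    show "\<alpha> x \<le> \<alpha> (proj_p x)"
      by (subst norm_eq_wedge_norm) (simp add: wedge_norm_def min_le_iff_disj)
  qed (simp_all add: proj_p_Wp)
  thus ?thesis
    using self_dual_algebra_normD(2)[OF self_dual, of y] by simp
qed

lemma splitting_basis_volume_eq_0:
  assumes es: "basis_of scale Wp es" "basis_splits_norm scale es \<alpha>"
  shows "v (Wp.TL es) - (\<Sum>i<3. \<alpha> (es ! i)) = 0"
proof -
  obtain gs where gs: "dual_basis_of scale B Wm es gs"
    by (rule dual_basis_exists[OF es(1)])
  obtain f1 f2 f3 where f: "es = [f1, f2, f3]"
    using Wp.basis_length[OF es(1)] by (auto simp: numeral_3_eq_3 length_Suc_conv)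
  obtain g1 g2 g3 where g: "gs = [g1, g2, g3]"
    using length_gs[OF norm_\<alpha> es gs] by (auto simp: numeral_3_eq_3 length_Suc_conv)
  have b: "basis_of scale Wp [f1, f2, f3]" and d: "dual_basis_of scale B Wm [f1, f2, f3] [g1, g2, g3]"
    using es gs f g by simp_all
  obtain k where "\<forall>i<3. \<alpha> (es ! i) = ereal (k i)" "\<forall>i<3. k i \<in> \<rat>"
    by (rule N_es[OF norm_\<alpha> es gs])
  hence k: "\<And>i. i < 3 \<Longrightarrow> \<alpha> (es ! i) = ereal (k i)" "\<And>i. i < 3 \<Longrightarrow> k i \<in> \<rat>"
    by simp_all
  have \<alpha>f: "\<alpha> f1 = ereal (k 0)" "\<alpha> f2 = ereal (k 1)" "\<alpha> f3 = ereal (k 2)"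
    using k(1)[of 0] k(1)[of 1] k(1)[of 2] f by simp_all
  note nth = dual_norm_nth[OF norm_\<alpha> es gs dual_norm_Wm]
  have \<alpha>g: "\<alpha> g1 = ereal (- k 0)" "\<alpha> g2 = ereal (- k 1)" "\<alpha> g3 = ereal (- k 2)"
    using nth[of 0] nth[of 1] nth[of 2] \<alpha>f f g by simp_all
  obtain n :: int where n: "v (T f1 f2 f3) = ereal n"
    using Wp.v_TL[OF b] by auto
  have T: "T f1 f2 f3 \<noteq> 0"
    using Wp.TL_nonzero[OF b] by simp
  have alg: "\<alpha> x + \<alpha> y \<le> \<alpha> (mul x y)" for x y
    using self_dual_algebra_normD(3)[OF self_dual] by simp
  have "mul f1 f2 = scale (T f1 f2 f3) g3"
    using d T unfolding dual_basis_of_iff[OF b] by simp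
  hence "\<alpha> (mul f1 f2) = ereal (n - k 2)"
    using norm_scale[OF norm_\<alpha>, of g3 UNIV] n \<alpha>g by simp
  moreover have "\<alpha> (mul g1 g2) = ereal (- n + k 2)"
    unfolding dual_basis_mul[OF b d] using norm_scale[OF norm_\<alpha>, of f3 UNIV] n \<alpha>f v_inverse[OF T] by simp
  \<comment> \<open>The two algebra inequalities read \<open>k 0 + k 1 \<le> n - k 2\<close> and
    \<open>- k 0 - k 1 \<le> k 2 - n\<close>.\<close>
  ultimately have "n = k 0 + k 1 + k 2"
    using alg[of f1 f2] alg[of g1 g2] by (simp add: \<alpha>f \<alpha>g)
  thus ?thesis
    by (simp add: f sum_lessThan_3 \<alpha>f n zero_ereal_def)
qed

end

section \<open>The norm of V built from a dual pair of norms\<close>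

context
  fixes \<alpha>p \<alpha>m :: "'v \<Rightarrow> ereal"
  assumes norm_p: "norm_on v scale Wp \<alpha>p" and norm_m: "norm_on v scale Wm \<alpha>m"
    and dual_m: "\<And>y. y \<in> Wm \<Longrightarrow> \<alpha>m y = dual_norm v B Wp \<alpha>p y"
    and dual_p: "\<And>x. x \<in> Wp \<Longrightarrow> \<alpha>p x = dual_norm v B Wm \<alpha>m x"
    and mul_p: "\<And>x y. x \<in> Wp \<Longrightarrow> y \<in> Wp \<Longrightarrow> \<alpha>p x + \<alpha>p y \<le> \<alpha>m (mul x y)"
    and mul_m: "\<And>x y. x \<in> Wm \<Longrightarrow> y \<in> Wm \<Longrightarrow> \<alpha>m x + \<alpha>m y \<le> \<alpha>p (mul x y)"
begin

lemma le_wedge_norm_iff: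
  "r \<le> wedge_norm \<alpha>p \<alpha>m x \<longleftrightarrow>
    r \<le> v (B x em) \<and> r \<le> v (B x ep) \<and> r \<le> \<alpha>p (proj_p x) \<and> r \<le> \<alpha>m (proj_m x)"
  by (simp add: wedge_norm_def norm_V0_def)

lemma wedge_norm_le:
  "wedge_norm \<alpha>p \<alpha>m x \<le> v (B x em)" "wedge_norm \<alpha>p \<alpha>m x \<le> v (B x ep)"
  "wedge_norm \<alpha>p \<alpha>m x \<le> \<alpha>p (proj_p x)" "wedge_norm \<alpha>p \<alpha>m x \<le> \<alpha>m (proj_m x)"
  using le_wedge_norm_iff[of "wedge_norm \<alpha>p \<alpha>m x" x] by simp_all

lemma norm_p_0: "\<alpha>p 0 = \<infinity>" and norm_m_0: "\<alpha>m 0 = \<infinity>"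
  using norm_infty_iff[OF norm_p] norm_infty_iff[OF norm_m] by simp_all

lemma norm_wedge_norm: "norm_on v scale UNIV (wedge_norm \<alpha>p \<alpha>m)"
proof -
  have p: "seminorm_on Wp \<alpha>p" and m: "seminorm_on Wm \<alpha>m"
    using norm_p norm_m by (simp_all add: norm_on_iff_seminorm_on)
  have "seminorm_on UNIV (\<lambda>x. \<alpha>p (proj_p x))"
    by (rule seminorm_on_comp[OF p]) (simp_all add: proj_p_Wp proj_linear)
  moreover have "seminorm_on UNIV (\<lambda>x. \<alpha>m (proj_m x))"
    by (rule seminorm_on_comp[OF m]) (simp_all add: proj_m_Wm proj_linear)
  moreover have "seminorm_on UNIV (\<lambda>x. v (B x y))" for y
    by (rule seminorm_on_functional0) (simp_all add: B_linear)
  ultimately have "seminorm_on UNIV (wedge_norm \<alpha>p \<alpha>m)"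
    unfolding wedge_norm_def[abs_def] norm_V0_def by (intro seminorm_on_min)
  moreover have "wedge_norm \<alpha>p \<alpha>m x = \<infinity> \<longleftrightarrow> x = 0" for x
  proof
    assume "wedge_norm \<alpha>p \<alpha>m x = \<infinity>"
    hence "B x em = 0" "B x ep = 0" "proj_p x = 0" "proj_m x = 0"
      using wedge_norm_le[of x] norm_infty_iff[OF norm_p proj_p_Wp] norm_infty_iff[OF norm_m proj_m_Wm]
      by (simp_all add: v_eq_infty_iff)
    thus "x = 0"
      using decomposition[of x] by simp
  next
    assume "x = 0"
    thus "wedge_norm \<alpha>p \<alpha>m x = \<infinity>"
      by (simp add: wedge_norm_def norm_V0_def Wp_components norm_p_0 norm_m_0)
  qed
  ultimately show ?thesis
    by (simp add: norm_on_iff_seminorm_on)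
qed

lemma norm_pairing_le:
  assumes "x \<in> Wp" "y \<in> Wm"
  shows "\<alpha>m y + \<alpha>p x \<le> v (B y x)"
  using dual_m[OF assms(2)] le_dual_norm_iff[OF norm_p, of "\<alpha>m y" y] assms(1) by simp

text \<open>In Zorn coordinates every component of the product is a sum of terms, each involving one
  component of \<open>x\<close> and one of \<open>y\<close>. Products of scalars and multiples of
  vectors are immediate, pairings are bounded by duality, cross products by \<open>mul_p\<close> and
  \<open>mul_m\<close>.\<close>

lemma wedge_norm_mul: "wedge_norm \<alpha>p \<alpha>m x + wedge_norm \<alpha>p \<alpha>m y \<le> wedge_norm \<alpha>p \<alpha>m (mul x y)"
proof -
  let ?n = "wedge_norm \<alpha>p \<alpha>m"
  note nx = wedge_norm_le[of x] and ny = wedge_norm_le[of y]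
  have 1: "?n x + ?n y \<le> v (B x em * B y em - B (proj_p x) (proj_m y))"
    "?n x + ?n y \<le> v (B x ep * B y ep - B (proj_p y) (proj_m x))"
    using norm_pairing_le[OF proj_p_Wp proj_m_Wm, of y x] norm_pairing_le[OF proj_p_Wp proj_m_Wm, of x y]
      add_mono[OF nx(1) ny(1)] add_mono[OF nx(2) ny(2)] add_mono[OF nx(3) ny(4)] add_mono[OF nx(4) ny(3)]
    by (auto intro!: le_v_diff simp: v_mult B_commute[of "proj_p _"] add.commute intro: order_trans)
  have 2: "?n x + ?n y \<le> \<alpha>p (scale (B x em) (proj_p y) + scale (B y ep) (proj_p x) + mul (proj_m x) (proj_m y))"
  proof (intro le_norm_add[OF norm_p])
    show "?n x + ?n y \<le> \<alpha>p (scale (B x em) (proj_p y))"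
      using norm_scale[OF norm_p proj_p_Wp] add_mono[OF nx(1) ny(3)] by simp
    show "?n x + ?n y \<le> \<alpha>p (scale (B y ep) (proj_p x))"
      using norm_scale[OF norm_p proj_p_Wp] add_mono[OF nx(3) ny(2)] by (simp add: add.commute)
    show "?n x + ?n y \<le> \<alpha>p (mul (proj_m x) (proj_m y))"
      using mul_m[OF proj_m_Wm proj_m_Wm, of x y] add_mono[OF nx(4) ny(4)] by (rule order_trans[rotated])
  qed (intro subspace_add[OF subspace_Wp] subspace_scale[OF subspace_Wp] mul_Wm_Wm proj_p_Wp proj_m_Wm)+
  have 3: "?n x + ?n y \<le> \<alpha>m (scale (B x ep) (proj_m y) + scale (B y em) (proj_m x) + mul (proj_p x) (proj_p y))"
  proof (intro le_norm_add[OF norm_m])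
    show "?n x + ?n y \<le> \<alpha>m (scale (B x ep) (proj_m y))"
      using norm_scale[OF norm_m proj_m_Wm] add_mono[OF nx(2) ny(4)] by simp
    show "?n x + ?n y \<le> \<alpha>m (scale (B y em) (proj_m x))"
      using norm_scale[OF norm_m proj_m_Wm] add_mono[OF nx(4) ny(1)] by (simp add: add.commute)
    show "?n x + ?n y \<le> \<alpha>m (mul (proj_p x) (proj_p y))"
      using mul_p[OF proj_p_Wp proj_p_Wp, of x y] add_mono[OF nx(3) ny(3)] by (rule order_trans[rotated])
  qed (intro subspace_add[OF subspace_Wm] subspace_scale[OF subspace_Wm] mul_Wp_Wp proj_p_Wp proj_m_Wm)+
  show ?thesis
    unfolding le_wedge_norm_iff mul_components using 1 2 3 by simp
qed

lemma wedge_norm_Wp: "x \<in> Wp \<Longrightarrow> wedge_norm \<alpha>p \<alpha>m x = \<alpha>p x"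
  by (simp add: wedge_norm_def norm_V0_def Wp_components Wp_D norm_m_0)

lemma wedge_norm_Wm: "x \<in> Wm \<Longrightarrow> wedge_norm \<alpha>p \<alpha>m x = \<alpha>m x"
  by (simp add: wedge_norm_def norm_V0_def Wm_components Wm_D norm_p_0)

lemma wedge_norm_V0: "x \<in> V0 \<Longrightarrow> wedge_norm \<alpha>p \<alpha>m x = norm_V0 x"
  by (simp add: wedge_norm_def V0_decomposition norm_p_0 norm_m_0)

lemma wedge_norm_W: "x \<in> W \<Longrightarrow> wedge_norm \<alpha>p \<alpha>m x = min (\<alpha>p (proj_p x)) (\<alpha>m (proj_m x))"
  by (simp add: wedge_norm_def norm_V0_def W_iff)

lemma wedge_norm_self_dual: "wedge_norm \<alpha>p \<alpha>m y = dual_norm v B UNIV (wedge_norm \<alpha>p \<alpha>m) y"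
proof (rule antisym)
  let ?n = "wedge_norm \<alpha>p \<alpha>m"
  have "?n y + ?n x \<le> v (B y x)" for x
  proof -
    note nx = wedge_norm_le[of x] and ny = wedge_norm_le[of y]
    have "?n y + ?n x \<le> v (B y em * B x ep)" "?n y + ?n x \<le> v (B y ep * B x em)"
      using add_mono[OF ny(1) nx(2)] add_mono[OF ny(2) nx(1)] by (simp_all add: v_mult)
    moreover have "?n y + ?n x \<le> v (B (proj_m y) (proj_p x))"
      using norm_pairing_le[OF proj_p_Wp proj_m_Wm, of y x] add_mono[OF ny(4) nx(3)]
      by (rule order_trans[rotated])
    moreover have "?n y + ?n x \<le> v (B (proj_p y) (proj_m x))"
      using norm_pairing_le[OF proj_p_Wp proj_m_Wm, of x y] add_mono[OF nx(4) ny(3)]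
      unfolding B_commute[of "proj_p y"] add.commute[of "?n y"] by (rule order_trans[rotated])
    ultimately show ?thesis
      by (subst B_decomposition) (intro le_v_add)
  qed
  thus "?n y \<le> dual_norm v B UNIV ?n y"
    unfolding le_dual_norm_iff[OF norm_wedge_norm] by simp
  have B_y: "B y x = B (proj_m y) x" if "x \<in> Wp" for x
    using that B_decomposition[of y x] Wp_components[OF that] by (simp add: Wp_D)
  have B_y': "B y x = B (proj_p y) x" if "x \<in> Wm" for x
    using that B_decomposition[of y x] Wm_components[OF that] by (simp add: Wm_D)
  have "dual_norm v B UNIV ?n y \<le> v (B y x) - ?n x" for x
    unfolding dual_norm_def by (rule INF_lower) simp
  note lower = this
  \<comment> \<open>Testing the infimum at \<open>em\<close>, at \<open>ep\<close>, on
    \<open>Wp\<close> and on \<open>Wm\<close> recovers the four components of \<open>y\<close>; on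
    the two halves this uses that each norm is dual to the other.\<close>
  have "dual_norm v B UNIV ?n y \<le> v (B y em)" "dual_norm v B UNIV ?n y \<le> v (B y ep)"
    using lower[of em] lower[of ep] wedge_norm_V0 ep_em
    by (simp_all add: norm_V0_def B_ep_ep B_em_em B_ep_em B_em_ep)
  moreover have "dual_norm v B UNIV ?n y \<le> \<alpha>m (proj_m y)"
    unfolding dual_m[OF proj_m_Wm] dual_norm_def[of v B Wp]
  proof (rule INF_greatest)
    fix x assume "x \<in> Wp"
    thus "dual_norm v B UNIV ?n y \<le> v (B (proj_m y) x) - \<alpha>p x"
      using lower[of x] by (simp add: B_y wedge_norm_Wp)
  qed
  moreover have "dual_norm v B UNIV ?n y \<le> \<alpha>p (proj_p y)"
    unfolding dual_p[OF proj_p_Wp] dual_norm_def[of v B Wm]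
  proof (rule INF_greatest)
    fix x assume "x \<in> Wm"
    thus "dual_norm v B UNIV ?n y \<le> v (B (proj_p y) x) - \<alpha>m x"
      using lower[of x] by (simp add: B_y' wedge_norm_Wm)
  qed
  ultimately show "dual_norm v B UNIV ?n y \<le> ?n y"
    unfolding le_wedge_norm_iff by simp
qed

lemma self_dual_wedge_norm: "self_dual_algebra_norm v scale mul B UNIV (wedge_norm \<alpha>p \<alpha>m)"
  using norm_wedge_norm wedge_norm_self_dual wedge_norm_mul by (intro self_dual_algebra_normI)

lemma wedge_norm_add:
  assumes x: "x \<in> V0" and y: "y \<in> W"
  shows "wedge_norm \<alpha>p \<alpha>m (x + y) = min (norm_V0 x) (min (\<alpha>p (proj_p y)) (\<alpha>m (proj_m y)))"
  using V0_decomposition[OF x] y by (simp add: wedge_norm_def norm_V0_def proj_linear B_linear W_iff)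

lemma wedge_norm_split: "norm_split_by scale UNIV V0 W (wedge_norm \<alpha>p \<alpha>m)"
  by (rule norm_split_byI[OF direct_sum_V0_W]) (simp add: wedge_norm_add wedge_norm_V0 wedge_norm_W)

lemma wedge_eq_wedge_norm:
  assumes \<alpha>0: "self_dual_algebra_norm v scale mul B V0 \<alpha>0"
  shows "wedge V0 W \<alpha>0 (wedge Wp Wm \<alpha>p \<alpha>m) = wedge_norm \<alpha>p \<alpha>m"
proof
  fix x
  have V0: "scale (B x em) ep + scale (B x ep) em \<in> V0"
    using ep_em subspace_V0 by (intro subspace_add subspace_scale)
  have "wedge V0 W \<alpha>0 (wedge Wp Wm \<alpha>p \<alpha>m) x =
      wedge V0 W \<alpha>0 (wedge Wp Wm \<alpha>p \<alpha>m) (scale (B x em) ep + scale (B x ep) em + (proj_p x + proj_m x))"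
    using decomposition[of x] by simp
  also have "\<dots> = wedge_norm \<alpha>p \<alpha>m x"
    unfolding wedge_eq[OF direct_sum_V0_W V0 Wp_add_Wm[OF proj_p_Wp proj_m_Wm]]
      wedge_eq[OF direct_sum_Wp_Wm proj_p_Wp proj_m_Wm] V0_norm_unique[OF \<alpha>0 V0]
    by (simp add: wedge_norm_def norm_V0_def B_linear B_ep_ep B_em_em B_ep_em B_em_ep)
  finally show "wedge V0 W \<alpha>0 (wedge Wp Wm \<alpha>p \<alpha>m) x = wedge_norm \<alpha>p \<alpha>m x" .
qed

end

text \<open>Derives the hypotheses on a dual pair from volume zero alone. The last inequality is the
  third one for \<open>M\<close> in the swapped polarization, rewritten by biduality, so
  \<open>M\<close> must have volume zero as well.\<close>

lemma dual_pair_of_volume_0: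
  assumes L0: "special_normalization v scale mul B Wp Wm L0"
    and N: "norm_on v scale Wp N" and vol: "norm_vol v scale Wp L0 N = 0"
    and M: "\<And>y. y \<in> Wm \<Longrightarrow> M y = dual_norm v B Wp N y"
  shows "norm_on v scale Wm M" "x \<in> Wp \<Longrightarrow> N x = dual_norm v B Wm M x"
    "x \<in> Wp \<Longrightarrow> y \<in> Wp \<Longrightarrow> N x + N y \<le> M (mul x y)"
    "x \<in> Wm \<Longrightarrow> y \<in> Wm \<Longrightarrow> M x + M y \<le> N (mul x y)"
proof -
  interpret s: valued_polarization v p scale mul unit Q V0 em ep
    by (rule valued_swap)
  obtain bs where "special_basis scale mul B Wp Wm bs"
    by (rule special_basis_exists)
  hence "basis_of scale Wp bs"
    using special_basis_iff by simp
  then obtain es where es: "basis_of scale Wp es" "basis_splits_norm scale es N"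
    by (rule exists_splitting_basis[OF N])
  obtain gs where gs: "dual_basis_of scale B Wm es gs"
    by (rule dual_basis_exists[OF es(1)])
  have vol0: "v (Wp.TL es) - (\<Sum>i<3. N (es ! i)) = 0"
    using norm_vol_special[OF L0 N es] vol by simp
  show norm: "norm_on v scale Wm M"
    by (rule norm_dual[OF N es gs M])
  show bidual: "N x = dual_norm v B Wm M x" if "x \<in> Wp" for x
    by (rule bidual_norm[OF N es gs M that])
  show "N x + N y \<le> M (mul x y)" if "x \<in> Wp" "y \<in> Wp"
    using norm_mul_le_dual_norm[OF N es vol0 that] M[OF mul_Wp_Wp[OF that]] by simp
  obtain k where "\<forall>i<3. N (es ! i) = ereal (k i)" "\<forall>i<3. k i \<in> \<rat>"
    by (rule N_es[OF N es gs])
  hence k: "\<And>i. i < 3 \<Longrightarrow> N (es ! i) = ereal (k i)" "\<And>i. i < 3 \<Longrightarrow> k i \<in> \<rat>"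
    by simp_all
  obtain n :: int where n: "v (Wp.TL es) = ereal n"
    by (rule Wp.v_TL[OF es(1)])
  have "real_of_int n = (\<Sum>i<3. k i)"
    using vol0 n k(1) by (simp add: zero_ereal_def)
  \<comment> \<open>The dual basis inverts \<open>T\<close>, and the dual norm takes opposite values
    on it, so its volume is the negative of that of \<open>N\<close>.\<close>
  hence "v (Wp.TL gs) - (\<Sum>i<3. M (gs ! i)) = 0"
    unfolding dual_TL[OF es(1) gs] v_inverse[OF Wp.TL_nonzero[OF es(1)]] n
    using dual_norm_nth[OF N es gs M] k(1) by (simp add: sum_negf zero_ereal_def)
  moreover note norm dual_basis_flip(1)[OF es(1) gs] dual_norm_splits[OF N es gs M]
  ultimately have "M x + M y \<le> dual_norm v B Wm M (mul x y)" if "x \<in> Wm" "y \<in> Wm"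
    using s.norm_mul_le_dual_norm[of M gs x y] that by (simp add: swap_Wp)
  thus "M x + M y \<le> N (mul x y)" if "x \<in> Wm" "y \<in> Wm"
    using bidual[OF mul_Wm_Wm[OF that]] that by simp
qed

end

theorem proposition1p14:
  fixes v :: "'a::field \<Rightarrow> ereal" and p :: nat
    and scale :: "'a \<Rightarrow> 'v::ab_group_add \<Rightarrow> 'v"
    and mul :: "'v \<Rightarrow> 'v \<Rightarrow> 'v" and unit :: 'v and Q :: "'v \<Rightarrow> 'a"
    and f :: "'v \<Rightarrow> 'v \<Rightarrow> 'a"
    and V0 W Wp Wm :: "'v set" and ep em :: 'v
  assumes local_field: "local_field v p" and p: "p \<notin> {2, 3}"
    and octonion: "split_octonion_algebra scale mul unit Q"
    and f: "f = polar Q"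
    and V0: "split_composition_subalgebra scale mul unit Q V0" "vector_space.dim scale V0 = 2"
    and idempotents: "ep \<in> V0" "em \<in> V0" "ep \<noteq> 0" "em \<noteq> 0"
      "mul ep ep = ep" "mul em em = em" "mul ep em = 0"
    and W: "W = orth_compl f V0"
    and Wp: "Wp = mul ep ` W" and Wm: "Wm = mul em ` W"
  shows
    "\<comment> \<open>(i)\<close>
     (\<forall>\<alpha>. self_dual_algebra_norm v scale mul f UNIV \<alpha> \<and> norm_split_by scale UNIV V0 W \<alpha> \<longrightarrow>
        norm_split_by scale W Wp Wm \<alpha> \<and> (\<forall>x\<in>Wm. \<alpha> x = dual_norm v f Wp \<alpha> x)) \<and>
     \<comment> \<open>(ii)\<close>
     (\<forall>f1 f2 f3 g1 g2 g3.
        basis_of scale Wp [f1, f2, f3] \<and> dual_basis_of scale f Wm [f1, f2, f3] [g1, g2, g3] \<longrightarrow>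
        (\<exists>c. c \<noteq> 0 \<and> mul g1 g2 = scale c f3)) \<and>
     (\<forall>L0 bs cs. lattice_in v scale Wp L0 \<and>
        special_basis scale mul f Wp Wm bs \<and> special_basis scale mul f Wp Wm cs \<longrightarrow>
        lattice_vol v scale Wp L0 (lattice_gen v scale bs) =
        lattice_vol v scale Wp L0 (lattice_gen v scale cs)) \<and>
     \<comment> \<open>(iii)\<close>
     (\<forall>L0 \<alpha>. special_normalization v scale mul f Wp Wm L0 \<and>
        self_dual_algebra_norm v scale mul f UNIV \<alpha> \<and> norm_split_by scale UNIV V0 W \<alpha> \<longrightarrow>
        norm_vol v scale Wp L0 \<alpha> = 0) \<and>
     \<comment> \<open>(iv)\<close>
     (\<exists>\<alpha>0. self_dual_algebra_norm v scale mul f V0 \<alpha>0 \<and>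
        (\<forall>\<beta>. self_dual_algebra_norm v scale mul f V0 \<beta> \<longrightarrow> (\<forall>x\<in>V0. \<beta> x = \<alpha>0 x))) \<and>
     (\<forall>L0 \<alpha>p \<alpha>m \<alpha>0 \<beta>. special_normalization v scale mul f Wp Wm L0 \<and>
        norm_on v scale Wp \<alpha>p \<and> norm_vol v scale Wp L0 \<alpha>p = 0 \<and>
        (\<forall>x\<in>Wm. \<alpha>m x = dual_norm v f Wp \<alpha>p x) \<and>
        self_dual_algebra_norm v scale mul f V0 \<alpha>0 \<and>
        \<beta> = wedge V0 W \<alpha>0 (wedge Wp Wm \<alpha>p \<alpha>m) \<longrightarrow>
        norm_on v scale Wm \<alpha>m \<and>
        self_dual_algebra_norm v scale mul f UNIV \<beta> \<and>
        norm_split_by scale UNIV V0 W \<beta> \<and> (\<forall>x\<in>Wp. \<beta> x = \<alpha>p x) \<and>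
        (\<forall>\<gamma>. self_dual_algebra_norm v scale mul f UNIV \<gamma> \<and>
             norm_split_by scale UNIV V0 W \<gamma> \<and> (\<forall>x\<in>Wp. \<gamma> x = \<alpha>p x) \<longrightarrow> \<gamma> = \<beta>))"
proof -
  interpret local_field v p
    by (rule local_field)
  interpret split_octonion_algebra scale mul unit Q
    by (rule octonion)
  interpret P: valued_polarization v p scale mul unit Q V0 ep em
    using V0 idempotents by unfold_locales
  have Wp': "Wp = P.Wp" and Wm': "Wm = P.Wm"
    by (simp_all add: Wp Wm W f P.Wp_def P.Wm_def)
  show ?thesis
    unfolding f W[unfolded f] Wp' Wm'
  proof (intro conjI allI impI; (elim conjE)?)
    \<comment> \<open>Claims (i) and (iii) make the same assumptions on \<open>\<alpha>\<close> and
      share this block; the reference lattice enters only for the volume.\<close>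
    fix \<alpha>
    assume \<alpha>: "self_dual_algebra_norm v scale mul B UNIV \<alpha>" "norm_split_by scale UNIV V0 P.W \<alpha>"
    show "norm_split_by scale P.W P.Wp P.Wm \<alpha>"
      by (rule norm_split_byI[OF P.direct_sum_Wp_Wm P.split_Wp_Wm[OF \<alpha>]])
    show "\<forall>x\<in>P.Wm. \<alpha> x = dual_norm v B P.Wp \<alpha> x"
      using P.dual_norm_Wm[OF \<alpha>] by simp
    fix L0
    assume L0: "special_normalization v scale mul B P.Wp P.Wm L0"
    obtain bs where "special_basis scale mul B P.Wp P.Wm bs"
      by (rule P.special_basis_exists)
    hence "basis_of scale P.Wp bs"
      using P.special_basis_iff by simp
    then obtain es where es: "basis_of scale P.Wp es" "basis_splits_norm scale es \<alpha>"
      by (rule P.exists_splitting_basis[OF P.norm_\<alpha>[OF \<alpha>]])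
    show "norm_vol v scale P.Wp L0 \<alpha> = 0"
      using P.norm_vol_special[OF L0 P.norm_\<alpha>[OF \<alpha>] es] P.splitting_basis_volume_eq_0[OF \<alpha> es] by simp
  next
    fix f1 f2 f3 g1 g2 g3
    assume b: "basis_of scale P.Wp [f1, f2, f3]" and d: "dual_basis_of scale B P.Wm [f1, f2, f3] [g1, g2, g3]"
    have "P.T f1 f2 f3 \<noteq> 0"
      using P.Wp.TL_nonzero[OF b] by simp
    with P.dual_basis_mul[OF b d] show "\<exists>c. c \<noteq> 0 \<and> mul g1 g2 = scale c f3"
      by (intro exI[of _ "inverse (P.T f1 f2 f3)"]) simp
  next
    fix L0 bs cs
    assume "lattice_in v scale P.Wp L0"
    then obtain ls where ls: "basis_of scale P.Wp ls" "L0 = lattice_gen v scale ls"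
      by (auto simp: lattice_in_def)
    assume "special_basis scale mul B P.Wp P.Wm bs" "special_basis scale mul B P.Wp P.Wm cs"
    thus "lattice_vol v scale P.Wp L0 (lattice_gen v scale bs) =
        lattice_vol v scale P.Wp L0 (lattice_gen v scale cs)"
      unfolding ls(2) P.special_basis_iff using P.Wp.lattice_vol_eq[OF ls(1)] by simp
  next
    show "\<exists>\<alpha>0. self_dual_algebra_norm v scale mul B V0 \<alpha>0 \<and>
        (\<forall>\<beta>. self_dual_algebra_norm v scale mul B V0 \<beta> \<longrightarrow> (\<forall>x\<in>V0. \<beta> x = \<alpha>0 x))"
      using P.self_dual_norm_V0 P.V0_norm_unique by (intro exI[of _ P.norm_V0]) simp
  next
    fix L0 \<alpha>p \<alpha>m \<alpha>0 \<beta>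
    assume L0: "special_normalization v scale mul B P.Wp P.Wm L0"
      and \<alpha>p: "norm_on v scale P.Wp \<alpha>p" "norm_vol v scale P.Wp L0 \<alpha>p = 0"
      and "\<forall>x\<in>P.Wm. \<alpha>m x = dual_norm v B P.Wp \<alpha>p x"
      and \<alpha>0: "self_dual_algebra_norm v scale mul B V0 \<alpha>0"
      and \<beta>: "\<beta> = wedge V0 P.W \<alpha>0 (wedge P.Wp P.Wm \<alpha>p \<alpha>m)"
    hence \<alpha>m: "\<alpha>m y = dual_norm v B P.Wp \<alpha>p y" if "y \<in> P.Wm" for y
      using that by simp
    note pair = P.dual_pair_of_volume_0[OF L0 \<alpha>p \<alpha>m]
    note ctxt = \<alpha>p(1) pair(1) \<alpha>m pair(2-4)
    have \<beta>': "\<beta> = P.wedge_norm \<alpha>p \<alpha>m"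
      unfolding \<beta> by (rule P.wedge_eq_wedge_norm[OF ctxt \<alpha>0])
    show "norm_on v scale P.Wm \<alpha>m"
      by (rule pair(1))
    show "self_dual_algebra_norm v scale mul B UNIV \<beta>"
      unfolding \<beta>' by (rule P.self_dual_wedge_norm[OF ctxt])
    show "norm_split_by scale UNIV V0 P.W \<beta>"
      unfolding \<beta>' by (rule P.wedge_norm_split[OF ctxt])
    show "\<forall>x\<in>P.Wp. \<beta> x = \<alpha>p x"
      unfolding \<beta>' using P.wedge_norm_Wp[OF ctxt] by simp
    fix \<gamma>
    assume \<gamma>: "self_dual_algebra_norm v scale mul B UNIV \<gamma>" "norm_split_by scale UNIV V0 P.W \<gamma>"
      and ext: "\<forall>x\<in>P.Wp. \<gamma> x = \<alpha>p x"
    \<comment> \<open>The dual norm sees only the values of \<open>\<gamma>\<close> on the other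
      half, and these are prescribed.\<close>
    have "\<gamma> y = \<alpha>m y" if "y \<in> P.Wm" for y
      using P.dual_norm_Wm[OF \<gamma> that] \<alpha>m[OF that] ext by (simp add: dual_norm_def)
    \<comment> \<open>Both functions have the closed form \<open>wedge_norm\<close>, with the same
      contribution \<open>norm_V0\<close> and the same restrictions to the two halves.\<close>
    show "\<gamma> = \<beta>"
    proof
      fix x
      show "\<gamma> x = \<beta> x"
        using P.norm_eq_wedge_norm[OF \<gamma>, of x] ext \<open>\<And>y. y \<in> P.Wm \<Longrightarrow> \<gamma> y = \<alpha>m y\<close>
        by (simp add: \<beta>' P.wedge_norm_def P.proj_p_Wp P.proj_m_Wm)
    qed
  qed
qed

end
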